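(* Let $d$ and $r$ be positive integers and let $P\colon \mathbb{F}_2^m\to\mathbb{F}_2$ be a function (for any $m$) with $\operatorname{rank}_d(P)=r$. Then \[ \Bigl|\Pr_{X}[P(X)=1]-\tfrac{1}{3}\Bigr|\ \ge\ \delta_{d,r}, \] where $X$ is uniform on $\mathbb{F}_2^m$ and $\delta_{d,r}>0$ is a constant depending only on $d$ and $r$ (not on $m$), which can be taken to be $2^{-\psi^*_{d,f}(r)}/12$ for $f(k)=c_{KL}\bigl(d,\tfrac14 2^{-3k/2}\bigr)$.
   Context: Polynomials over $\mathbb{F}_2$ are multilinear polynomials viewed as functions $\mathbb{F}_2^m\to\mathbb{F}_2$; "degree $d$" means degree at most $d$. For a function $P\colon\mathbb{F}_2^m\to\mathbb{F}_2$ not identically zero, $\operatorname{rank}_d(P)$ is the smallest positive integer $k$ such that there are polynomials $Q_1,\dots,Q_k$ of degree at most $d$ and a function $\Gamma\colon\mathbb{F}_2^k\to\mathbb{F}_2$ with $P(x)=\Gamma(Q_1(x),\dots,Q_k(x))$ for all $x$. The bias of a polynomial $P$ is $|\mathbb{E}_X[(-1)^{P(X)}]|$. $c_{KL}(d,\delta)$ denotes a fixed function (whose existence is the Kaufman–Lovett bias-implies-low-rank theorem) such that every polynomial over $\mathbb{F}_2$ of degree at most $d$ with bias at least $\delta>0$ has $\operatorname{rank}_{d-1}\le c_{KL}(d,\delta)$. For a function $f\colon\mathbb{N}\to\mathbb{N}$ and positive integer $d$, $\psi_{d,f}\colon\mathbb{N}^d\to\mathbb{N}$ is defined recursively: $\psi_{d,f}(M_1,0,\dots,0)=M_1$;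 otherwise, if $\ell\ge2$ is the smallest index with $M_\ell>0$, $\psi_{d,f}(M_1,\dots,M_d)=\psi_{d,f}(M_1,\dots,M_{\ell-1}+f(\sum_iM_i),M_\ell-1,\dots,M_d)$. Set $\psi^*_{d,f}(K)=\psi_{d,f}(0,\dots,0,K)$. *)

theory Defs
  imports Complex_Main
begin

text \<open>Points of F_2^m are represented as subsets x of {..<m} (the support of the
0/1 vector).  A multilinear polynomial over F_2 in the variables x_0,...,x_{m-1}
is a set M of monomials (each monomial a subset S of {..<m}, standing for the
product of x_i, i in S); its value at x is the parity of the number of monomials
S in M with S a subset of x.  Degree at most d means every monomial has at most d
variables.\<close>

definition points :: "nat \<Rightarrow> nat set set" where
  "points m = Pow {..<m}"

definition poly_eval :: "nat set set \<Rightarrow> nat set \<Rightarrow> bool" where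
  "poly_eval M x = odd (card {S \<in> M. S \<subseteq> x})"

definition is_poly_deg :: "nat \<Rightarrow> nat \<Rightarrow> (nat set \<Rightarrow> bool) \<Rightarrow> bool" where
  "is_poly_deg m d Q \<longleftrightarrow>
     (\<exists>M. M \<subseteq> {S. S \<subseteq> {..<m} \<and> card S \<le> d} \<and>
          (\<forall>x \<in> points m. Q x = poly_eval M x))"

definition rank_deg :: "nat \<Rightarrow> nat \<Rightarrow> (nat set \<Rightarrow> bool) \<Rightarrow> nat" where
  "rank_deg m d P = (LEAST k. k > 0 \<and>
     (\<exists>(Q :: nat \<Rightarrow> nat set \<Rightarrow> bool) (\<Gamma> :: bool list \<Rightarrow> bool).
        (\<forall>i<k. is_poly_deg m d (Q i)) \<and>
        (\<forall>x \<in> points m. P x = \<Gamma> (map (\<lambda>i. Q i x) [0..<k]))))"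

definition bias :: "nat \<Rightarrow> (nat set \<Rightarrow> bool) \<Rightarrow> real" where
  "bias m P = \<bar>(\<Sum>x \<in> points m. (if P x then -1 else 1 :: real)) / 2 ^ m\<bar>"

definition prob_one :: "nat \<Rightarrow> (nat set \<Rightarrow> bool) \<Rightarrow> real" where
  "prob_one m P = real (card {x \<in> points m. P x}) / 2 ^ m"

definition KL_bound :: "(nat \<Rightarrow> real \<Rightarrow> nat) \<Rightarrow> bool" where
  "KL_bound c \<longleftrightarrow>
     (\<forall>d m \<delta> Q. d > 0 \<longrightarrow> \<delta> > 0 \<longrightarrow> is_poly_deg m d Q \<longrightarrow>
        (\<exists>x \<in> points m. Q x) \<longrightarrow> bias m Q \<ge> \<delta> \<longrightarrow>
        rank_deg m (d - 1) Q \<le> c d \<delta>)"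

text \<open>psi_{d,f} on lists [M_1,...,M_d] (list index i = paper index i+1).\<close>

definition psi_step :: "(nat \<Rightarrow> nat) \<Rightarrow> nat list \<Rightarrow> nat list" where
  "psi_step f M = (let l = (LEAST l. 1 \<le> l \<and> l < length M \<and> M ! l > 0) in
      M[l - 1 := M ! (l - 1) + f (sum_list M), l := M ! l - 1])"

lemma rev_lex_lemma:
  assumes "length xs = length ys" "j < length ys" "xs ! j < ys ! j"
    and "\<And>i. j < i \<Longrightarrow> i < length ys \<Longrightarrow> xs ! i = ys ! i"
  shows "(rev xs, rev ys) \<in> lex less_than"
proof -
  have dr: "drop (Suc j) xs = drop (Suc j) ys"
    using assms by (intro nth_equalityI) auto
  have xs: "xs = take j xs @ xs ! j # drop (Suc j) xs"
    using assms by (simp add: id_take_nth_drop)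
  have ys: "ys = take j ys @ ys ! j # drop (Suc j) ys"
    using assms by (simp add: id_take_nth_drop)
  have "rev xs = rev (drop (Suc j) ys) @ xs ! j # rev (take j xs)"
    using xs dr by (metis append.assoc append_Cons rev.simps(2) rev_append self_append_conv2)
  moreover have "rev ys = rev (drop (Suc j) ys) @ ys ! j # rev (take j ys)"
    using ys by (metis append.assoc append_Cons rev.simps(2) rev_append self_append_conv2)
  ultimately show ?thesis using assms(1,3)
    by (auto simp: lex_conv intro!: exI[of _ "rev (drop (Suc j) ys)"])
qed

function psi :: "(nat \<Rightarrow> nat) \<Rightarrow> nat list \<Rightarrow> nat" where
  "psi f M = (if (\<forall>i. 1 \<le> i \<and> i < length M \<longrightarrow> M ! i = 0)
              then (if M = [] then 0 else hd M)
              else psi f (psi_step f M))"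
  by auto
termination
proof (relation "inv_image (lex less_than) (rev \<circ> snd)")
  show "wf (inv_image (lex less_than) (rev \<circ> snd))" by (intro wf_inv_image wf_lex wf_less_than)
next
  fix f :: "nat \<Rightarrow> nat" and M :: "nat list"
  assume h: "\<not> (\<forall>i. 1 \<le> i \<and> i < length M \<longrightarrow> M ! i = 0)"
  define l where "l = (LEAST l. 1 \<le> l \<and> l < length M \<and> M ! l > 0)"
  have ex: "\<exists>l. 1 \<le> l \<and> l < length M \<and> M ! l > 0" using h by auto
  have l: "1 \<le> l" "l < length M" "M ! l > 0"
    using LeastI_ex[OF ex] unfolding l_def by auto
  have st: "psi_step f M = M[l - 1 := M ! (l - 1) + f (sum_list M), l := M ! l - 1]"
    unfolding psi_step_def l_def Let_def by simp
  show "((f, psi_step f M), f, M) \<in> inv_image (lex less_than) (rev \<circ> snd)"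
    unfolding st using l
    by (auto intro!: rev_lex_lemma[where j = l] simp: nth_list_update)
qed

definition psi_star :: "nat \<Rightarrow> (nat \<Rightarrow> nat) \<Rightarrow> nat \<Rightarrow> nat" where
  "psi_star d f K = psi f (replicate (d - 1) 0 @ [K])"

end

theory Submission
  imports Defs "HOL-Library.Function_Algebras" "HOL-Library.Product_Plus" "HOL-Library.FuncSet" "HOL-Library.Z2"
begin

text \<open>
  The parameter f of psi uses c(d, -) at every degree, while nothing relates c(d, -) to c(e, -) for
  e < d. Hence the Kaufman-Lovett bound is used only for the top degree d. Polynomials P determined by
  a family F of polynomials are described by the patterns of F; if no product of members of F has
  noticeable bias, Parseval shows that Pr[P = 1] is close to a multiple of 2^{-|F|}, hence far from 1/3.
  Otherwise a biased product allows one member of F to be traded for polynomials of lower degree. For a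
  biased product of degree d this is the hypothesis on c. For lower degrees a quantitative structure
  theorem is proved from scratch: a biased polynomial is approximated by a function of a bounded number of its
  derivatives (Bogdanov-Viola), and regularizing the derivatives turns the approximation
  into an exact identity, at the price of a fixed iterated growth function.

  This price is affordable because f cannot be too small. Let w(k) be the worst rank over all
  polynomials of degree d whose bias is at least twice the threshold of f(k). Adding a term t * B(w) in fresh
  variables, with B of degree d - 1 nearly orthogonal to degree d - 2, halves the bias at most and raises
  the rank by one, so that f(k) > w(k) and w(k + 1) > w(k); iterating it from a constant gives w(k) > 3k.
\<close>

section \<open>Averages over finite groups of exponent two\<close>

text \<open>A biased product is at first only approximated, with an error averaged over points,
  while trading a member needs an identity at every point. The bridge is self-correction: a
  derivative of too high an order is trivial, so a value is a product of values at the other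
  vertices of a random cube, and these points are uniform. The price is that patterns at the new
  vertices enter the formula. Regularity makes the derivatives that are not forced by lower members
  nearly independent, so those involving the new directions can be frozen to constants. The error
  bound then holds at each base point; if no direction is left, nothing is random, and an error
  below 1 is an identity. The recursion psi is followed only through a lower bound on the sum of its
  list. Spending one unit of an entry creates many units of the entry before it, which gives a
  hierarchy of iterated functions. One unit of the entry for degree d - 1 pays for a whole
  regularization of the degrees below d - 1, although that regularization is itself an iterated
  function; those degrees need no entries of their own.\<close>

definition elem2 :: "'v::ab_group_add set \<Rightarrow> bool" where
  "elem2 V \<longleftrightarrow> finite V \<and> 0 \<in> V \<and> (\<forall>x\<in>V. \<forall>y\<in>V. x + y \<in> V) \<and> (\<forall>x\<in>V. x + x = 0)"

definition av :: "'a set \<Rightarrow> ('a \<Rightarrow> real) \<Rightarrow> real" where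
  "av V f = (\<Sum>x\<in>V. f x) / real (card V)"

lemma sgD: assumes "elem2 V" shows "finite V" "0 \<in> V" "V \<noteq> {}"
    "\<And>x y. x \<in> V \<Longrightarrow> y \<in> V \<Longrightarrow> x + y \<in> V" "\<And>x. x \<in> V \<Longrightarrow> x + x = 0"
  using assms unfolding elem2_def by auto

lemma sg_sum: assumes "elem2 V" "finite I" "\<And>i. i \<in> I \<Longrightarrow> h i \<in> V" shows "sum h I \<in> V"
  using assms(2,3) by (induction I rule: finite_induct) (auto simp: sgD[OF assms(1)])

lemma sg_cancel: assumes "elem2 V" "a \<in> V" shows "x + a + a = x" "a + (a + x) = x"
proof -
  show "x + a + a = x" by (simp only: add.assoc sgD(5)[OF assms] add_0_right)
  show "a + (a + x) = x" by (simp only: add.assoc[symmetric] sgD(5)[OF assms] add_0_left)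
qed

lemma av_cong: "V = W \<Longrightarrow> (\<And>x. x \<in> W \<Longrightarrow> f x = g x) \<Longrightarrow> av V f = av W g"
  unfolding av_def by simp

lemma av_const: "finite V \<Longrightarrow> V \<noteq> {} \<Longrightarrow> av V (\<lambda>x. c) = c"
  unfolding av_def by simp

lemma av_add: "av V (\<lambda>x. f x + g x) = av V f + av V g"
  unfolding av_def by (simp add: sum.distrib add_divide_distrib)

lemma av_diff: "av V (\<lambda>x. f x - g x) = av V f - av V g"
  unfolding av_def by (simp add: sum_subtractf diff_divide_distrib)

lemma av_cmult: "av V (\<lambda>x. c * f x) = c * av V f"
  unfolding av_def by (simp add: sum_distrib_left)

lemma av_cmult_right: "av V (\<lambda>x. f x * c) = av V f * c"
  unfolding av_def by (simp add: sum_distrib_right)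

lemma av_sum: "av V (\<lambda>x. \<Sum>i\<in>I. f i x) = (\<Sum>i\<in>I. av V (f i))"
  unfolding av_def by (subst sum.swap) (simp add: sum_divide_distrib)

lemma av_mono: "(\<And>x. x \<in> V \<Longrightarrow> f x \<le> g x) \<Longrightarrow> av V f \<le> av V g"
  unfolding av_def by (intro divide_right_mono sum_mono) auto

lemma av_nonneg: "(\<And>x. x \<in> V \<Longrightarrow> 0 \<le> f x) \<Longrightarrow> 0 \<le> av V f"
  unfolding av_def by (intro divide_nonneg_nonneg sum_nonneg) auto

lemma av_abs: "\<bar>av V f\<bar> \<le> av V (\<lambda>x. \<bar>f x\<bar>)"
  unfolding av_def by (simp add: divide_right_mono sum_abs)

lemma av_swap: "av V (\<lambda>x. av W (\<lambda>y. f x y)) = av W (\<lambda>y. av V (\<lambda>x. f x y))"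
  unfolding av_def sum_divide_distrib[symmetric] by (subst sum.swap) (simp add: mult.commute)

lemma av_prod: "av (V \<times> W) f = av V (\<lambda>x. av W (\<lambda>y. f (x, y)))"
  unfolding av_def sum_divide_distrib[symmetric]
  by (simp add: sum.cartesian_product card_cartesian_product mult.commute)

lemma av_bij: "bij_betw g V V \<Longrightarrow> av V (\<lambda>x. f (g x)) = av V f"
  unfolding av_def using sum.reindex_bij_betw[of g V V f] by simp

lemma sg_shift_bij: assumes "elem2 V" "a \<in> V" shows "bij_betw (\<lambda>x. x + a) V V"
  using assms by (intro bij_betwI[where g = "\<lambda>x. x + a"]) (auto simp: sgD sg_cancel)

lemma av_shift: assumes "elem2 V" "a \<in> V" shows "av V (\<lambda>x. f (x + a)) = av V f"
  using av_bij[OF sg_shift_bij[OF assms]] .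

lemma av_shift': assumes "elem2 V" "a \<in> V" shows "av V (\<lambda>x. f (a + x)) = av V f"
  using av_shift[OF assms, of f] by (simp add: add.commute)

lemma av_sq: assumes "finite V" shows "(av V f)\<^sup>2 \<le> av V (\<lambda>x. (f x)\<^sup>2)"
proof (cases "V = {}")
  case True then show ?thesis by (simp add: av_def)
next
  case False
  have "0 \<le> av V (\<lambda>x. (f x - av V f)\<^sup>2)" by (rule av_nonneg) simp
  also have "\<dots> = av V (\<lambda>x. (f x)\<^sup>2 - 2 * av V f * f x + (av V f)\<^sup>2)"
    by (rule av_cong) (auto simp: power2_eq_square algebra_simps)
  also have "\<dots> = av V (\<lambda>x. (f x)\<^sup>2) - (av V f)\<^sup>2"
    by (simp add: av_add av_diff av_cmult av_const assms False power2_eq_square)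
  finally show ?thesis by simp
qed

lemma av_pow: assumes "finite V" shows "\<bar>av V f\<bar> ^ (2 ^ j) \<le> av V (\<lambda>x. \<bar>f x\<bar> ^ (2 ^ j))"
proof (induction j)
  case 0 show ?case using av_abs[of V f] by simp
next
  case (Suc j)
  have "\<bar>av V f\<bar> ^ (2 ^ Suc j) = (\<bar>av V f\<bar> ^ (2 ^ j))\<^sup>2" by (simp add: power_mult[symmetric] mult.commute)
  also have "\<dots> \<le> (av V (\<lambda>x. \<bar>f x\<bar> ^ (2 ^ j)))\<^sup>2" by (rule power_mono[OF Suc]) simp
  also have "\<dots> \<le> av V (\<lambda>x. (\<bar>f x\<bar> ^ (2 ^ j))\<^sup>2)" by (rule av_sq[OF assms])
  also have "\<dots> = av V (\<lambda>x. \<bar>f x\<bar> ^ (2 ^ Suc j))" by (simp add: power_mult[symmetric] mult.commute)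
  finally show ?case .
qed

definition pr :: "'a set \<Rightarrow> ('a \<Rightarrow> bool) \<Rightarrow> real" where
  "pr V P = av V (\<lambda>x. of_bool (P x))"

lemma pr_mono: "(\<And>x. x \<in> V \<Longrightarrow> P x \<Longrightarrow> Q x) \<Longrightarrow> pr V P \<le> pr V Q"
  unfolding pr_def by (rule av_mono) auto

lemma pr_disj: "pr V (\<lambda>x. P x \<or> Q x) \<le> pr V P + pr V Q"
  unfolding pr_def av_add[symmetric] by (rule av_mono) auto

lemma pr_nonneg: "0 \<le> pr V P" unfolding pr_def by (rule av_nonneg) auto

lemma pr_union: "finite I \<Longrightarrow> pr V (\<lambda>x. \<exists>i\<in>I. P i x) \<le> (\<Sum>i\<in>I. pr V (P i))"
proof (induction I rule: finite_induct)
  case empty then show ?case by (simp add: pr_def av_def)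
next
  case (insert i I)
  have "pr V (\<lambda>x. \<exists>k\<in>insert i I. P k x) \<le> pr V (\<lambda>x. P i x \<or> (\<exists>k\<in>I. P k x))" by (rule pr_mono) auto
  also have "\<dots> \<le> pr V (P i) + pr V (\<lambda>x. \<exists>k\<in>I. P k x)" by (rule pr_disj)
  finally show ?case using insert by simp
qed

lemma av_exists_le: assumes "finite V" "V \<noteq> {}" "av V f \<le> c" shows "\<exists>x\<in>V. f x \<le> c"
proof (rule ccontr)
  assume n: "\<not> ?thesis"
  have "(\<Sum>x\<in>V. c) < (\<Sum>x\<in>V. f x)" using n assms by (intro sum_strict_mono) auto
  then have "c * real (card V) < (\<Sum>x\<in>V. f x)" by (simp add: mult.commute)
  then have "c < av V f" using assms by (simp add: av_def pos_less_divide_eq card_gt_0_iff)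
  then show False using assms by simp
qed

text \<open>A product set \<open>A\<^sup>I\<close>, realised as functions that are constant outside \<open>I\<close>.\<close>

definition cub :: "'i set \<Rightarrow> 'a set \<Rightarrow> 'a \<Rightarrow> ('i \<Rightarrow> 'a) set" where
  "cub I A c = {z. (\<forall>i\<in>I. z i \<in> A) \<and> (\<forall>i. i \<notin> I \<longrightarrow> z i = c)}"

lemma cub_empty: "cub {} A c = {\<lambda>_. c}" unfolding cub_def by auto

lemma cub_upd: "z \<in> cub I A c \<Longrightarrow> i \<in> I \<Longrightarrow> v \<in> A \<Longrightarrow> z(i := v) \<in> cub I A c"
  unfolding cub_def by auto

lemma cub_insert_bij: assumes "i \<notin> I"
  shows "bij_betw (\<lambda>(v, z). z(i := v)) (A \<times> cub I A c) (cub (insert i I) A c)"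
  using assms by (intro bij_betwI[where g = "\<lambda>z. (z i, z(i := c))"]) (auto simp: cub_def fun_upd_idem)

lemma cub_insert_av: assumes "i \<notin> I"
  shows "av (cub (insert i I) A c) f = av A (\<lambda>v. av (cub I A c) (\<lambda>z. f (z(i := v))))"
proof -
  have "av (cub (insert i I) A c) f = av (A \<times> cub I A c) (\<lambda>(v, z). f (z(i := v)))"
    unfolding av_def using sum.reindex_bij_betw[OF cub_insert_bij[OF assms], of f A c]
      bij_betw_same_card[OF cub_insert_bij[OF assms], of A c] by (simp add: case_prod_unfold)
  then show ?thesis by (simp add: av_prod)
qed

lemma cub_finite: "finite I \<Longrightarrow> finite A \<Longrightarrow> finite (cub I A c)"
proof (induction I rule: finite_induct)
  case empty then show ?case by (simp add: cub_empty)
next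
  case (insert i I)
  then show ?case using bij_betw_finite[OF cub_insert_bij[OF insert(2), of A c]] by simp
qed

lemma cub_card: "finite I \<Longrightarrow> card (cub I A c) = card A ^ card I"
proof (induction I rule: finite_induct)
  case empty then show ?case by (simp add: cub_empty)
next
  case (insert i I)
  then show ?case using bij_betw_same_card[OF cub_insert_bij[OF insert(2), of A c]]
    by (simp add: card_cartesian_product)
qed

lemma cub_ne: "A \<noteq> {} \<Longrightarrow> cub I A c \<noteq> {}"
proof -
  assume "A \<noteq> {}" then obtain a where "a \<in> A" by auto
  then have "(\<lambda>i. if i \<in> I then a else c) \<in> cub I A c" by (auto simp: cub_def)
  then show ?thesis by auto
qed

lemma cub_resample1: assumes "i \<in> I" "finite A" "A \<noteq> {}"
  shows "av (cub I A c) (\<lambda>z. av A (\<lambda>v. f (z(i := v)))) = av (cub I A c) f"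
proof -
  obtain J where J: "I = insert i J" "i \<notin> J" using assms(1) by (meson Set.set_insert)
  show ?thesis unfolding J(1) cub_insert_av[OF J(2)] using assms(2,3)
    by (simp add: av_const) (rule av_swap)
qed

definition ov :: "'i set \<Rightarrow> ('i \<Rightarrow> 'a) \<Rightarrow> ('i \<Rightarrow> 'a) \<Rightarrow> 'i \<Rightarrow> 'a" where
  "ov C z z' = (\<lambda>i. if i \<in> C then z' i else z i)"

text \<open>Overwriting the coordinates in \<open>C\<close> by an independent copy keeps the
  distribution. This is the form in which independence of directions is used later.\<close>

lemma cub_resample: assumes "finite C" "C \<subseteq> I" "finite I" "finite A" "A \<noteq> {}"
  shows "av (cub I A c) (\<lambda>z. av (cub I A c) (\<lambda>z'. f (ov C z z'))) = av (cub I A c) f"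
  using assms(1,2)
proof (induction C arbitrary: f rule: finite_induct)
  case empty
  then show ?case using assms by (simp add: ov_def av_const cub_finite cub_ne)
next
  case (insert i C)
  let ?W = "cub I A c"
  have e: "ov (insert i C) z (z'(i := v)) = (ov C z z')(i := v)"
          "ov C (z(i := v)) z' = (ov C z z')(i := v)" for z z' v
    using insert(2) by (auto simp: ov_def)
  have i: "i \<in> I" using insert by auto
  have "av ?W (\<lambda>z. av ?W (\<lambda>z'. f (ov (insert i C) z z')))
     = av ?W (\<lambda>z. av ?W (\<lambda>z'. av A (\<lambda>v. f (ov (insert i C) z (z'(i := v))))))"
    by (subst cub_resample1[OF i assms(4,5)]) simp
  also have "\<dots> = av ?W (\<lambda>z'. av ?W (\<lambda>z. av A (\<lambda>v. f (ov C (z(i := v)) z'))))"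
    by (subst av_swap) (simp add: e)
  also have "\<dots> = av ?W (\<lambda>z'. av ?W (\<lambda>z. f (ov C z z')))"
    by (subst cub_resample1[OF i assms(4,5)]) simp
  also have "\<dots> = av ?W f" using insert by (subst av_swap) simp
  finally show ?case .
qed

lemma sg_cub: assumes "elem2 V" "finite I" shows "elem2 (cub I V 0)"
  unfolding elem2_def using cub_finite[OF assms(2) sgD(1)[OF assms(1)]]
  by (auto simp: cub_def fun_eq_iff sgD[OF assms(1)])
    (metis add_0_left sgD(5)[OF assms(1)])

lemma sg_times: assumes "elem2 V" "elem2 W" shows "elem2 (V \<times> W)"
  unfolding elem2_def using sgD[OF assms(1)] sgD[OF assms(2)] by (auto simp: zero_prod_def)

text \<open>Every claim below that one quantity is a function of another is reduced to comparing two
  points with equal data.\<close>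

lemma factor_through:
  assumes "\<And>z z'. z \<in> Z \<Longrightarrow> z' \<in> Z \<Longrightarrow> q z = q z' \<Longrightarrow> p z = p z'"
  shows "\<exists>g. \<forall>z\<in>Z. p z = g (q z)"
proof (intro exI ballI)
  fix z assume z: "z \<in> Z"
  let ?w = "SOME w. w \<in> Z \<and> q w = q z"
  have "?w \<in> Z \<and> q ?w = q z" by (rule someI[of _ z]) (use z in auto)
  then show "p z = (\<lambda>c. p (SOME w. w \<in> Z \<and> q w = c)) (q z)" using assms z by metis
qed

section \<open>Phases, derivatives and the Gowers-Cauchy-Schwarz inequality\<close>

definition phase :: "('v \<Rightarrow> real) \<Rightarrow> bool" where
  "phase \<phi> \<longleftrightarrow> (\<forall>x. \<phi> x = 1 \<or> \<phi> x = -1)"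

text \<open>Sign form of the iterated derivative: for \<open>\<phi>\<close> = (-1)^p this is (-1) to
  the derivative of p along the directions \<open>h i\<close>, \<open>i\<close> in \<open>I\<close>.
  Indexing directions by sets lets derivatives over different \<open>I\<close> share one random
  \<open>h\<close>.\<close>

definition D :: "('v::ab_group_add \<Rightarrow> real) \<Rightarrow> 'v \<Rightarrow> ('i \<Rightarrow> 'v) \<Rightarrow> 'i set \<Rightarrow> real" where
  "D \<phi> x h I = (\<Prod>J\<in>Pow I. \<phi> (x + sum h J))"

definition der :: "'v::ab_group_add \<Rightarrow> ('v \<Rightarrow> real) \<Rightarrow> 'v \<Rightarrow> real" where
  "der w \<phi> = (\<lambda>x. \<phi> (x + w) * \<phi> x)"

lemma phase_sq [simp]: "phase \<phi> \<Longrightarrow> \<phi> x * \<phi> x = 1"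
  unfolding phase_def by (metis mult_1 mult_minus1_right verit_minus_simplify(4))

lemma phase_abs [simp]: "phase \<phi> \<Longrightarrow> \<bar>\<phi> x\<bar> = 1"
  unfolding phase_def by (metis abs_1 abs_minus)

lemma phase_mult: "phase \<phi> \<Longrightarrow> phase \<psi> \<Longrightarrow> phase (\<lambda>x. \<phi> x * \<psi> x)"
  unfolding phase_def by (metis mult_1 mult_minus1 verit_minus_simplify(4))

lemma phase_prod: "(\<And>i. i \<in> I \<Longrightarrow> phase (f i)) \<Longrightarrow> phase (\<lambda>x. \<Prod>i\<in>I. f i x)"
proof (induction I rule: infinite_finite_induct)
  case (insert i I)
  then have "phase (\<lambda>x. f i x * (\<Prod>i\<in>I. f i x))" by (intro phase_mult) auto
  then show ?case using insert by simp
qed (auto simp: phase_def)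

lemma phase_shift: "phase \<phi> \<Longrightarrow> phase (\<lambda>x. \<phi> (x + a))"
  unfolding phase_def by simp

lemma phase_der: "phase \<phi> \<Longrightarrow> phase (der w \<phi>)"
  unfolding der_def by (intro phase_mult phase_shift)

lemma phase_D: "phase \<phi> \<Longrightarrow> phase (\<lambda>x. D \<phi> x h I)"
  unfolding D_def by (intro phase_prod phase_shift)

lemma phase_D': assumes "phase \<phi>" shows "D \<phi> x h I = 1 \<or> D \<phi> x h I = -1"
  using phase_D[OF assms] unfolding phase_def by blast

lemma Pow_insert_split:
  assumes "finite I" "i \<notin> I"
  shows "Pow I \<inter> insert i ` Pow I = {}" "inj_on (insert i) (Pow I)"
    "\<And>J. J \<in> Pow I \<Longrightarrow> finite J \<and> i \<notin> J"
proof -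
  show "inj_on (insert i) (Pow I)"
    by (rule inj_on_inverseI[where g = "\<lambda>J. J - {i}"]) (use assms in auto)
qed (use assms finite_subset in auto)

lemma prod_Pow_insert:
  assumes "finite I" "i \<notin> I"
  shows "prod f (Pow (insert i I)) = prod f (Pow I) * (\<Prod>J\<in>Pow I. f (insert i J))"
  unfolding Pow_insert using assms Pow_insert_split[OF assms]
  by (simp add: prod.union_disjoint prod.reindex)

lemma D_empty [simp]: "D \<phi> x h {} = \<phi> x"
  by (simp add: D_def)

lemma D_insert: assumes "finite I" "i \<notin> I"
  shows "D \<phi> x h (insert i I) = D \<phi> (x + h i) h I * D \<phi> x h I"
proof -
  have "D \<phi> x h (insert i I) = (\<Prod>J\<in>Pow I. \<phi> (x + sum h J)) * (\<Prod>J\<in>Pow I. \<phi> (x + sum h (insert i J)))"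
    unfolding D_def by (rule prod_Pow_insert[OF assms])
  also have "(\<Prod>J\<in>Pow I. \<phi> (x + sum h (insert i J))) = (\<Prod>J\<in>Pow I. \<phi> (x + h i + sum h J))"
  proof (rule prod.cong[OF refl])
    fix J assume "J \<in> Pow I"
    then have "finite J" "i \<notin> J" using assms finite_subset by auto
    then show "\<phi> (x + sum h (insert i J)) = \<phi> (x + h i + sum h J)" by (simp add: add.assoc)
  qed
  finally show ?thesis by (simp add: D_def mult.commute)
qed

lemma D_mult: "D (\<lambda>x. \<phi> x * \<psi> x) x h I = D \<phi> x h I * D \<psi> x h I"
  unfolding D_def by (simp add: prod.distrib)

lemma D_prod: "D (\<lambda>x. \<Prod>p\<in>T. f p x) x h I = (\<Prod>p\<in>T. D (f p) x h I)"
  unfolding D_def by (rule prod.swap)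

lemma D_insert_der: assumes "finite I" "i \<notin> I"
  shows "D \<phi> x h (insert i I) = D (der (h i) \<phi>) x h I"
proof -
  have "D (\<lambda>x. \<phi> (x + h i)) x h I = D \<phi> (x + h i) h I"
    unfolding D_def by (simp add: add_ac)
  then show ?thesis unfolding D_insert[OF assms] der_def D_mult by simp
qed

lemma D_cong: "(\<And>i. i \<in> I \<Longrightarrow> h i = h' i) \<Longrightarrow> D \<phi> x h I = D \<phi> x h' I"
  unfolding D_def by (intro prod.cong refl arg_cong[where f = \<phi>] arg_cong2[where f = "(+)"] sum.cong) auto

lemma D_union: assumes "finite A" "finite B" "A \<inter> B = {}"
  shows "D \<phi> x h (A \<union> B) = (\<Prod>C\<in>Pow B. D \<phi> (x + sum h C) h A)"
  using assms(2,3)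
proof (induction B arbitrary: x rule: finite_induct)
  case empty then show ?case by simp
next
  case (insert i B)
  have "D \<phi> x h (A \<union> insert i B) = D \<phi> x h (insert i (A \<union> B))" by simp
  also have "\<dots> = D \<phi> (x + h i) h (A \<union> B) * D \<phi> x h (A \<union> B)"
    using assms insert by (intro D_insert) auto
  also have "\<dots> = (\<Prod>C\<in>Pow B. D \<phi> (x + h i + sum h C) h A) * (\<Prod>C\<in>Pow B. D \<phi> (x + sum h C) h A)"
    using insert by simp
  also have "(\<Prod>C\<in>Pow B. D \<phi> (x + h i + sum h C) h A) = (\<Prod>C\<in>Pow B. D \<phi> (x + sum h (insert i C)) h A)"
  proof (rule prod.cong[OF refl])
    fix J assume "J \<in> Pow B"
    then have "finite J" "i \<notin> J" using insert finite_subset by auto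
    then show "D \<phi> (x + h i + sum h J) h A = D \<phi> (x + sum h (insert i J)) h A" by (simp add: add.assoc)
  qed
  finally show ?case by (simp add: prod_Pow_insert[OF insert(1,2)] mult.commute)
qed

text \<open>Moebius inversion over the vertices of a cube. Since signs are their own inverses, the
  inversion carries no alternating exponents.\<close>

lemma moebius: assumes "phase \<phi>" "finite J"
  shows "\<phi> (x + sum h J) = (\<Prod>K\<in>Pow J. D \<phi> x h K)"
  using assms(2)
proof (induction J arbitrary: x rule: finite_induct)
  case empty then show ?case by simp
next
  case (insert i J)
  have "\<phi> (x + sum h (insert i J)) = \<phi> ((x + h i) + sum h J)" using insert by (simp add: add.assoc)
  also have "\<dots> = (\<Prod>K\<in>Pow J. D \<phi> (x + h i) h K)" by (rule insert)
  also have "\<dots> = (\<Prod>K\<in>Pow J. D \<phi> x h K * D \<phi> x h (insert i K))"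
  proof (rule prod.cong[OF refl])
    fix K assume "K \<in> Pow J"
    then have K: "finite K" "i \<notin> K" using insert finite_subset by auto
    show "D \<phi> (x + h i) h K = D \<phi> x h K * D \<phi> x h (insert i K)"
      unfolding D_insert[OF K] using phase_sq[OF phase_D[OF assms(1)], of x h K]
      by (simp add: mult.left_commute)
  qed
  also have "\<dots> = (\<Prod>K\<in>Pow (insert i J). D \<phi> x h K)"
    by (simp add: prod_Pow_insert[OF insert(1,2)] prod.distrib)
  finally show ?case .
qed

section \<open>Degree of a phase, measured by iterated derivatives\<close>

fun dg :: "'v::ab_group_add set \<Rightarrow> nat \<Rightarrow> ('v \<Rightarrow> real) \<Rightarrow> bool" where
  "dg V 0 \<phi> = (\<forall>x\<in>V. \<forall>y\<in>V. \<phi> x = \<phi> y)"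
| "dg V (Suc e) \<phi> = (\<forall>h\<in>V. dg V e (der h \<phi>))"

lemma dg_Suc: "elem2 V \<Longrightarrow> dg V e \<phi> \<Longrightarrow> dg V (Suc e) \<phi>"
proof (induction e arbitrary: \<phi>)
  case 0
  show ?case unfolding dg.simps
  proof (intro ballI)
    fix h x y assume "h \<in> V" "x \<in> V" "y \<in> V"
    then have "\<phi> (x + h) = \<phi> x" "\<phi> (y + h) = \<phi> y" "\<phi> x = \<phi> y"
      using 0(2) sgD(4)[OF 0(1)] unfolding dg.simps(1) by blast+
    then show "der h \<phi> x = der h \<phi> y" by (simp add: der_def)
  qed
next
  case (Suc e)
  then show ?case by simp
qed

lemma dg_mono: "elem2 V \<Longrightarrow> dg V e \<phi> \<Longrightarrow> e \<le> e' \<Longrightarrow> dg V e' \<phi>"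
proof -
  assume V: "elem2 V" and d: "dg V e \<phi>" and "e \<le> e'"
  show ?thesis using \<open>e \<le> e'\<close> by (induction e' rule: dec_induct) (use d dg_Suc[OF V] in blast)+
qed

lemma dg_mult: "dg V e \<phi> \<Longrightarrow> dg V e \<psi> \<Longrightarrow> dg V e (\<lambda>x. \<phi> x * \<psi> x)"
proof (induction e arbitrary: \<phi> \<psi>)
  case 0 then show ?case unfolding dg.simps(1) by metis
next
  case (Suc e)
  have "der h (\<lambda>x. \<phi> x * \<psi> x) = (\<lambda>x. der h \<phi> x * der h \<psi> x)" for h
    by (auto simp: der_def mult_ac)
  then show ?case using Suc by simp
qed

lemma dg_const: "elem2 V \<Longrightarrow> dg V e (\<lambda>x. c)"
  by (rule dg_mono[of V 0]) auto

lemma dg_prod: "elem2 V \<Longrightarrow> (\<And>i. i \<in> I \<Longrightarrow> dg V e (f i)) \<Longrightarrow> dg V e (\<lambda>x. \<Prod>i\<in>I. f i x)"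
  by (induction I rule: infinite_finite_induct) (auto simp: dg_const intro: dg_mult)

lemma dg_D: assumes "elem2 V"
  shows "finite I \<Longrightarrow> (\<And>i. i \<in> I \<Longrightarrow> h i \<in> V) \<Longrightarrow> dg V (k + card I) \<phi> \<Longrightarrow> dg V k (\<lambda>y. D \<phi> y h I)"
proof (induction I arbitrary: \<phi> rule: finite_induct)
  case empty then show ?case by simp
next
  case (insert i I)
  have "dg V (k + card I) (der (h i) \<phi>)" using insert by simp
  then show ?case using insert by (simp add: D_insert_der)
qed

text \<open>All directions but one already make the derivative constant, and the last difference of
  a constant sign is 1.\<close>

lemma D_eq_1: assumes "elem2 V" "phase \<phi>" "finite I" "\<And>i. i \<in> I \<Longrightarrow> h i \<in> V" "dg V e \<phi>" "e < card I" "x \<in> V"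
  shows "D \<phi> x h I = 1"
proof -
  obtain i where i: "i \<in> I" using assms by (metis card.empty ex_in_conv not_less_zero)
  let ?J = "I - {i}"
  have I: "I = insert i ?J" "i \<notin> ?J" "finite ?J" "card ?J = card I - 1" using i assms by auto
  have "dg V (0 + card ?J) \<phi>" using assms I by (intro dg_mono[OF assms(1,5)]) auto
  then have "dg V 0 (\<lambda>y. D \<phi> y h ?J)" using assms by (intro dg_D) auto
  then have "D \<phi> (x + h i) h ?J = D \<phi> x h ?J"
    using assms(4)[OF i] assms(7) sgD(4)[OF assms(1)] unfolding dg.simps(1) by blast
  then show ?thesis using D_insert[OF I(3,2), of \<phi> x h] I(1) phase_sq[OF phase_D[OF assms(2)], of x h ?J]
    by simp
qed

text \<open>For positive order \<open>j\<close> this is the Gowers uniformity norm raised to the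
  power 2^\<open>j\<close>. Order 0 is the plain mean, so that bias is the first case of
  non-uniformity.\<close>

fun U :: "'v::ab_group_add set \<Rightarrow> nat \<Rightarrow> ('v \<Rightarrow> real) \<Rightarrow> real" where
  "U V 0 \<phi> = av V \<phi>"
| "U V (Suc j) \<phi> = av V (\<lambda>k. U V j (der k \<phi>))"

lemma U_av: assumes "elem2 V" "finite N" "I \<subseteq> N"
  shows "U V (card I) \<phi> = av V (\<lambda>x. av (cub N V 0) (\<lambda>h. D \<phi> x h I))"
proof -
  have "finite I" using assms finite_subset by auto
  then show ?thesis using assms(3)
  proof (induction I arbitrary: \<phi> rule: finite_induct)
    case empty
    then show ?case using assms by (simp add: av_const cub_finite cub_ne sgD)
  next
    case (insert i I)
    have "U V (card (insert i I)) \<phi> = av V (\<lambda>k. av V (\<lambda>x. av (cub N V 0) (\<lambda>h. D (der k \<phi>) x h I)))"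
      using insert by simp
    also have "\<dots> = av V (\<lambda>k. av V (\<lambda>x. av (cub N V 0) (\<lambda>h. D \<phi> x (h(i := k)) (insert i I))))"
    proof (intro av_cong refl)
      fix k x h
      have "D \<phi> x (h(i := k)) (insert i I) = D (der k \<phi>) x (h(i := k)) I"
        using insert by (subst D_insert_der) auto
      also have "\<dots> = D (der k \<phi>) x h I" using insert by (intro D_cong) auto
      finally show "D (der k \<phi>) x h I = D \<phi> x (h(i := k)) (insert i I)" by simp
    qed
    also have "\<dots> = av V (\<lambda>x. av V (\<lambda>k. av (cub N V 0) (\<lambda>h. D \<phi> x (h(i := k)) (insert i I))))"
      by (rule av_swap)
    also have "\<dots> = av V (\<lambda>x. av (cub N V 0) (\<lambda>h. av V (\<lambda>k. D \<phi> x (h(i := k)) (insert i I))))"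
      by (intro av_cong refl av_swap)
    also have "\<dots> = av V (\<lambda>x. av (cub N V 0) (\<lambda>h. D \<phi> x h (insert i I)))"
    proof -
      have "i \<in> N" using insert by auto
      then show ?thesis
        by (subst cub_resample1[of i N V 0, OF _ sgD(1)[OF assms(1)] sgD(3)[OF assms(1)]]) auto
    qed
    finally show ?case .
  qed
qed

text \<open>Cauchy-Schwarz once per direction in \<open>I\<close>. The factor \<open>b i\<close>
  does not involve direction \<open>i\<close>, so it can be pulled out of the average over that
  direction and bounded by 1; squaring what remains replaces \<open>G\<close> by one of its
  derivatives.\<close>

lemma gowers_cs:
  assumes V: "elem2 V" and N: "finite N"
  shows "finite I \<Longrightarrow> I \<noteq> {} \<Longrightarrow> I \<subseteq> N \<Longrightarrow> x \<in> V \<Longrightarrow>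
     (\<And>i h. i \<in> I \<Longrightarrow> h \<in> cub N V 0 \<Longrightarrow> \<bar>b i h\<bar> \<le> 1) \<Longrightarrow>
     (\<And>i h v. i \<in> I \<Longrightarrow> b i (h(i := v)) = b i h) \<Longrightarrow>
     \<bar>av (cub N V 0) (\<lambda>h. G (x + sum h I) * (\<Prod>i\<in>I. b i h))\<bar> ^ (2 ^ card I) \<le> U V (card I) G"
proof (induction I arbitrary: x b G rule: finite_ne_induct)
  case (singleton i)
  let ?W = "cub N V 0"
  have fW: "finite ?W" using N sgD(1)[OF V] by (rule cub_finite)
  have iN: "i \<in> N" using singleton by simp
  have "av ?W (\<lambda>h. G (x + sum h {i}) * (\<Prod>i\<in>{i}. b i h)) = av ?W (\<lambda>h. G (x + h i) * b i h)" by simp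
  also have "\<dots> = av ?W (\<lambda>h. av V (\<lambda>v. G (x + v) * b i h))"
  proof -
    have "b i (z(i := v)) = b i z" for z v by (rule singleton(4)) simp
    then show ?thesis
      by (subst cub_resample1[OF iN sgD(1)[OF V] sgD(3)[OF V], symmetric]) (simp only: fun_upd_same)
  qed
  also have "\<dots> = av ?W (\<lambda>h. av V G * b i h)"
    using singleton by (intro av_cong refl) (simp add: av_cmult_right av_shift'[OF V])
  also have "\<dots> = av V G * av ?W (b i)" by (rule av_cmult)
  finally have e: "av ?W (\<lambda>h. G (x + sum h {i}) * (\<Prod>i\<in>{i}. b i h)) = av V G * av ?W (b i)" .
  have "\<bar>av ?W (b i)\<bar> \<le> av ?W (\<lambda>h. 1)" using singleton
    by (intro order_trans[OF av_abs] av_mono) auto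
  then have b1: "\<bar>av ?W (b i)\<bar> \<le> 1" using fW cub_ne[OF sgD(3)[OF V], of N 0] by (simp add: av_const)
  have "U V 1 G = av V (\<lambda>k. av V (\<lambda>x. G (x + k) * G x))" by (simp add: der_def)
  also have "\<dots> = av V (\<lambda>x. av V (\<lambda>k. G (x + k)) * G x)"
    by (subst av_swap) (simp add: av_cmult_right)
  also have "\<dots> = av V (\<lambda>x. av V G * G x)"
    by (rule av_cong[OF refl]) (simp add: av_shift'[OF V])
  also have "\<dots> = (av V G)\<^sup>2" by (simp add: av_cmult power2_eq_square)
  finally have u: "U V 1 G = (av V G)\<^sup>2" .
  have "(\<bar>av V G\<bar> * \<bar>av ?W (b i)\<bar>)\<^sup>2 \<le> \<bar>av V G\<bar>\<^sup>2"
    using b1 by (intro power_mono) (auto simp: mult_left_le)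
  then show ?case unfolding e using u by (simp add: abs_mult)
next
  case (insert i I)
  let ?W = "cub N V 0"
  have fW: "finite ?W" using N sgD(1)[OF V] by (rule cub_finite)
  have neW: "?W \<noteq> {}" by (rule cub_ne[OF sgD(3)[OF V]])
  have iN: "i \<in> N" and IN: "I \<subseteq> N" using insert by auto
  have fV: "finite V" "V \<noteq> {}" using sgD[OF V] by auto
  define f where "f h v = G (x + v + sum h I) * (\<Prod>l\<in>I. b l (h(i := v)))" for h v
  have sm: "sum (h(i := v)) I = sum h I" for h :: "'b \<Rightarrow> 'a" and v using insert by (intro sum.cong) auto
  have "av ?W (\<lambda>h. G (x + sum h (insert i I)) * (\<Prod>l\<in>insert i I. b l h)) =
        av ?W (\<lambda>h. av V (\<lambda>v. G (x + sum (h(i := v)) (insert i I)) * (\<Prod>l\<in>insert i I. b l (h(i := v)))))"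
    by (rule cub_resample1[OF iN fV, symmetric])
  also have "\<dots> = av ?W (\<lambda>h. b i h * av V (f h))"
  proof (rule av_cong[OF refl])
    fix h
    have bi: "b i (h(i := v)) = b i h" for v by (rule insert(8)) simp
    have si: "sum (h(i := v)) (insert i I) = v + sum h I" for v
      unfolding sum.insert[OF insert(1,3)] sm by simp
    show "av V (\<lambda>v. G (x + sum (h(i := v)) (insert i I)) * (\<Prod>l\<in>insert i I. b l (h(i := v)))) =
        b i h * av V (f h)"
      unfolding av_cmult[symmetric] si prod.insert[OF insert(1,3)] bi f_def by (simp add: add.assoc mult_ac)
  qed
  finally have e: "av ?W (\<lambda>h. G (x + sum h (insert i I)) * (\<Prod>l\<in>insert i I. b l h)) = av ?W (\<lambda>h. b i h * av V (f h))" .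
  \<comment> \<open>Writing the second copy of \<open>v\<close> as \<open>v + k\<close> turns two
    values of \<open>G\<close> into one value of \<open>der k G\<close>. The doubled factors still
    omit one direction each, so the induction hypothesis applies.\<close>
  define A where "A v k = av ?W (\<lambda>h. der k G (x + v + sum h I) * (\<Prod>l\<in>I. b l (h(i := v)) * b l (h(i := v + k))))" for v k
  have "\<bar>av ?W (\<lambda>h. b i h * av V (f h))\<bar>\<^sup>2 \<le> av ?W (\<lambda>h. (b i h * av V (f h))\<^sup>2)"
    using av_sq[OF fW] by simp
  also have "\<dots> \<le> av ?W (\<lambda>h. (av V (f h))\<^sup>2)"
  proof (rule av_mono)
    fix h assume "h \<in> ?W"
    then have "\<bar>b i h\<bar> \<le> 1" using insert(7) by auto
    then have "(b i h)\<^sup>2 \<le> 1" by (simp add: abs_square_le_1)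
    then show "(b i h * av V (f h))\<^sup>2 \<le> (av V (f h))\<^sup>2"
      by (simp add: power_mult_distrib mult_left_le_one_le)
  qed
  also have "\<dots> = av ?W (\<lambda>h. av V (\<lambda>v. av V (\<lambda>k. f h v * f h (v + k))))"
  proof (rule av_cong[OF refl])
    fix h
    have "av V (\<lambda>v. av V (\<lambda>k. f h v * f h (v + k))) = av V (\<lambda>v. f h v * av V (f h))"
      by (rule av_cong[OF refl]) (simp add: av_cmult av_shift'[OF V])
    then show "(av V (f h))\<^sup>2 = av V (\<lambda>v. av V (\<lambda>k. f h v * f h (v + k)))"
      by (simp add: av_cmult_right power2_eq_square)
  qed
  also have "\<dots> = av V (\<lambda>v. av V (\<lambda>k. av ?W (\<lambda>h. f h v * f h (v + k))))"
    by (subst av_swap) (intro av_cong refl av_swap)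
  also have "\<dots> = av V (\<lambda>v. av V (\<lambda>k. A v k))"
    unfolding A_def f_def by (intro av_cong refl) (simp add: der_def prod.distrib add_ac mult_ac)
  finally have s1: "\<bar>av ?W (\<lambda>h. b i h * av V (f h))\<bar>\<^sup>2 \<le> av V (\<lambda>v. av V (\<lambda>k. A v k))" .
  have IH: "\<bar>A v k\<bar> ^ (2 ^ card I) \<le> U V (card I) (der k G)" if "v \<in> V" "k \<in> V" for v k
    unfolding A_def
  proof (rule insert(4)[OF IN])
    show "x + v \<in> V" using insert(6) that sgD(4)[OF V] by auto
    fix l h assume l: "l \<in> I" and h: "h \<in> ?W"
    have "\<bar>b l (h(i := v))\<bar> \<le> 1" "\<bar>b l (h(i := v + k))\<bar> \<le> 1"
      using insert(7)[of l] l h that iN by (auto intro!: cub_upd sgD(4)[OF V])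
    then show "\<bar>b l (h(i := v)) * b l (h(i := v + k))\<bar> \<le> 1"
      by (simp add: abs_mult mult_le_one)
  next
    fix l h u assume l: "l \<in> I"
    have "l \<noteq> i" using insert l by auto
    have c: "b l (g(l := u)) = b l g" for g by (rule insert(8)) (use l in simp)
    show "b l ((h(l := u))(i := v)) * b l ((h(l := u))(i := v + k)) = b l (h(i := v)) * b l (h(i := v + k))"
      unfolding fun_upd_twist[OF \<open>l \<noteq> i\<close>] c ..
  qed
  have "\<bar>av ?W (\<lambda>h. b i h * av V (f h))\<bar> ^ (2 ^ card (insert i I)) = (\<bar>av ?W (\<lambda>h. b i h * av V (f h))\<bar>\<^sup>2) ^ (2 ^ card I)"
    unfolding card_insert_disjoint[OF insert(1,3)] power_Suc power_mult ..
  also have "\<dots> \<le> (av V (\<lambda>v. av V (\<lambda>k. A v k))) ^ (2 ^ card I)"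
    by (rule power_mono[OF s1]) simp
  also have "\<dots> \<le> \<bar>av V (\<lambda>v. av V (\<lambda>k. A v k))\<bar> ^ (2 ^ card I)"
    by (metis abs_ge_self power_abs)
  also have "\<dots> \<le> av V (\<lambda>v. \<bar>av V (\<lambda>k. A v k)\<bar> ^ (2 ^ card I))" by (rule av_pow[OF fV(1)])
  also have "\<dots> \<le> av V (\<lambda>v. av V (\<lambda>k. \<bar>A v k\<bar> ^ (2 ^ card I)))"
    by (intro av_mono av_pow[OF fV(1)])
  also have "\<dots> \<le> av V (\<lambda>v. av V (\<lambda>k. U V (card I) (der k G)))"
    by (intro av_mono IH)
  also have "\<dots> = U V (card (insert i I)) G" using insert fV by (simp add: av_const)
  finally show ?case unfolding e .
qed

section \<open>Pattern families and near-uniformity\<close>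

definition sgn_cub :: "'p set \<Rightarrow> ('p \<Rightarrow> real) set" where
  "sgn_cub F = cub F {1, -1} 1"

lemma sgn_cub_fin: "finite F \<Longrightarrow> finite (sgn_cub F)" "sgn_cub F \<noteq> {}"
  "finite F \<Longrightarrow> card (sgn_cub F) = 2 ^ card F"
  unfolding sgn_cub_def by (simp_all add: cub_finite cub_ne cub_card numeral_2_eq_2)

definition res :: "'p set \<Rightarrow> ('p \<Rightarrow> real) \<Rightarrow> 'p \<Rightarrow> real" where
  "res F z = (\<lambda>p. if p \<in> F then z p else 1)"

lemma res_in: "(\<And>p. p \<in> F \<Longrightarrow> z p = 1 \<or> z p = -1) \<Longrightarrow> res F z \<in> sgn_cub F"
  unfolding res_def sgn_cub_def cub_def by auto

text \<open>The factor (1 + z p * w p) / 2 is the indicator of w p = z p; the product over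
  \<open>F\<close> is expanded into characters.\<close>

lemma ind_expand:
  assumes "finite F" "z \<in> sgn_cub F" "\<And>p. p \<in> F \<Longrightarrow> w p = 1 \<or> w p = -1"
  shows "of_bool (res F w = z) = (\<Sum>A\<in>Pow F. (\<Prod>p\<in>A. z p) * (\<Prod>p\<in>A. w p)) / 2 ^ card F"
proof -
  have z1: "z p = 1 \<or> z p = -1" for p using assms(2) unfolding sgn_cub_def cub_def by blast
  have "(\<Sum>A\<in>Pow F. (\<Prod>p\<in>A. z p) * (\<Prod>p\<in>A. w p)) = (\<Sum>A\<in>Pow F. (\<Prod>p\<in>A. z p * w p) * (\<Prod>p\<in>F - A. 1))"
    by (simp add: prod.distrib)
  also have "\<dots> = (\<Prod>p\<in>F. z p * w p + 1)" by (rule prod_add[OF assms(1), symmetric])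
  also have "\<dots> = of_bool (res F w = z) * 2 ^ card F"
  proof (cases "res F w = z")
    case True
    have "z p * w p + 1 = 2" if "p \<in> F" for p
    proof -
      have "w p = z p" using True that by (metis res_def)
      then show ?thesis using assms(3)[OF that] by auto
    qed
    then have "(\<Prod>p\<in>F. z p * w p + 1) = (\<Prod>p\<in>F. 2)" by (intro prod.cong) auto
    then show ?thesis using True by simp
  next
    case False
    then obtain p where p: "res F w p \<noteq> z p" by auto
    have "p \<in> F" using p assms(2) unfolding sgn_cub_def cub_def res_def by (auto split: if_splits)
    moreover have "z p * w p + 1 = 0" using p z1[of p] assms(3)[OF calculation] calculation by (auto simp: res_def)
    ultimately have "(\<Prod>p\<in>F. z p * w p + 1) = 0" using assms(1) by (intro prod_zero) auto
    then show ?thesis using False by simp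
  qed
  finally show ?thesis by (simp add: field_simps)
qed

lemma distr_expand:
  assumes "finite F" "z \<in> sgn_cub F" "\<And>h p. h \<in> W \<Longrightarrow> p \<in> F \<Longrightarrow> Z h p = 1 \<or> Z h p = -1"
  shows "pr W (\<lambda>h. res F (Z h) = z) = (\<Sum>A\<in>Pow F. (\<Prod>p\<in>A. z p) * av W (\<lambda>h. \<Prod>p\<in>A. Z h p)) / 2 ^ card F"
proof -
  have "pr W (\<lambda>h. res F (Z h) = z) = av W (\<lambda>h. (\<Sum>A\<in>Pow F. (\<Prod>p\<in>A. z p) * (\<Prod>p\<in>A. Z h p)) * (1 / 2 ^ card F))"
    unfolding pr_def by (intro av_cong refl) (subst ind_expand[OF assms(1,2)], use assms(3) in auto)
  also have "\<dots> = (\<Sum>A\<in>Pow F. (\<Prod>p\<in>A. z p) * av W (\<lambda>h. \<Prod>p\<in>A. Z h p)) * (1 / 2 ^ card F)"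
    by (simp only: av_cmult_right av_sum av_cmult)
  finally show ?thesis by simp
qed

text \<open>In the character expansion the empty set contributes exactly the uniform probability of
  a pattern, and the other characters at most \<open>\<eta>\<close> in total. Summing over the
  2^\<open>card F\<close> patterns gives the bound.\<close>

lemma near_uniform:
  assumes F: "finite F" and W: "finite W" "W \<noteq> {}"
    and pm: "\<And>h p. h \<in> W \<Longrightarrow> p \<in> F \<Longrightarrow> Z h p = 1 \<or> Z h p = -1"
    and e0: "0 \<le> \<eta>"
    and small: "\<And>A. A \<subseteq> F \<Longrightarrow> A \<noteq> {} \<Longrightarrow> \<bar>av W (\<lambda>h. \<Prod>p\<in>A. Z h p)\<bar> \<le> \<eta>"
  shows "\<bar>pr W (\<lambda>h. Q (res F (Z h))) - pr (sgn_cub F) Q\<bar> \<le> 2 ^ card F * \<eta>"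
proof -
  let ?S = "sgn_cub F"
  let ?f = "(1 / 2 ^ card F) :: real"
  have pz: "\<bar>pr W (\<lambda>h. res F (Z h) = z) - ?f\<bar> \<le> \<eta>" if z: "z \<in> ?S" for z
  proof -
    have z1: "z p = 1 \<or> z p = -1" for p using z unfolding sgn_cub_def cub_def by blast
    have "(\<Sum>A\<in>Pow F. (\<Prod>p\<in>A. z p) * av W (\<lambda>h. \<Prod>p\<in>A. Z h p)) =
       1 + (\<Sum>A\<in>Pow F - {{}}. (\<Prod>p\<in>A. z p) * av W (\<lambda>h. \<Prod>p\<in>A. Z h p))"
      using F W by (subst sum.remove[of _ "{}"]) (auto simp: av_const)
    then have "pr W (\<lambda>h. res F (Z h) = z) - ?f =
       (\<Sum>A\<in>Pow F - {{}}. (\<Prod>p\<in>A. z p) * av W (\<lambda>h. \<Prod>p\<in>A. Z h p)) / 2 ^ card F"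
      by (subst distr_expand[OF F z pm]) (auto simp: add_divide_distrib)
    also have "\<bar>\<dots>\<bar> \<le> (\<Sum>A\<in>Pow F - {{}}. \<eta>) / 2 ^ card F"
    proof -
      have "\<bar>\<Sum>A\<in>Pow F - {{}}. (\<Prod>p\<in>A. z p) * av W (\<lambda>h. \<Prod>p\<in>A. Z h p)\<bar> \<le> (\<Sum>A\<in>Pow F - {{}}. \<eta>)"
      proof (rule order_trans[OF sum_abs], rule sum_mono)
        fix A assume "A \<in> Pow F - {{}}"
        then have "\<bar>av W (\<lambda>h. \<Prod>p\<in>A. Z h p)\<bar> \<le> \<eta>" using small by auto
        moreover have "\<bar>\<Prod>p\<in>A. z p\<bar> = 1" unfolding abs_prod using z1
          by (intro prod.neutral) (metis abs_1 abs_minus)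
        ultimately show "\<bar>(\<Prod>p\<in>A. z p) * av W (\<lambda>h. \<Prod>p\<in>A. Z h p)\<bar> \<le> \<eta>" by (simp add: abs_mult)
      qed
      then show ?thesis by (simp add: divide_right_mono)
    qed
    also have "\<dots> \<le> (2 ^ card F * \<eta>) / 2 ^ card F"
    proof -
      have "real (card (Pow F - {{}})) \<le> 2 ^ card F"
        using F by (simp add: card_Diff_singleton card_Pow)
      then show ?thesis using e0 by (intro divide_right_mono) (auto intro: mult_right_mono)
    qed
    finally show ?thesis by simp
  qed
  have "pr W (\<lambda>h. Q (res F (Z h))) = av W (\<lambda>h. \<Sum>z\<in>?S. of_bool (Q z) * of_bool (res F (Z h) = z))"
    unfolding pr_def
  proof (rule av_cong[OF refl])
    fix h assume "h \<in> W"
    then have "res F (Z h) \<in> ?S" by (intro res_in pm)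
    then show "of_bool (Q (res F (Z h))) = (\<Sum>z\<in>?S. of_bool (Q z) * (of_bool (res F (Z h) = z) :: real))"
      using sgn_cub_fin(1)[OF F] by (subst sum.remove[of _ "res F (Z h)"]) (auto intro!: sum.neutral)
  qed
  also have "\<dots> = (\<Sum>z\<in>?S. of_bool (Q z) * pr W (\<lambda>h. res F (Z h) = z))"
    by (simp only: av_sum av_cmult pr_def)
  finally have e1: "pr W (\<lambda>h. Q (res F (Z h))) = (\<Sum>z\<in>?S. of_bool (Q z) * pr W (\<lambda>h. res F (Z h) = z))" .
  have e2: "pr ?S Q = (\<Sum>z\<in>?S. of_bool (Q z) * ?f)"
    unfolding pr_def av_def sgn_cub_fin(3)[OF F] by (simp add: sum_divide_distrib)
  have "\<bar>pr W (\<lambda>h. Q (res F (Z h))) - pr ?S Q\<bar> = \<bar>\<Sum>z\<in>?S. of_bool (Q z) * (pr W (\<lambda>h. res F (Z h) = z) - ?f)\<bar>"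
    unfolding e1 e2 by (simp add: sum_subtractf right_diff_distrib)
  also have "\<dots> \<le> (\<Sum>z\<in>?S. \<eta>)"
    using pz e0 by (intro order_trans[OF sum_abs] sum_mono) auto
  also have "\<dots> = 2 ^ card F * \<eta>" using sgn_cub_fin(3)[OF F] by simp
  finally show ?thesis .
qed


text \<open>A triple \<open>(\<phi>, l, s)\<close> is a phase of degree at most \<open>l\<close> together with a stage \<open>s\<close>: in a valid family
  the derivatives of \<open>\<phi>\<close> of order above \<open>s\<close> are determined, in most directions, by the values of the
  members of level below \<open>l\<close>, while those of order at most \<open>s\<close> are treated as free.\<close>

type_synonym 'v tri = "('v \<Rightarrow> real) \<times> nat \<times> nat"

abbreviation ph :: "'v tri \<Rightarrow> 'v \<Rightarrow> real" where "ph p \<equiv> fst p"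
abbreviation lev :: "'v tri \<Rightarrow> nat" where "lev p \<equiv> fst (snd p)"
abbreviation stg :: "'v tri \<Rightarrow> nat" where "stg p \<equiv> snd (snd p)"

text \<open>The values of the members of \<open>S\<close> at all vertices of the cube spanned by
  \<open>h\<close> over \<open>I\<close>. The constant 1 elsewhere makes equality of patterns the
  same as equality of these values.\<close>

definition pat :: "('v::ab_group_add) tri set \<Rightarrow> 'v \<Rightarrow> (nat \<Rightarrow> 'v) \<Rightarrow> nat set \<Rightarrow> nat set \<Rightarrow> 'v tri \<Rightarrow> real" where
  "pat S x h I = (\<lambda>J p. if J \<subseteq> I \<and> p \<in> S then ph p (x + sum h J) else 1)"

definition low :: "'v tri set \<Rightarrow> nat \<Rightarrow> 'v tri set" where
  "low S e = {p \<in> S. lev p < e}"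

abbreviation cubn :: "nat \<Rightarrow> ('v::ab_group_add) set \<Rightarrow> (nat \<Rightarrow> 'v) set" where
  "cubn n V \<equiv> cub {..<n} V 0"

text \<open>The bound is uniform in the base point \<open>x\<close>; only the directions are random.
  For \<open>j = 0\<close> no randomness is left, which \<open>detl_0\<close> exploits.\<close>

definition detl :: "('v::ab_group_add) set \<Rightarrow> nat \<Rightarrow> ('v \<Rightarrow> real) \<Rightarrow> 'v tri set \<Rightarrow> nat \<Rightarrow> real \<Rightarrow> bool" where
  "detl V n \<phi> S j \<epsilon> \<longleftrightarrow> (\<forall>I. I \<subseteq> {..<n} \<longrightarrow> card I = j \<longrightarrow>
     (\<exists>\<Psi>. \<forall>x\<in>V. pr (cubn n V) (\<lambda>h. D \<phi> x h I \<noteq> \<Psi> (pat S x h I)) \<le> \<epsilon>))"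

definition wf_fam :: "('v::ab_group_add) set \<Rightarrow> 'v tri set \<Rightarrow> bool" where
  "wf_fam V S \<longleftrightarrow> finite S \<and> (\<forall>p\<in>S. phase (ph p) \<and> dg V (lev p) (ph p) \<and> stg p \<le> lev p \<and> 1 \<le> lev p)"

definition valid :: "('v::ab_group_add) set \<Rightarrow> nat \<Rightarrow> 'v tri set \<Rightarrow> real \<Rightarrow> bool" where
  "valid V n S \<kappa> \<longleftrightarrow> wf_fam V S \<and>
     (\<exists>err. (\<forall>p\<in>S. 0 \<le> err p \<and> detl V n (ph p) (low S (lev p)) (Suc (stg p)) (err p)) \<and> sum err S \<le> \<kappa>)"

text \<open>The derivatives that validity does not force. The empty index set is excluded because
  the values at the base point are fixed together with \<open>x\<close>.\<close>

definition Free :: "nat \<Rightarrow> 'v tri set \<Rightarrow> ('v tri \<times> nat set) set" where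
  "Free n S = {(p, I). p \<in> S \<and> I \<subseteq> {..<n} \<and> I \<noteq> {} \<and> card I \<le> stg p}"

definition Zf :: "('v::ab_group_add) \<Rightarrow> (nat \<Rightarrow> 'v) \<Rightarrow> 'v tri \<times> nat set \<Rightarrow> real" where
  "Zf x h q = D (ph (fst q)) x h (snd q)"

text \<open>The Gowers norm of order \<open>j\<close> is at most \<open>\<eta>\<close>, written with
  the powers that \<open>U\<close> carries. Only members whose derivatives of order \<open>j\<close>
  are free are multiplied, since forced derivatives may well be correlated.\<close>

definition Rg :: "('v::ab_group_add) set \<Rightarrow> 'v tri set \<Rightarrow> real \<Rightarrow> bool" where
  "Rg V S \<eta> \<longleftrightarrow> (\<forall>j T. T \<subseteq> {p \<in> S. j \<le> stg p} \<longrightarrow> T \<noteq> {} \<longrightarrow>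
     \<bar>U V j (\<lambda>x. \<Prod>p\<in>T. ph p x)\<bar> \<le> \<eta> ^ (2 ^ j))"

section \<open>Near independence of the free derivatives\<close>

lemma Free_finite: "finite S \<Longrightarrow> finite (Free n S)"
  by (rule finite_subset[of _ "S \<times> Pow {..<n}"]) (auto simp: Free_def)

lemma Free_card: assumes "finite S" shows "card (Free n S) \<le> card S * 2 ^ n"
proof -
  have "card (Free n S) \<le> card (S \<times> Pow {..<n})"
  proof (rule card_mono)
    show "finite (S \<times> Pow {..<n})" using assms by simp
    show "Free n S \<subseteq> S \<times> Pow {..<n}" by (auto simp: Free_def)
  qed
  also have "\<dots> = card S * 2 ^ n" by (simp add: card_cartesian_product card_Pow)
  finally show ?thesis .
qed

text \<open>Take a factor whose index set \<open>I0\<close> has maximal size and multiply all phases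
  occurring over \<open>I0\<close> into \<open>G\<close>. Only the vertex value
  \<open>G (x + sum h I0)\<close> depends on every direction in \<open>I0\<close>: the other
  vertices of that cube and, by maximality, the other factors each miss one. This is the situation
  of \<open>gowers_cs\<close>.\<close>

lemma fourier_free:
  assumes V: "elem2 V" and S: "wf_fam V S" and R: "Rg V S \<eta>" and e0: "0 \<le> \<eta>" and x: "x \<in> V"
    and A: "A \<subseteq> Free n S" "A \<noteq> {}"
  shows "\<bar>av (cubn n V) (\<lambda>h. \<Prod>q\<in>A. Zf x h q)\<bar> \<le> \<eta>"
proof -
  have finA: "finite A" using A(1) Free_finite[of S n] S finite_subset unfolding wf_fam_def by blast
  obtain q0 where q0: "q0 \<in> A" "\<And>q. q \<in> A \<Longrightarrow> card (snd q) \<le> card (snd q0)"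
  proof -
    have "Max ((\<lambda>q. card (snd q)) ` A) \<in> (\<lambda>q. card (snd q)) ` A" using finA A(2) by simp
    then obtain q where "q \<in> A" "card (snd q) = Max ((\<lambda>q. card (snd q)) ` A)" by auto
    then show ?thesis using that[of q] finA by auto
  qed
  define I0 where "I0 = snd q0"
  have I0: "I0 \<subseteq> {..<n}" "I0 \<noteq> {}" "finite I0"
  proof -
    have "q0 \<in> Free n S" using q0(1) A(1) by blast
    then show "I0 \<subseteq> {..<n}" "I0 \<noteq> {}" by (auto simp: I0_def Free_def)
    then show "finite I0" using finite_subset by blast
  qed
  define T where "T = {p. (p, I0) \<in> A}"
  have T: "T \<subseteq> {p \<in> S. card I0 \<le> stg p}" "T \<noteq> {}" "finite T"
  proof -
    show a: "T \<subseteq> {p \<in> S. card I0 \<le> stg p}" using A(1) unfolding T_def Free_def by blast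
    have "fst q0 \<in> T" using q0(1) by (simp add: T_def I0_def)
    then show "T \<noteq> {}" by blast
    have "T \<subseteq> S" using a by blast
    then show "finite T" using S finite_subset unfolding wf_fam_def by blast
  qed
  define G where "G = (\<lambda>x. \<Prod>p\<in>T. ph p x)"
  have phG: "phase G" unfolding G_def using T(1) S by (intro phase_prod) (auto simp: wf_fam_def)
  \<comment> \<open>\<open>c\<close> charges each remaining factor to one direction of
    \<open>I0\<close> that it does not involve; the factors charged to \<open>i\<close> form
    \<open>b i\<close>.\<close>
  define c where "c K = (SOME i. i \<in> I0 \<and> i \<notin> K)" for K
  have c: "c K \<in> I0 \<and> c K \<notin> K" if "\<not> I0 \<subseteq> K" for K
    unfolding c_def by (rule someI_ex) (use that in auto)
  define A' where "A' = {q \<in> A. snd q \<noteq> I0}"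
  have A': "\<not> I0 \<subseteq> snd q" if "q \<in> A'" for q
  proof
    assume s: "I0 \<subseteq> snd q"
    have q: "q \<in> A" "snd q \<noteq> I0" using that by (auto simp: A'_def)
    have "q \<in> Free n S" using q(1) A(1) by blast
    then have "snd q \<subseteq> {..<n}" by (auto simp: Free_def)
    then have "finite (snd q)" using finite_subset by blast
    then have "card I0 < card (snd q)" using s q by (intro psubset_card_mono) auto
    then show False using q0(2)[OF q(1)] by (simp add: I0_def)
  qed
  have finA': "finite A'" using finA by (simp add: A'_def)
  define P where "P = Pow I0 - {I0}"
  have P: "\<not> I0 \<subseteq> J" if "J \<in> P" for J using that by (auto simp: P_def)
  have finP: "finite P" using I0 by (simp add: P_def)
  define b where "b i h = (\<Prod>J\<in>{J\<in>P. c J = i}. G (x + sum h J)) * (\<Prod>q\<in>{q\<in>A'. c (snd q) = i}. Zf x h q)" for i h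
  have phq: "phase (ph (fst q))" if "q \<in> A" for q using that A(1) S
    unfolding Free_def wf_fam_def by fastforce
  have prod: "(\<Prod>q\<in>A. Zf x h q) = G (x + sum h I0) * (\<Prod>i\<in>I0. b i h)" for h
  proof -
    have "(\<Prod>q\<in>A. Zf x h q) = (\<Prod>q\<in>(\<lambda>p. (p, I0)) ` T. Zf x h q) * (\<Prod>q\<in>A'. Zf x h q)"
    proof (subst prod.union_disjoint[symmetric])
      show "finite ((\<lambda>p. (p, I0)) ` T)" using T by simp
      have "A = (\<lambda>p. (p, I0)) ` T \<union> A'" by (auto simp: T_def A'_def)
      then show "(\<Prod>q\<in>A. Zf x h q) = (\<Prod>q\<in>(\<lambda>p. (p, I0)) ` T \<union> A'. Zf x h q)" by simp
    qed (use finA' in \<open>auto simp: A'_def\<close>)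
    also have "(\<Prod>q\<in>(\<lambda>p. (p, I0)) ` T. Zf x h q) = D G x h I0"
      unfolding G_def D_prod by (subst prod.reindex) (auto simp: inj_on_def Zf_def)
    also have "D G x h I0 = G (x + sum h I0) * (\<Prod>J\<in>P. G (x + sum h J))"
      unfolding D_def P_def using I0 by (subst prod.remove[of _ I0]) auto
    also have "(\<Prod>J\<in>P. G (x + sum h J)) = (\<Prod>i\<in>I0. \<Prod>J\<in>{J\<in>P. c J = i}. G (x + sum h J))"
      by (rule prod.group[symmetric]) (use finP I0 c P in auto)
    also have "(\<Prod>q\<in>A'. Zf x h q) = (\<Prod>i\<in>I0. \<Prod>q\<in>{q\<in>A'. c (snd q) = i}. Zf x h q)"
      by (rule prod.group[symmetric]) (use finA' I0 c A' in auto)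
    finally show ?thesis by (simp add: b_def prod.distrib mult.assoc)
  qed
  have "\<bar>av (cubn n V) (\<lambda>h. G (x + sum h I0) * (\<Prod>i\<in>I0. b i h))\<bar> ^ (2 ^ card I0) \<le> U V (card I0) G"
  proof (rule gowers_cs[OF V _ I0(3,2,1) x])
    fix i h
    have "\<bar>b i h\<bar> = (\<Prod>J\<in>{J\<in>P. c J = i}. \<bar>G (x + sum h J)\<bar>) * (\<Prod>q\<in>{q\<in>A'. c (snd q) = i}. \<bar>Zf x h q\<bar>)"
      by (simp add: b_def abs_mult abs_prod)
    also have "\<dots> = 1"
    proof -
      have "\<bar>Zf x h q\<bar> = 1" if "q \<in> A'" for q
      proof -
        have "q \<in> A" using that by (simp add: A'_def)
        from phase_abs[OF phase_D[OF phq[OF this]], of x h "snd q"] show ?thesis by (simp add: Zf_def)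
      qed
      then show ?thesis using phG by simp
    qed
    finally show "\<bar>b i h\<bar> \<le> 1" by simp
  next
    fix i :: nat and h :: "nat \<Rightarrow> 'a" and v :: 'a
    have "sum (h(i := v)) J = sum h J" if "J \<in> P" "c J = i" for J
      using c[OF P[OF that(1)]] that by (intro sum.cong) auto
    moreover have "Zf x (h(i := v)) q = Zf x h q" if "q \<in> A'" "c (snd q) = i" for q
      unfolding Zf_def using c[OF A'[OF that(1)]] that by (intro D_cong) auto
    ultimately show "b i (h(i := v)) = b i h" unfolding b_def
      by (intro arg_cong2[where f = "(*)"] prod.cong refl arg_cong[where f = G]) auto
  qed (rule finite_lessThan)
  also have "\<dots> \<le> \<bar>U V (card I0) G\<bar>" by (rule abs_ge_self)
  also have "\<dots> \<le> \<eta> ^ (2 ^ card I0)" using R T(1,2) unfolding Rg_def G_def by blast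
  finally have "\<bar>av (cubn n V) (\<lambda>h. \<Prod>q\<in>A. Zf x h q)\<bar> ^ (2 ^ card I0) \<le> \<eta> ^ (2 ^ card I0)"
    by (simp add: prod)
  then show ?thesis
    using e0 by (meson abs_ge_zero power_mono_iff zero_less_numeral zero_less_power)
qed

section \<open>Patterns determined by base values and free derivatives\<close>

definition base :: "('v::ab_group_add) tri set \<Rightarrow> 'v \<Rightarrow> 'v tri \<Rightarrow> real" where
  "base S x = (\<lambda>p. if p \<in> S then ph p x else 1)"

definition FrI :: "nat \<Rightarrow> 'v tri set \<Rightarrow> nat set \<Rightarrow> ('v tri \<times> nat set) set" where
  "FrI n S I = {q \<in> Free n S. snd q \<subseteq> I}"

lemma pat_cong: "(\<And>i. i \<in> I \<Longrightarrow> h i = h' i) \<Longrightarrow> pat S x h I = pat S x h' I"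
  unfolding pat_def
  by (intro ext) (auto intro!: arg_cong2[where f = "(+)"] arg_cong[where f = "ph _"] sum.cong)

lemma sum_cub: "elem2 V \<Longrightarrow> h \<in> cubn n V \<Longrightarrow> C \<subseteq> {..<n} \<Longrightarrow> sum h C \<in> V"
  using finite_subset by (intro sg_sum) (auto simp: cub_def)

text \<open>The directions in \<open>C\<close> move only the base point and are independent of those
  in \<open>I\<close>, so the latter may be resampled with the base point held fixed.\<close>

lemma pr_base:
  assumes V: "elem2 V" and CI: "I \<subseteq> {..<n}" "C \<subseteq> {..<n}" "C \<inter> I = {}" and x: "x \<in> V"
    and Q: "\<And>y h h'. (\<And>i. i \<in> I \<Longrightarrow> h i = h' i) \<Longrightarrow> Q y h = Q y h'"
    and bd: "\<And>y. y \<in> V \<Longrightarrow> pr (cubn n V) (Q y) \<le> \<epsilon>"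
  shows "pr (cubn n V) (\<lambda>h. Q (x + sum h C) h) \<le> \<epsilon>"
proof -
  let ?W = "cubn n V"
  have fin: "finite ?W" "?W \<noteq> {}" using sgD(1,3)[OF V] by (auto simp: cub_finite cub_ne)
  have "pr ?W (\<lambda>h. Q (x + sum h C) h) = av ?W (\<lambda>h. av ?W (\<lambda>h'. of_bool (Q (x + sum (ov I h h') C) (ov I h h'))))"
    unfolding pr_def using sgD[OF V] CI finite_subset[OF CI(1)] by (intro cub_resample[symmetric]) auto
  also have "\<dots> = av ?W (\<lambda>h. pr ?W (Q (x + sum h C)))"
    unfolding pr_def
  proof (intro av_cong refl)
    fix h h' :: "nat \<Rightarrow> 'a"
    have "sum (ov I h h') C = sum h C" using CI by (intro sum.cong) (auto simp: ov_def)
    moreover have "Q y (ov I h h') = Q y h'" for y by (rule Q) (auto simp: ov_def)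
    ultimately show "of_bool (Q (x + sum (ov I h h') C) (ov I h h')) = (of_bool (Q (x + sum h C) h') :: real)" by simp
  qed
  also have "\<dots> \<le> av ?W (\<lambda>h. \<epsilon>)"
    by (intro av_mono bd sgD(4)[OF V] x sum_cub[OF V _ CI(2)])
  finally show ?thesis using fin by (simp add: av_const)
qed

text \<open>By \<open>moebius\<close> it suffices to know all derivatives at \<open>x\<close>. If
  \<open>K\<close> has more than \<open>stg p\<close> elements, choose \<open>I0\<close> inside
  \<open>K\<close> with \<open>stg p + 1\<close> elements: \<open>D_union\<close> writes the
  derivative over \<open>K\<close> as a product of derivatives over \<open>I0\<close> at shifted
  base points, and validity makes each of them a function of values of lower level. Induction on the
  level finishes the argument.\<close>

lemma pat_det:
  assumes V: "elem2 V" and val: "valid V n S \<kappa>"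
  shows "\<exists>\<Lambda>. \<forall>x\<in>V. pr (cubn n V) (\<lambda>h. \<exists>I\<in>Pow {..<n}.
    pat S x h I \<noteq> \<Lambda> I (base S x) (res (FrI n S I) (Zf x h))) \<le> 4 ^ n * \<kappa>"
proof -
  let ?W = "cubn n V"
  let ?N = "Pow {..<n} :: nat set set"
  have wf: "wf_fam V S" using val by (simp add: valid_def)
  have finS: "finite S" and phS: "\<And>p. p \<in> S \<Longrightarrow> phase (ph p)" using wf by (auto simp: wf_fam_def)
  obtain err where err: "\<And>p. p \<in> S \<Longrightarrow> 0 \<le> err p"
      "\<And>p. p \<in> S \<Longrightarrow> detl V n (ph p) (low S (lev p)) (Suc (stg p)) (err p)" "sum err S \<le> \<kappa>"
    using val unfolding valid_def by blast
  define good where "good p I \<Psi> \<longleftrightarrow>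
      (\<forall>x\<in>V. pr ?W (\<lambda>h. D (ph p) x h I \<noteq> \<Psi> (pat (low S (lev p)) x h I)) \<le> err p)" for p I \<Psi>
  define \<Psi> where "\<Psi> p I = (SOME \<Psi>. good p I \<Psi>)" for p I
  have \<Psi>: "pr ?W (\<lambda>h. D (ph p) x h I \<noteq> \<Psi> p I (pat (low S (lev p)) x h I)) \<le> err p"
    if pI: "p \<in> S" "I \<in> ?N" "card I = Suc (stg p)" and x: "x \<in> V" for p I x
  proof -
    have "\<exists>\<Psi>. good p I \<Psi>" using err(2)[OF pI(1)] pI(2,3) unfolding detl_def good_def by auto
    then have "good p I (\<Psi> p I)" unfolding \<Psi>_def by (rule someI_ex[of "good p I"])
    then show ?thesis using x unfolding good_def by (rule bspec)
  qed
  \<comment> \<open>The exceptional event includes all shifted base points needed for the splitting.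
    There are 4^\<open>n\<close> pairs of an index set and a shift, whence the factor.\<close>
  define bad1 where "bad1 p I C x h \<longleftrightarrow> card I = Suc (stg p) \<and> C \<inter> I = {} \<and>
     D (ph p) (x + sum h C) h I \<noteq> \<Psi> p I (pat (low S (lev p)) (x + sum h C) h I)" for p I C x h
  define bad where "bad x h \<longleftrightarrow> (\<exists>p\<in>S. \<exists>I\<in>?N. \<exists>C\<in>?N. bad1 p I C x h)" for x h
  have bad1: "pr ?W (bad1 p I C x) \<le> err p" if "p \<in> S" "I \<in> ?N" "C \<in> ?N" "x \<in> V" for p I C x
  proof (cases "card I = Suc (stg p) \<and> C \<inter> I = {}")
    case False
    then have "bad1 p I C x = (\<lambda>h. False)" unfolding bad1_def by blast
    then have "pr ?W (bad1 p I C x) = 0" by (simp add: pr_def av_def)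
    then show ?thesis using err(1)[OF that(1)] by simp
  next
    case True
    define Q where "Q y h \<longleftrightarrow> D (ph p) y h I \<noteq> \<Psi> p I (pat (low S (lev p)) y h I)" for y h
    have "pr ?W (\<lambda>h. Q (x + sum h C) h) \<le> err p"
    proof (rule pr_base[OF V _ _ _ that(4), of I])
      show "Q y h = Q y h'" if "\<And>i. i \<in> I \<Longrightarrow> h i = h' i" for y h h'
        unfolding Q_def using D_cong[OF that, of I] pat_cong[OF that, of I] by simp
      show "pr ?W (Q y) \<le> err p" if "y \<in> V" for y
        unfolding Q_def using \<Psi>[OF \<open>p \<in> S\<close> \<open>I \<in> ?N\<close> _ that] True by blast
    qed (use that True in auto)
    moreover have "bad1 p I C x = (\<lambda>h. Q (x + sum h C) h)"
      unfolding bad1_def Q_def using True by blast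
    ultimately show ?thesis by (simp only:)
  qed
  have bad: "pr ?W (bad x) \<le> 4 ^ n * \<kappa>" if x: "x \<in> V" for x
  proof -
    have "pr ?W (bad x) \<le> (\<Sum>p\<in>S. pr ?W (\<lambda>h. \<exists>I\<in>?N. \<exists>C\<in>?N. bad1 p I C x h))"
      unfolding bad_def by (rule pr_union[OF finS])
    also have "\<dots> \<le> (\<Sum>p\<in>S. \<Sum>I\<in>?N. pr ?W (\<lambda>h. \<exists>C\<in>?N. bad1 p I C x h))"
      by (intro sum_mono pr_union) simp
    also have "\<dots> \<le> (\<Sum>p\<in>S. \<Sum>I\<in>?N. \<Sum>C\<in>?N. pr ?W (bad1 p I C x))"
      by (intro sum_mono pr_union) simp
    also have "\<dots> \<le> (\<Sum>p\<in>S. \<Sum>I\<in>?N. \<Sum>C\<in>?N. err p)"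
      by (intro sum_mono bad1 x)
    also have "\<dots> = 4 ^ n * sum err S"
      by (simp add: card_Pow sum_distrib_left power_mult_distrib[symmetric] mult.assoc[symmetric])
    also have "\<dots> \<le> 4 ^ n * \<kappa>" using err(3) by simp
    finally show ?thesis .
  qed
  have vert: "ph q (x + sum h J) = ph q (x' + sum h' J)"
    if "q \<in> S" "finite J" "\<And>K. K \<subseteq> J \<Longrightarrow> D (ph q) x h K = D (ph q) x' h' K" for q x x' h h' J
    unfolding moebius[OF phS[OF that(1)] that(2)] by (rule prod.cong[OF refl]) (use that(3) in auto)
  have key: "D (ph p) x h K = D (ph p) x' h' K"
    if xh: "x \<in> V" "h \<in> ?W" "\<not> bad x h" and xh': "x' \<in> V" "h' \<in> ?W" "\<not> bad x' h'"
      and I: "I \<in> ?N" and b: "base S x = base S x'"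
      and r: "res (FrI n S I) (Zf x h) = res (FrI n S I) (Zf x' h')"
      and pK: "p \<in> S" "K \<subseteq> I" for x h x' h' I p K
    using pK
  proof (induction "lev p" arbitrary: p K rule: less_induct)
    case less
    have finK: "finite K" using less(3) I finite_subset by (auto intro: finite_subset)
    consider "K = {}" | "K \<noteq> {}" "card K \<le> stg p" | "stg p < card K" by linarith
    then show ?case
    proof cases
      case 1
      then show ?thesis using fun_cong[OF b, of p] less(2) by (simp add: base_def)
    next
      case 2
      then have "(p, K) \<in> FrI n S I" using less I by (auto simp: FrI_def Free_def)
      then show ?thesis using fun_cong[OF r, of "(p, K)"] by (simp add: res_def Zf_def)
    next
      case 3
      then obtain I0 where I0: "I0 \<subseteq> K" "card I0 = Suc (stg p)"
        by (metis Suc_leI obtain_subset_with_card_n)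
      have fI0: "finite I0" using finite_subset[OF I0(1) finK] .
      have K: "K = I0 \<union> (K - I0)" using I0 by auto
      have inN: "I0 \<in> ?N" "\<And>C. C \<subseteq> K - I0 \<Longrightarrow> C \<in> ?N" using I0 less(3) I by auto
      have "D (ph p) (x + sum h C) h I0 = D (ph p) (x' + sum h' C) h' I0" if C: "C \<subseteq> K - I0" for C
      proof -
        have fC: "finite C" using C finK finite_subset by blast
        have "D (ph p) (x + sum h C) h I0 = \<Psi> p I0 (pat (low S (lev p)) (x + sum h C) h I0)"
          using xh(3) inN(1) inN(2)[OF C] less(2) C I0(2) unfolding bad_def bad1_def by blast
        moreover have "D (ph p) (x' + sum h' C) h' I0 = \<Psi> p I0 (pat (low S (lev p)) (x' + sum h' C) h' I0)"
          using xh'(3) inN(1) inN(2)[OF C] less(2) C I0(2) unfolding bad_def bad1_def by blast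
        moreover have "pat (low S (lev p)) (x + sum h C) h I0 = pat (low S (lev p)) (x' + sum h' C) h' I0"
        proof (intro ext)
          fix J q
          have "ph q (x + sum h C + sum h J) = ph q (x' + sum h' C + sum h' J)"
            if J: "J \<subseteq> I0" and q: "q \<in> S" "lev q < lev p"
          proof -
            have fJ: "finite J" using J fI0 finite_subset by blast
            have d: "C \<inter> J = {}" using C J by auto
            have "ph q (x + sum h (C \<union> J)) = ph q (x' + sum h' (C \<union> J))"
            proof (rule vert[OF q(1)])
              show "finite (C \<union> J)" using fC fJ by simp
              show "D (ph q) x h K' = D (ph q) x' h' K'" if "K' \<subseteq> C \<union> J" for K'
              proof (rule less(1)[OF q(2,1)])
                show "K' \<subseteq> I" using that C J I0(1) less(3) by blast
              qed
            qed
            then show ?thesis using fC fJ d by (simp add: sum.union_disjoint add.assoc)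
          qed
          then show "pat (low S (lev p)) (x + sum h C) h I0 J q = pat (low S (lev p)) (x' + sum h' C) h' I0 J q"
            by (auto simp: pat_def low_def)
        qed
        ultimately show ?thesis by simp
      qed
      moreover have "D (ph p) y g K = (\<Prod>C\<in>Pow (K - I0). D (ph p) (y + sum g C) g I0)" for y g
        using D_union[OF fI0, of "K - I0" "ph p" y g] finK K by auto
      ultimately show ?thesis by (auto intro: prod.cong)
    qed
  qed
  have "\<exists>g. \<forall>z\<in>{(x, h). x \<in> V \<and> h \<in> ?W \<and> \<not> bad x h}. (case z of (x, h) \<Rightarrow> pat S x h I) =
      g (case z of (x, h) \<Rightarrow> (base S x, res (FrI n S I) (Zf x h)))" if I: "I \<in> ?N" for I
  proof (rule factor_through, clarsimp)
    fix x h x' h'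
    assume a: "x \<in> V" "h \<in> ?W" "\<not> bad x h" "x' \<in> V" "h' \<in> ?W" "\<not> bad x' h'"
      "base S x = base S x'" "res (FrI n S I) (Zf x h) = res (FrI n S I) (Zf x' h')"
    show "pat S x h I = pat S x' h' I"
    proof (intro ext)
      fix J p
      have "ph p (x + sum h J) = ph p (x' + sum h' J)" if "J \<subseteq> I" "p \<in> S"
      proof (rule vert[OF that(2)])
        show "finite J" using that(1) I finite_subset by (auto intro: finite_subset)
        show "D (ph p) x h K = D (ph p) x' h' K" if "K \<subseteq> J" for K
          using that \<open>J \<subseteq> I\<close> by (intro key[OF a(1-6) I a(7,8) \<open>p \<in> S\<close>]) auto
      qed
      then show "pat S x h I J p = pat S x' h' I J p" by (auto simp: pat_def)
    qed
  qed
  then have "\<forall>I. \<exists>g. I \<in> ?N \<longrightarrow> (\<forall>z\<in>{(x, h). x \<in> V \<and> h \<in> ?W \<and> \<not> bad x h}.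
      (case z of (x, h) \<Rightarrow> pat S x h I) = g (case z of (x, h) \<Rightarrow> (base S x, res (FrI n S I) (Zf x h))))"
    by blast
  from choice[OF this] obtain g where g: "\<And>I x h. I \<in> ?N \<Longrightarrow> x \<in> V \<Longrightarrow> h \<in> ?W \<Longrightarrow> \<not> bad x h \<Longrightarrow>
      pat S x h I = g I (base S x, res (FrI n S I) (Zf x h))"
    by auto
  have "pr ?W (\<lambda>h. \<exists>I\<in>?N. pat S x h I \<noteq> g I (base S x, res (FrI n S I) (Zf x h))) \<le> 4 ^ n * \<kappa>"
    if x: "x \<in> V" for x
  proof (rule order_trans[OF pr_mono bad[OF x]])
    fix h assume h: "h \<in> ?W" and ex: "\<exists>I\<in>?N. pat S x h I \<noteq> g I (base S x, res (FrI n S I) (Zf x h))"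
    show "bad x h" using ex g[OF _ x h] by blast
  qed
  then show ?thesis by (intro exI[of _ "\<lambda>I b z. g I (b, z)"]) auto
qed

section \<open>Self-correction\<close>

text \<open>As soon as \<open>C\<close> contains one direction outside \<open>I\<close>, the shifted
  base point is uniform and independent of the directions in \<open>I\<close>. An error bound that
  holds only on average over base points is then enough.\<close>

lemma pr_unif:
  assumes V: "elem2 V" and C: "C \<subseteq> {..<n}" "C \<noteq> {}" "C \<inter> I = {}" and x: "x \<in> V"
    and Q: "\<And>y h h'. (\<And>i. i \<in> I \<Longrightarrow> h i = h' i) \<Longrightarrow> Q y h = Q y h'"
  shows "pr (cubn n V) (\<lambda>h. Q (x + sum h C) h) = av V (\<lambda>y. pr (cubn n V) (Q y))"
proof -
  let ?W = "cubn n V"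
  obtain w where w: "w \<in> C" using C by blast
  have wn: "w \<in> {..<n}" and wI: "w \<notin> I" using w C by auto
  have finC: "finite C" using C(1) finite_subset by blast
  have "pr ?W (\<lambda>h. Q (x + sum h C) h) = av ?W (\<lambda>h. av V (\<lambda>v. of_bool (Q (x + sum (h(w := v)) C) (h(w := v)))))"
    unfolding pr_def by (rule cub_resample1[OF wn sgD(1)[OF V] sgD(3)[OF V], symmetric])
  also have "\<dots> = av ?W (\<lambda>h. av V (\<lambda>v. of_bool (Q ((x + sum h (C - {w})) + v) h)))"
  proof (intro av_cong refl)
    fix h :: "nat \<Rightarrow> 'a" and v
    have "sum (h(w := v)) C = v + sum (h(w := v)) (C - {w})"
      by (subst sum.remove[OF finC w]) simp
    also have "sum (h(w := v)) (C - {w}) = sum h (C - {w})" by (intro sum.cong) auto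
    finally have 1: "x + sum (h(w := v)) C = (x + sum h (C - {w})) + v" by (simp add: add_ac)
    have 2: "Q y (h(w := v)) = Q y h" for y by (rule Q) (use wI in auto)
    show "of_bool (Q (x + sum (h(w := v)) C) (h(w := v))) = (of_bool (Q ((x + sum h (C - {w})) + v) h) :: real)"
      unfolding 1 2 ..
  qed
  also have "\<dots> = av ?W (\<lambda>h. av V (\<lambda>v. of_bool (Q v h)))"
  proof (rule av_cong[OF refl])
    fix h assume "h \<in> ?W"
    then have "x + sum h (C - {w}) \<in> V" using C(1) by (intro sgD(4)[OF V x] sum_cub[OF V]) auto
    then show "av V (\<lambda>v. of_bool (Q ((x + sum h (C - {w})) + v) h)) = av V (\<lambda>v. of_bool (Q v h))"
      by (rule av_shift'[OF V])
  qed
  also have "\<dots> = av V (\<lambda>y. pr ?W (Q y))" unfolding pr_def by (rule av_swap)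
  finally show ?thesis .
qed

text \<open>The derivative over \<open>I \<union> Y\<close> has order above \<open>e\<close> and is
  1. Splitting it with \<open>D_union\<close>, one solves for the factor with \<open>C\<close>
  empty.\<close>

lemma self_correct:
  assumes V: "elem2 V" and R: "phase R" "dg V e R" and I: "I \<subseteq> {..<n}" and Y: "Y \<subseteq> {..<n}" "card Y = Suc e" "I \<inter> Y = {}"
    and x: "x \<in> V" and h: "h \<in> cubn n V"
  shows "D R x h I = (\<Prod>C\<in>Pow Y - {{}}. D R (x + sum h C) h I)"
proof -
  have fin: "finite I" "finite Y" using I Y(1) finite_subset by blast+
  have hV: "h i \<in> V" if "i \<in> I \<union> Y" for i using h that I Y(1) by (auto simp: cub_def)
  have "e < card (I \<union> Y)" using fin Y by (simp add: card_Un_disjoint)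
  then have "D R x h (I \<union> Y) = 1" using fin by (intro D_eq_1[OF V R(1) _ hV R(2) _ x]) auto
  then have "1 = D R x h (I \<union> Y)" by simp
  also have "\<dots> = D R x h I * (\<Prod>C\<in>Pow Y - {{}}. D R (x + sum h C) h I)"
    unfolding D_union[OF fin Y(3)] using fin by (subst prod.remove[of _ "{}"]) auto
  finally have "D R x h I * 1 = D R x h I * D R x h I * (\<Prod>C\<in>Pow Y - {{}}. D R (x + sum h C) h I)"
    by (simp add: mult.assoc)
  then show ?thesis using phase_sq[OF phase_D[OF R(1)], of x h I] by simp
qed

text \<open>Turns an error averaged over base points into one valid at every base point.
  Self-correction along a block \<open>Y\<close> of extra directions gives a formula valid at every
  \<open>x\<close>, but it reads the pattern over \<open>I \<union> Y\<close>. A second block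
  \<open>Y'\<close> gives another formula for the same value. In terms of the free derivatives the
  first formula ignores everything that involves \<open>Y'\<close>; as the two mostly agree and the
  free derivatives are nearly uniform, the ones involving \<open>Y'\<close> can be frozen in the
  second formula, which then reads only the pattern over \<open>I\<close>.\<close>

lemma upgrade:
  assumes V: "elem2 V" and val: "valid V n S \<kappa>" and rg: "Rg V S \<eta>" and e0: "0 \<le> \<eta>"
    and R: "phase R" "dg V e R" and I: "I \<subseteq> {..<n}" and n: "card I + 2 * Suc e \<le> n"
    and ap: "av V (\<lambda>x. pr (cubn n V) (\<lambda>h. D R x h I \<noteq> F (pat S x h I))) \<le> \<epsilon>"
  shows "\<exists>F'. \<forall>x\<in>V. pr (cubn n V) (\<lambda>h. D R x h I \<noteq> F' (pat S x h I))
     \<le> 3 * (2 ^ Suc e * \<epsilon>) + 3 * (4 ^ n * \<kappa>) + 2 * (2 ^ (card S * 2 ^ n) * \<eta>)"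
proof -
  let ?W = "cubn n V"
  have W: "finite ?W" "?W \<noteq> {}" using sgD(1,3)[OF V] by (auto simp: cub_finite cub_ne)
  have wf: "wf_fam V S" using val by (simp add: valid_def)
  have finS: "finite S" and phS: "\<And>p. p \<in> S \<Longrightarrow> phase (ph p)" using wf by (auto simp: wf_fam_def)
  have finI: "finite I" using I finite_subset by blast
  have eps0: "0 \<le> \<epsilon>" by (rule order_trans[OF _ ap]) (intro av_nonneg pr_nonneg)
  \<comment> \<open>Two disjoint blocks of \<open>Suc e\<close> directions outside \<open>I\<close>;
    this is the reason for \<open>2 * Suc e\<close> in the bound on \<open>n\<close>.\<close>
  have "Suc e \<le> card ({..<n} - I)" using n I finI by (simp add: card_Diff_subset)
  then obtain Y where Y: "Y \<subseteq> {..<n} - I" "card Y = Suc e" "finite Y" by (metis obtain_subset_with_card_n)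
  have "Suc e \<le> card ({..<n} - (I \<union> Y))"
  proof -
    have "card (I \<union> Y) = card I + Suc e" using finI Y by (subst card_Un_disjoint) auto
    then show ?thesis using n I finI Y by (subst card_Diff_subset) auto
  qed
  then obtain Y' where Y': "Y' \<subseteq> {..<n} - (I \<union> Y)" "card Y' = Suc e" "finite Y'" by (metis obtain_subset_with_card_n)
  define rs where "rs C P = (\<lambda>J p. if J \<subseteq> I \<and> p \<in> S then P (J \<union> C) p else (1::real))"
    for C and P :: "nat set \<Rightarrow> 'a tri \<Rightarrow> real"
  define \<Psi> where "\<Psi> Y P = (\<Prod>C\<in>Pow Y - {{}}. F (rs C P))" for Y P
  define a where "a = 2 ^ Suc e * \<epsilon>"
  have \<Psi>: "pr ?W (\<lambda>h. D R x h I \<noteq> \<Psi> Y (pat S x h (I \<union> Y))) \<le> a"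
    if Y: "Y \<subseteq> {..<n} - I" "card Y = Suc e" "finite Y" and x: "x \<in> V" for Y x
  proof -
    have IY: "I \<inter> Y = {}" using Y by auto
    define Q where "Q y h \<longleftrightarrow> D R y h I \<noteq> F (pat S y h I)" for y h
    have "pr ?W (\<lambda>h. D R x h I \<noteq> \<Psi> Y (pat S x h (I \<union> Y))) \<le> pr ?W (\<lambda>h. \<exists>C\<in>Pow Y - {{}}. Q (x + sum h C) h)"
    proof (rule pr_mono, rule ccontr)
      fix h assume h: "h \<in> ?W" and ne: "D R x h I \<noteq> \<Psi> Y (pat S x h (I \<union> Y))"
        and no: "\<not> (\<exists>C\<in>Pow Y - {{}}. Q (x + sum h C) h)"
      have "D R x h I = (\<Prod>C\<in>Pow Y - {{}}. D R (x + sum h C) h I)"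
        using Y IY by (intro self_correct[OF V R I _ _ _ x h]) auto
      also have "\<dots> = (\<Prod>C\<in>Pow Y - {{}}. F (rs C (pat S x h (I \<union> Y))))"
      proof (rule prod.cong[OF refl])
        fix C assume C: "C \<in> Pow Y - {{}}"
        have "rs C (pat S x h (I \<union> Y)) = pat S (x + sum h C) h I"
        proof (intro ext)
          fix J p
          show "rs C (pat S x h (I \<union> Y)) J p = pat S (x + sum h C) h I J p"
          proof (cases "J \<subseteq> I \<and> p \<in> S")
            case True
            then have "finite J" "finite C" "J \<inter> C = {}" "J \<union> C \<subseteq> I \<union> Y"
              using C finI Y(3) IY by (auto dest: finite_subset)
            then show ?thesis using True by (simp add: rs_def pat_def sum.union_disjoint add_ac)
          qed (auto simp: rs_def pat_def)
        qed
        then show "D R (x + sum h C) h I = F (rs C (pat S x h (I \<union> Y)))" using no C by (auto simp: Q_def)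
      qed
      finally show False using ne by (simp add: \<Psi>_def)
    qed
    also have "\<dots> \<le> (\<Sum>C\<in>Pow Y - {{}}. pr ?W (\<lambda>h. Q (x + sum h C) h))"
      using Y by (intro pr_union) auto
    also have "\<dots> \<le> (\<Sum>C\<in>Pow Y - {{}}. \<epsilon>)"
    proof (rule sum_mono)
      fix C assume C: "C \<in> Pow Y - {{}}"
      have "pr ?W (\<lambda>h. Q (x + sum h C) h) = av V (\<lambda>y. pr ?W (Q y))"
      proof (rule pr_unif[OF V _ _ _ x, of C n I])
        show "Q y h = Q y h'" if "\<And>i. i \<in> I \<Longrightarrow> h i = h' i" for y h h'
          unfolding Q_def using D_cong[OF that, of I] pat_cong[OF that, of I] by simp
      qed (use C Y in auto)
      then show "pr ?W (\<lambda>h. Q (x + sum h C) h) \<le> \<epsilon>" using ap unfolding Q_def by simp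
    qed
    also have "\<dots> \<le> a"
    proof -
      have "real (card (Pow Y - {{}})) \<le> 2 ^ Suc e" using Y by (simp add: card_Diff_singleton card_Pow)
      then show ?thesis using eps0 unfolding a_def by (simp add: mult_right_mono)
    qed
    finally show ?thesis .
  qed
  obtain \<Lambda> where \<Lambda>: "\<And>x. x \<in> V \<Longrightarrow> pr ?W (\<lambda>h. \<exists>I\<in>Pow {..<n}.
    pat S x h I \<noteq> \<Lambda> I (base S x) (res (FrI n S I) (Zf x h))) \<le> 4 ^ n * \<kappa>"
    using pat_det[OF V val] by blast
  let ?F = "Free n S"
  have finF: "finite ?F" by (rule Free_finite[OF finS])
  define \<nu> where "\<nu> = 2 ^ card ?F * \<eta>"
  have \<nu>: "\<nu> \<le> 2 ^ (card S * 2 ^ n) * \<eta>"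
    unfolding \<nu>_def using e0 Free_card[OF finS, of n] by (intro mult_right_mono power_increasing) auto
  define G where "G Y b z = \<Psi> Y (\<Lambda> (I \<union> Y) b (res (FrI n S (I \<union> Y)) z))" for Y b z
  define P2 where "P2 = FrI n S (I \<union> Y') - FrI n S I"
  define c where "c = 2 * a + 4 ^ n * \<kappa> + \<nu>"
  have pmZ: "Zf x h q = 1 \<or> Zf x h q = -1" if "q \<in> ?F" for x h q
    unfolding Zf_def using that by (intro phase_D' phS) (auto simp: Free_def)
  have nu: "\<bar>pr ?W (\<lambda>h. Q (res ?F (Zf x h))) - pr (sgn_cub ?F) Q\<bar> \<le> \<nu>" if x: "x \<in> V" for x Q
    unfolding \<nu>_def by (rule near_uniform[OF finF W pmZ e0 fourier_free[OF V wf rg e0 x]])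
  have resF: "res (FrI n S J) (res ?F z) = res (FrI n S J) z" for J z
    by (auto simp: res_def FrI_def fun_eq_iff)
  define good\<zeta> where "good\<zeta> b \<zeta> \<longleftrightarrow> pr (sgn_cub ?F) (\<lambda>z. G Y b z \<noteq> G Y' b (ov P2 z \<zeta>)) \<le> c" for b \<zeta>
  define \<zeta> where "\<zeta> b = (SOME \<zeta>. good\<zeta> b \<zeta>)" for b
  have bad: "pr ?W (\<lambda>h. D R x h I \<noteq> G Y (base S x) (res ?F (Zf x h))) \<le> a + 4 ^ n * \<kappa>"
    and coll: "pr ?W (\<lambda>h. G Y (base S x) (res ?F (Zf x h)) \<noteq> G Y' (base S x) (res ?F (Zf x h))) \<le> 2 * a + 4 ^ n * \<kappa>"
    if x: "x \<in> V" for x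
  proof -
    let ?E = "\<lambda>h. \<exists>I\<in>Pow {..<n}. pat S x h I \<noteq> \<Lambda> I (base S x) (res (FrI n S I) (Zf x h))"
    let ?A = "\<lambda>Y h. D R x h I \<noteq> \<Psi> Y (pat S x h (I \<union> Y))"
    have sub: "I \<union> Y \<in> Pow {..<n}" "I \<union> Y' \<in> Pow {..<n}" using I Y Y' by auto
    have g: "\<Psi> Y0 (pat S x h (I \<union> Y0)) = G Y0 (base S x) (res ?F (Zf x h))"
      if "\<not> ?E h" "I \<union> Y0 \<in> Pow {..<n}" for h Y0
      using that unfolding G_def resF by metis
    have A: "pr ?W (?A Y) \<le> a" "pr ?W (?A Y') \<le> a" using Y Y' x by (auto intro!: \<Psi>)
    have "pr ?W (\<lambda>h. D R x h I \<noteq> G Y (base S x) (res ?F (Zf x h))) \<le> pr ?W (\<lambda>h. ?A Y h \<or> ?E h)"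
      using g[OF _ sub(1)] by (intro pr_mono) metis
    also have "\<dots> \<le> pr ?W (?A Y) + pr ?W ?E" by (rule pr_disj)
    finally show "pr ?W (\<lambda>h. D R x h I \<noteq> G Y (base S x) (res ?F (Zf x h))) \<le> a + 4 ^ n * \<kappa>"
      using A \<Lambda>[OF x] by linarith
    have "pr ?W (\<lambda>h. G Y (base S x) (res ?F (Zf x h)) \<noteq> G Y' (base S x) (res ?F (Zf x h)))
      \<le> pr ?W (\<lambda>h. (?A Y h \<or> ?A Y' h) \<or> ?E h)"
      using g[OF _ sub(1)] g[OF _ sub(2)] by (intro pr_mono) metis
    also have "\<dots> \<le> pr ?W (\<lambda>h. ?A Y h \<or> ?A Y' h) + pr ?W ?E" by (rule pr_disj)
    also have "pr ?W (\<lambda>h. ?A Y h \<or> ?A Y' h) \<le> pr ?W (?A Y) + pr ?W (?A Y')" by (rule pr_disj)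
    finally show "pr ?W (\<lambda>h. G Y (base S x) (res ?F (Zf x h)) \<noteq> G Y' (base S x) (res ?F (Zf x h))) \<le> 2 * a + 4 ^ n * \<kappa>"
      using A \<Lambda>[OF x] by linarith
  qed
  have \<zeta>: "good\<zeta> (base S x) (\<zeta> (base S x))" if x: "x \<in> V" for x
    unfolding \<zeta>_def
  proof (rule someI_ex[of "good\<zeta> (base S x)"])
    let ?b = "base S x" and ?X = "sgn_cub ?F"
    \<comment> \<open>The formula from \<open>Y\<close> does not read the coordinates in
      \<open>P2\<close>, so it is unchanged when they are resampled. The disagreement of the two
      formulas is therefore an average over frozen values, and some choice is at most
      average.\<close>
    have GY: "G Y ?b (ov P2 z z') = G Y ?b z" for z z'
    proof -
      have "res (FrI n S (I \<union> Y)) (ov P2 z z') = res (FrI n S (I \<union> Y)) z"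
      proof
        fix q
        have "q \<notin> P2" if "q \<in> FrI n S (I \<union> Y)"
          using that Y Y' by (auto simp: P2_def FrI_def)
        then show "res (FrI n S (I \<union> Y)) (ov P2 z z') q = res (FrI n S (I \<union> Y)) z q"
          by (simp add: res_def ov_def)
      qed
      then show ?thesis by (simp add: G_def)
    qed
    have "av ?X (\<lambda>z'. av ?X (\<lambda>z. of_bool (G Y ?b z \<noteq> G Y' ?b (ov P2 z z')))) =
       av ?X (\<lambda>z. av ?X (\<lambda>z'. of_bool (G Y ?b (ov P2 z z') \<noteq> G Y' ?b (ov P2 z z'))))"
      unfolding GY by (rule av_swap)
    also have "\<dots> = av ?X (\<lambda>z. of_bool (G Y ?b z \<noteq> G Y' ?b z))"
      unfolding sgn_cub_def using finF by (intro cub_resample) (auto simp: P2_def FrI_def)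
    also have "\<dots> = pr ?X (\<lambda>z. G Y ?b z \<noteq> G Y' ?b z)" by (simp add: pr_def)
    also have "\<dots> \<le> c" using nu[OF x, of "\<lambda>z. G Y ?b z \<noteq> G Y' ?b z"] coll[OF x] unfolding c_def by linarith
    finally obtain z' where "av ?X (\<lambda>z. of_bool (G Y ?b z \<noteq> G Y' ?b (ov P2 z z'))) \<le> c"
      using av_exists_le[OF sgn_cub_fin(1)[OF finF] sgn_cub_fin(2)] by blast
    then show "\<exists>\<zeta>. good\<zeta> ?b \<zeta>" by (auto simp: good\<zeta>_def pr_def)
  qed
  \<comment> \<open>Recovers a free derivative over \<open>snd q\<close> from the vertex values
    stored in a pattern.\<close>
  define zP where "zP P = (\<lambda>q. \<Prod>J\<in>Pow (snd q). P J (fst q))" for P :: "nat set \<Rightarrow> 'a tri \<Rightarrow> real"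
  define F' where "F' P = G Y' (P {}) (ov P2 (zP P) (\<zeta> (P {})))" for P :: "nat set \<Rightarrow> 'a tri \<Rightarrow> real"
  have "pr ?W (\<lambda>h. D R x h I \<noteq> F' (pat S x h I)) \<le> 3 * a + 3 * (4 ^ n * \<kappa>) + 2 * \<nu>" if x: "x \<in> V" for x
  proof -
    let ?b = "base S x"
    let ?z = "\<zeta> ?b"
    have F'e: "F' (pat S x h I) = G Y' ?b (ov P2 (res ?F (Zf x h)) ?z)" for h
    proof -
      have b: "pat S x h I {} = ?b" by (auto simp: pat_def base_def fun_eq_iff)
      have "res (FrI n S (I \<union> Y')) (ov P2 (zP (pat S x h I)) ?z) = res (FrI n S (I \<union> Y')) (ov P2 (res ?F (Zf x h)) ?z)"
      proof
        fix q
        show "res (FrI n S (I \<union> Y')) (ov P2 (zP (pat S x h I)) ?z) q = res (FrI n S (I \<union> Y')) (ov P2 (res ?F (Zf x h)) ?z) q"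
        proof (cases "q \<in> FrI n S (I \<union> Y') \<and> q \<notin> P2")
          case True
          then have q: "q \<in> ?F" "snd q \<subseteq> I" "fst q \<in> S" by (auto simp: P2_def FrI_def Free_def)
          have "zP (pat S x h I) q = (\<Prod>J\<in>Pow (snd q). ph (fst q) (x + sum h J))"
            unfolding zP_def by (rule prod.cong[OF refl]) (use q in \<open>auto simp: pat_def\<close>)
          then have "zP (pat S x h I) q = Zf x h q" by (simp add: Zf_def D_def)
          then show ?thesis using True q by (simp add: res_def ov_def)
        qed (auto simp: res_def ov_def)
      qed
      then show ?thesis by (simp add: F'_def b G_def)
    qed
    have "pr ?W (\<lambda>h. D R x h I \<noteq> F' (pat S x h I)) \<le>
       pr ?W (\<lambda>h. D R x h I \<noteq> G Y ?b (res ?F (Zf x h)) \<or>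
          G Y ?b (res ?F (Zf x h)) \<noteq> G Y' ?b (ov P2 (res ?F (Zf x h)) ?z))"
      unfolding F'e by (rule pr_mono) auto
    also have "\<dots> \<le> pr ?W (\<lambda>h. D R x h I \<noteq> G Y ?b (res ?F (Zf x h))) +
       pr ?W (\<lambda>h. G Y ?b (res ?F (Zf x h)) \<noteq> G Y' ?b (ov P2 (res ?F (Zf x h)) ?z))" by (rule pr_disj)
    also have "\<dots> \<le> (a + 4 ^ n * \<kappa>) + (c + \<nu>)"
      using bad[OF x] \<zeta>[OF x] nu[OF x, of "\<lambda>z. G Y ?b z \<noteq> G Y' ?b (ov P2 z ?z)"]
      unfolding good\<zeta>_def by linarith
    also have "\<dots> \<le> 3 * a + 3 * (4 ^ n * \<kappa>) + 2 * \<nu>"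
    proof -
      have "0 \<le> 4 ^ n * \<kappa>" using \<Lambda>[OF x] pr_nonneg order_trans by blast
      then show ?thesis unfolding c_def by linarith
    qed
    finally show ?thesis .
  qed
  then show ?thesis using \<nu> unfolding a_def by (intro exI[of _ F']) (meson add_left_mono mult_left_mono order_trans zero_le_numeral)
qed

section \<open>Derivatives as sampled approximations\<close>

lemma sum_fun_app: "(sum v S) i = (\<Sum>s\<in>S. v s i)"
  by (induction S rule: infinite_finite_induct) auto

lemma sum_Pow_insert:
  assumes "finite I" "i \<notin> I"
  shows "sum f (Pow (insert i I)) = sum f (Pow I) + (\<Sum>J\<in>Pow I. f (insert i J))"
  unfolding Pow_insert using assms Pow_insert_split[OF assms]
  by (simp add: sum.union_disjoint sum.reindex)

text \<open>Averaging a function over the cosets of a random subgroup of order \<open>2\<^sup>\<tau>\<close>, built up one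
  generator at a time, halves the variance in each step.\<close>

lemma halving:
  fixes f :: "'z::ab_group_add \<Rightarrow> real"
  assumes Z: "elem2 Z"
  shows "\<exists>g. (\<forall>s::nat. g s \<in> Z) \<and>
     av Z (\<lambda>z. ((\<Sum>L\<in>Pow {..<\<tau>}. f (z + sum g L)) / 2 ^ \<tau> - av Z f)\<^sup>2) \<le> av Z (\<lambda>z. (f z - av Z f)\<^sup>2) / 2 ^ \<tau>"
proof (induction \<tau>)
  case 0
  show ?case using sgD(2)[OF Z] by (intro exI[of _ "\<lambda>_. 0"]) simp
next
  case (Suc \<tau>)
  then obtain g where g: "\<And>s. g s \<in> Z"
     "av Z (\<lambda>z. ((\<Sum>L\<in>Pow {..<\<tau>}. f (z + sum g L)) / 2 ^ \<tau> - av Z f)\<^sup>2) \<le> av Z (\<lambda>z. (f z - av Z f)\<^sup>2) / 2 ^ \<tau>"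
    by blast
  have fZ: "finite Z" "Z \<noteq> {}" using sgD[OF Z] by auto
  define u where "u z = (\<Sum>L\<in>Pow {..<\<tau>}. f (z + sum g L)) / 2 ^ \<tau> - av Z f" for z
  have gL: "sum g L \<in> Z" if "L \<in> Pow {..<\<tau>}" for L
    using that g(1) finite_subset by (intro sg_sum[OF Z]) auto
  have avu: "av Z u = 0"
  proof -
    have "av Z u = av Z (\<lambda>z. (\<Sum>L\<in>Pow {..<\<tau>}. f (z + sum g L)) * (1 / 2 ^ \<tau>)) - av Z f"
      unfolding u_def using fZ by (simp add: av_diff av_const)
    also have "\<dots> = (\<Sum>L\<in>Pow {..<\<tau>}. av Z (\<lambda>z. f (z + sum g L))) * (1 / 2 ^ \<tau>) - av Z f"
      by (simp only: av_cmult_right av_sum)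
    also have "(\<Sum>L\<in>Pow {..<\<tau>}. av Z (\<lambda>z. f (z + sum g L))) = (\<Sum>L\<in>Pow {..<\<tau>}. av Z f)"
      by (intro sum.cong refl av_shift[OF Z] gL)
    finally show ?thesis by (simp add: card_Pow)
  qed
  \<comment> \<open>Averaged over \<open>k\<close>, the cross term is the square of the mean of
    \<open>u\<close>, which is 0. Some \<open>k\<close> does at least as well as the
    average.\<close>
  have "av Z (\<lambda>k. av Z (\<lambda>z. ((u z + u (z + k)) / 2)\<^sup>2)) =
    av Z (\<lambda>k. av Z (\<lambda>z. (1/4) * (u z)\<^sup>2 + (1/4) * (u (z + k))\<^sup>2 + (1/2) * (u z * u (z + k))))"
    by (intro av_cong refl) (simp add: power2_eq_square field_simps)
  also have "\<dots> = av Z (\<lambda>k. (1/4) * av Z (\<lambda>z. (u z)\<^sup>2) + (1/4) * av Z (\<lambda>z. (u z)\<^sup>2) + (1/2) * av Z (\<lambda>z. u z * u (z + k)))"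
    by (rule av_cong[OF refl]) (simp only: av_add av_cmult av_shift[OF Z, of _ "\<lambda>z. (u z)\<^sup>2"])
  also have "\<dots> = (1/2) * av Z (\<lambda>z. (u z)\<^sup>2) + (1/2) * av Z (\<lambda>k. av Z (\<lambda>z. u z * u (z + k)))"
    unfolding av_add av_cmult av_const[OF fZ] by simp
  also have "av Z (\<lambda>k. av Z (\<lambda>z. u z * u (z + k))) = av Z (\<lambda>z. u z * av Z (\<lambda>k. u (z + k)))"
    by (subst av_swap) (simp only: av_cmult)
  also have "\<dots> = av Z (\<lambda>z. 0)"
    by (rule av_cong[OF refl]) (simp only: av_shift'[OF Z] avu mult_zero_right)
  finally have "av Z (\<lambda>k. av Z (\<lambda>z. ((u z + u (z + k)) / 2)\<^sup>2)) \<le> av Z (\<lambda>z. (u z)\<^sup>2) / 2"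
    using fZ by (simp add: av_const)
  then obtain k where k: "k \<in> Z" "av Z (\<lambda>z. ((u z + u (z + k)) / 2)\<^sup>2) \<le> av Z (\<lambda>z. (u z)\<^sup>2) / 2"
    using av_exists_le[OF fZ] by blast
  define g' where "g' = g(\<tau> := k)"
  have gg: "sum g' L = sum g L" if "L \<subseteq> {..<\<tau>}" for L
    unfolding g'_def using that by (intro sum.cong) auto
  have ins: "sum g' (insert \<tau> L) = k + sum g L" if "L \<subseteq> {..<\<tau>}" for L
  proof -
    have "finite L" "\<tau> \<notin> L" using that finite_subset by blast+
    then show ?thesis using gg[OF that] by (simp add: g'_def)
  qed
  have "(\<Sum>L\<in>Pow {..<Suc \<tau>}. f (z + sum g' L)) / 2 ^ Suc \<tau> - av Z f = (u z + u (z + k)) / 2" for z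
  proof -
    have "(\<Sum>L\<in>Pow {..<Suc \<tau>}. f (z + sum g' L)) =
      (\<Sum>L\<in>Pow {..<\<tau>}. f (z + sum g' L)) + (\<Sum>L\<in>Pow {..<\<tau>}. f (z + sum g' (insert \<tau> L)))"
      unfolding lessThan_Suc by (rule sum_Pow_insert) auto
    also have "\<dots> = (\<Sum>L\<in>Pow {..<\<tau>}. f (z + sum g L)) + (\<Sum>L\<in>Pow {..<\<tau>}. f (z + k + sum g L))"
      using gg ins by (intro arg_cong2[where f = "(+)"] sum.cong refl) (auto simp: add.assoc)
    finally show ?thesis by (simp add: u_def field_simps)
  qed
  moreover have "av Z (\<lambda>z. ((u z + u (z + k)) / 2)\<^sup>2) \<le> av Z (\<lambda>z. (f z - av Z f)\<^sup>2) / 2 ^ Suc \<tau>"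
  proof -
    have "av Z (\<lambda>z. (u z)\<^sup>2) / 2 \<le> (av Z (\<lambda>z. (f z - av Z f)\<^sup>2) / 2 ^ \<tau>) / 2"
      using g(2) unfolding u_def[symmetric] by (rule divide_right_mono) simp
    then show ?thesis using k(2) by (simp add: mult.commute)
  qed
  ultimately have "av Z (\<lambda>z. ((\<Sum>L\<in>Pow {..<Suc \<tau>}. f (z + sum g' L)) / 2 ^ Suc \<tau> - av Z f)\<^sup>2)
     \<le> av Z (\<lambda>z. (f z - av Z f)\<^sup>2) / 2 ^ Suc \<tau>" by (simp only:)
  moreover have "\<forall>s. g' s \<in> Z" using g(1) k(1) by (simp add: g'_def)
  ultimately show ?case by blast
qed

text \<open>By Chebyshev the sample mean has the sign of \<open>av Z f\<close> except with
  probability \<open>\<epsilon>\<close>. Multiplying it by \<open>f z\<close> and solving for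
  \<open>f z\<close> expresses \<open>f\<close> through the products
  \<open>f z * f (z + sum g L)\<close>, which are derivatives of \<open>f\<close> and not mere
  translates.\<close>

lemma sampling:
  fixes f :: "'z::ab_group_add \<Rightarrow> real"
  assumes Z: "elem2 Z" and f: "\<And>z. z \<in> Z \<Longrightarrow> f z = 1 \<or> f z = -1"
    and b: "av Z f \<noteq> 0" and t: "1 \<le> 2 ^ \<tau> * \<epsilon> * (av Z f)\<^sup>2"
  shows "\<exists>g. (\<forall>s::nat. g s \<in> Z) \<and>
     pr Z (\<lambda>z. f z \<noteq> sgn (av Z f) * sgn (f z * (\<Sum>L\<in>Pow {..<\<tau>}. f (z + sum g L)))) \<le> \<epsilon>"
proof -
  let ?b = "av Z f"
  have fZ: "finite Z" "Z \<noteq> {}" using sgD[OF Z] by auto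
  obtain g where g: "\<And>s. g s \<in> Z" and v:
     "av Z (\<lambda>z. ((\<Sum>L\<in>Pow {..<\<tau>}. f (z + sum g L)) / 2 ^ \<tau> - ?b)\<^sup>2) \<le> av Z (\<lambda>z. (f z - ?b)\<^sup>2) / 2 ^ \<tau>"
    using halving[OF Z, of f \<tau>] by blast
  have "av Z (\<lambda>z. (f z - ?b)\<^sup>2) = av Z (\<lambda>z. 1 - 2 * ?b * f z + ?b\<^sup>2)"
  proof (rule av_cong[OF refl])
    fix z assume "z \<in> Z"
    then have "(f z)\<^sup>2 = 1" using f by fastforce
    then show "(f z - ?b)\<^sup>2 = 1 - 2 * ?b * f z + ?b\<^sup>2" by (simp add: power2_diff)
  qed
  also have "\<dots> = 1 - ?b\<^sup>2" using fZ by (simp add: av_add av_diff av_cmult av_const power2_eq_square)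
  finally have v1: "av Z (\<lambda>z. (f z - ?b)\<^sup>2) \<le> 1" by simp
  define A where "A z = (\<Sum>L\<in>Pow {..<\<tau>}. f (z + sum g L)) / 2 ^ \<tau>" for z
  have v2: "av Z (\<lambda>z. (A z - ?b)\<^sup>2) \<le> 1 / 2 ^ \<tau>"
    using v v1 unfolding A_def by (rule order_trans[OF _ divide_right_mono]) simp
  have "pr Z (\<lambda>z. f z \<noteq> sgn ?b * sgn (f z * (\<Sum>L\<in>Pow {..<\<tau>}. f (z + sum g L)))) \<le> av Z (\<lambda>z. (A z - ?b)\<^sup>2 / ?b\<^sup>2)"
    unfolding pr_def
  proof (rule av_mono)
    fix z assume z: "z \<in> Z"
    show "of_bool (f z \<noteq> sgn ?b * sgn (f z * (\<Sum>L\<in>Pow {..<\<tau>}. f (z + sum g L)))) \<le> (A z - ?b)\<^sup>2 / ?b\<^sup>2"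
    proof (cases "\<bar>A z - ?b\<bar> < \<bar>?b\<bar>")
      case False
      then have "\<bar>?b\<bar>\<^sup>2 \<le> \<bar>A z - ?b\<bar>\<^sup>2" by (intro power_mono) auto
      then have "1 \<le> (A z - ?b)\<^sup>2 / ?b\<^sup>2" using b by (simp add: le_divide_eq)
      then show ?thesis using of_bool_less_eq_one order_trans by blast
    next
      case True
      then have "sgn (A z) = sgn ?b" by (auto simp: sgn_if abs_if split: if_splits)
      moreover have "sgn (A z) = sgn (\<Sum>L\<in>Pow {..<\<tau>}. f (z + sum g L))" by (simp add: A_def sgn_divide)
      moreover have "sgn ?b * (sgn (f z) * sgn ?b) = f z" using f[OF z] b by (auto simp: sgn_if)
      ultimately have "f z = sgn ?b * sgn (f z * (\<Sum>L\<in>Pow {..<\<tau>}. f (z + sum g L)))" by (simp add: sgn_mult)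
      then show ?thesis by simp
    qed
  qed
  also have "\<dots> = av Z (\<lambda>z. (A z - ?b)\<^sup>2) / ?b\<^sup>2" by (simp add: divide_inverse av_cmult_right)
  also have "\<dots> \<le> (1 / 2 ^ \<tau>) / ?b\<^sup>2" by (rule divide_right_mono[OF v2]) simp
  also have "\<dots> \<le> \<epsilon>" using t b by (simp add: divide_le_eq mult_ac)
  finally show ?thesis using g by blast
qed

lemma card_small_subsets: "card {L. L \<subseteq> {..<\<tau>::nat} \<and> card L \<le> k} \<le> (\<tau> + 1) ^ k"
proof (induction k)
  case 0
  have "{L. L \<subseteq> {..<\<tau>} \<and> card L \<le> 0} \<subseteq> {{}}" by (auto dest: finite_subset)
  then show ?case using card_mono[of "{{}}" "{L. L \<subseteq> {..<\<tau>} \<and> card L \<le> 0}"] by simp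
next
  case (Suc k)
  let ?S = "\<lambda>k. {L. L \<subseteq> {..<\<tau>} \<and> card L \<le> k}"
  have fin: "finite (?S k)" for k by (rule finite_subset[of _ "Pow {..<\<tau>}"]) auto
  \<comment> \<open>The extra index \<open>s = \<tau>\<close> inserts nothing and covers the sets
    that already have at most \<open>k\<close> elements.\<close>
  have "?S (Suc k) \<subseteq> (\<lambda>(L, s). if s < \<tau> then insert s L else L) ` (?S k \<times> {..\<tau>})"
  proof
    fix L assume L: "L \<in> ?S (Suc k)"
    show "L \<in> (\<lambda>(L, s). if s < \<tau> then insert s L else L) ` (?S k \<times> {..\<tau>})"
    proof (cases "card L \<le> k")
      case True
      then show ?thesis using L by (intro image_eqI[of _ _ "(L, \<tau>)"]) auto
    next
      case False
      then obtain s where s: "s \<in> L" by (metis card.empty ex_in_conv le0)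
      have "finite L" using L finite_subset by auto
      moreover have "card L \<le> Suc k" using L by simp
      ultimately have "card (L - {s}) \<le> k" using s by (simp add: card_Diff_singleton)
      then show ?thesis using L s by (intro image_eqI[of _ _ "(L - {s}, s)"]) auto
    qed
  qed
  then have "card (?S (Suc k)) \<le> card ((\<lambda>(L, s). if s < \<tau> then insert s L else L) ` (?S k \<times> {..\<tau>}))"
    using fin by (intro card_mono) auto
  also have "\<dots> \<le> card (?S k \<times> {..\<tau>})" using fin by (intro card_image_le) auto
  also have "\<dots> = card (?S k) * (\<tau> + 1)" by (simp add: card_cartesian_product)
  also have "\<dots> \<le> (\<tau> + 1) ^ k * (\<tau> + 1)" using Suc by (rule mult_right_mono) simp
  finally show ?case by (simp add: mult.commute)
qed

text \<open>\<open>sampling\<close> is applied to the derivative of \<open>R\<close> over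
  \<open>I\<close> as a function of base point and directions together. A shift of both moves the
  vertex belonging to \<open>J\<close> by \<open>w J s\<close>, so by \<open>moebius\<close> each
  sampled product is a product of derivatives of \<open>R\<close> in fixed directions, read at the
  vertices. A derivative of order |K| has degree at most \<open>e\<close> - |K|; from order
  \<open>e\<close> on it is constant, so only nonempty \<open>K\<close> with at most
  \<open>e - 1\<close> elements contribute.\<close>

lemma derivative_sampling:
  assumes V: "elem2 V" and R: "phase R" "dg V e R" "1 \<le> e" and I: "I \<subseteq> {..<n}"
    and b: "\<beta> \<le> \<bar>U V (card I) R\<bar>" "0 < \<beta>" and t: "1 \<le> 2 ^ \<tau> * \<epsilon> * \<beta>\<^sup>2"
  shows "\<exists>S F. wf_fam V S \<and> (\<forall>p\<in>S. lev p < e) \<and>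
     card S \<le> 2 ^ card I * ((\<tau> + 1) ^ (e - 1) - 1) \<and> card {p\<in>S. lev p = e - 1} \<le> 2 ^ card I * \<tau> \<and>
     av V (\<lambda>x. pr (cubn n V) (\<lambda>h. D R x h I \<noteq> F (pat S x h I))) \<le> \<epsilon>"
proof -
  let ?W = "cubn n V"
  let ?Z = "V \<times> ?W"
  have finI: "finite I" using I finite_subset by blast
  have sgW: "elem2 ?W" by (rule sg_cub[OF V]) simp
  have sgZ: "elem2 ?Z" by (rule sg_times[OF V sgW])
  define f where "f = (\<lambda>z. D R (fst z) (snd z) I)"
  have avf: "av ?Z f = U V (card I) R"
    unfolding U_av[OF V finite_lessThan I] av_prod f_def by simp
  have b2: "\<beta>\<^sup>2 \<le> (av ?Z f)\<^sup>2" using b power_mono[of \<beta> "\<bar>U V (card I) R\<bar>" 2] avf by simp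
  have eps: "0 < \<epsilon>"
  proof (rule ccontr)
    assume "\<not> 0 < \<epsilon>"
    then have "2 ^ \<tau> * \<epsilon> * \<beta>\<^sup>2 \<le> 0" by (simp add: mult_nonneg_nonpos mult_nonpos_nonneg)
    then show False using t by simp
  qed
  have t': "1 \<le> 2 ^ \<tau> * \<epsilon> * (av ?Z f)\<^sup>2" using t b2 eps by (meson mult_left_mono mult_nonneg_nonneg less_imp_le order_trans zero_le_numeral zero_le_power)
  have "av ?Z f \<noteq> 0" using b avf by auto
  then obtain g where g: "\<And>s::nat. g s \<in> ?Z" and smp:
     "pr ?Z (\<lambda>z. f z \<noteq> sgn (av ?Z f) * sgn (f z * (\<Sum>L\<in>Pow {..<\<tau>}. f (z + sum g L)))) \<le> \<epsilon>"
    using sampling[OF sgZ _ _ t'] phase_D'[OF R(1)] unfolding f_def by blast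
  define w where "w J s = fst (g s) + sum (snd (g s)) J" for J s
  have wV: "w J s \<in> V" if "J \<subseteq> I" for J s
    using g[of s] that I unfolding w_def by (intro sgD(4)[OF V] sum_cub[OF V]) (auto simp: mem_Times_iff)
  define \<psi> where "\<psi> q = (\<lambda>y. D R y (w (fst q)) (snd q))" for q
  define QQ where "QQ = Pow I \<times> {L. L \<subseteq> {..<\<tau>} \<and> L \<noteq> {} \<and> card L \<le> e - 1}"
  \<comment> \<open>Level and stage coincide: all that is known about these phases is their
    degree.\<close>
  define S where "S = (\<lambda>q. (\<psi> q, e - card (snd q), e - card (snd q))) ` QQ"
  have finQ: "finite QQ" unfolding QQ_def using finI by auto
  have fL: "finite L \<and> (card L = 0 \<longleftrightarrow> L = {})" if "L \<subseteq> {..<\<tau>}" for L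
    using that finite_subset by auto
  have inS: thesis if pS: "p \<in> S" and th: "\<And>J L. J \<subseteq> I \<Longrightarrow> L \<subseteq> {..<\<tau>} \<Longrightarrow> L \<noteq> {} \<Longrightarrow> card L \<le> e - 1 \<Longrightarrow>
     p = (\<psi> (J, L), e - card L, e - card L) \<Longrightarrow> thesis" for p thesis
  proof -
    obtain q where q: "q \<in> QQ" "p = (\<psi> q, e - card (snd q), e - card (snd q))"
      using pS unfolding S_def by blast
    obtain J L where JL: "q = (J, L)" by (cases q)
    show thesis by (rule th[of J L]) (use q JL in \<open>auto simp: QQ_def\<close>)
  qed
  have wf: "wf_fam V S" unfolding wf_fam_def
  proof (intro conjI ballI)
    show "finite S" unfolding S_def using finQ by simp
    fix p assume "p \<in> S"
    then obtain J L where q: "J \<subseteq> I" "L \<subseteq> {..<\<tau>}" "L \<noteq> {}" "card L \<le> e - 1"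
      and p: "p = (\<psi> (J, L), e - card L, e - card L)" by (rule inS)
    show "phase (ph p)" unfolding p \<psi>_def using phase_D[OF R(1)] by simp
    show "stg p \<le> lev p" unfolding p by simp
    show "1 \<le> lev p" unfolding p using q R(3) by simp
    have "dg V ((e - card L) + card L) R" using R q by simp
    then have "dg V (e - card L) (\<lambda>y. D R y (w J) L)"
      using fL[OF q(2)] wV[OF q(1)] by (intro dg_D[OF V]) auto
    then show "dg V (lev p) (ph p)" unfolding p \<psi>_def by simp
  qed
  have lev: "lev p < e" if "p \<in> S" for p
  proof (rule inS[OF that])
    fix J L assume "L \<subseteq> {..<\<tau>}" "L \<noteq> {}" and p: "p = (\<psi> (J, L), e - card L, e - card L)"
    then have "0 < card L" using fL[of L] by auto
    then show "lev p < e" using R(3) p by simp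
  qed
  have c1: "card S \<le> 2 ^ card I * ((\<tau> + 1) ^ (e - 1) - 1)"
  proof -
    let ?A = "{L. L \<subseteq> {..<\<tau>} \<and> card L \<le> e - 1}"
    have fA: "finite ?A" by (rule finite_subset[of _ "Pow {..<\<tau>}"]) auto
    have "{L. L \<subseteq> {..<\<tau>} \<and> L \<noteq> {} \<and> card L \<le> e - 1} = ?A - {{}}" by auto
    moreover have "card (?A - {{}}) = card ?A - 1" using fA by (intro card_Diff_singleton) auto
    ultimately have "card QQ \<le> 2 ^ card I * ((\<tau> + 1) ^ (e - 1) - 1)"
      unfolding QQ_def using card_small_subsets[of \<tau> "e - 1"] finI by (simp add: card_cartesian_product card_Pow)
    then show ?thesis unfolding S_def using card_image_le[OF finQ] order_trans by blast
  qed
  have c2: "card {p\<in>S. lev p = e - 1} \<le> 2 ^ card I * \<tau>"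
  proof -
    let ?B = "Pow I \<times> (\<lambda>s. {s}) ` {..<\<tau>}"
    have "{p\<in>S. lev p = e - 1} \<subseteq> (\<lambda>q. (\<psi> q, e - card (snd q), e - card (snd q))) ` ?B"
    proof
      fix p assume "p \<in> {p\<in>S. lev p = e - 1}"
      then have pS: "p \<in> S" and le: "lev p = e - 1" by auto
      from pS obtain J L where q: "J \<subseteq> I" "L \<subseteq> {..<\<tau>}" "L \<noteq> {}" "card L \<le> e - 1"
        and p: "p = (\<psi> (J, L), e - card L, e - card L)" by (rule inS)
      have "e - card L = e - 1" using le p by simp
      then have "card L = 1" using q R(3) fL[OF q(2)] by (cases "card L") auto
      then obtain s where "L = {s}" by (auto simp: card_1_singleton_iff)
      then show "p \<in> (\<lambda>q. (\<psi> q, e - card (snd q), e - card (snd q))) ` ?B"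
        unfolding p using q by (intro image_eqI[of _ _ "(J, L)"]) auto
    qed
    then have "card {p\<in>S. lev p = e - 1} \<le> card ((\<lambda>q. (\<psi> q, e - card (snd q), e - card (snd q))) ` ?B)"
      using finI by (intro card_mono) auto
    also have "\<dots> \<le> card ?B" using finI by (intro card_image_le) auto
    also have "\<dots> \<le> 2 ^ card I * \<tau>"
      using finI card_image_le[of "{..<\<tau>}" "\<lambda>s. {s}"] by (simp add: card_cartesian_product card_Pow)
    finally show ?thesis .
  qed
  define G where "G z = f z * (\<Sum>L\<in>Pow {..<\<tau>}. f (z + sum g L))" for z
  have expand: "f z * f (z + sum g L) = (\<Prod>J\<in>Pow I. \<Prod>K\<in>Pow L - {{}}. \<psi> (J, K) (fst z + sum (snd z) J))"
    if L: "L \<subseteq> {..<\<tau>}" for z L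
  proof -
    have fLL: "finite L" using fL[OF L] by simp
    have 1: "fst z + fst (sum g L) + sum (snd z + snd (sum g L)) J = (fst z + sum (snd z) J) + sum (w J) L" for J
    proof -
      have "sum (snd z + snd (sum g L)) J = sum (snd z) J + (\<Sum>i\<in>J. \<Sum>s\<in>L. snd (g s) i)"
        by (simp add: sum.distrib snd_sum sum_fun_app)
      also have "(\<Sum>i\<in>J. \<Sum>s\<in>L. snd (g s) i) = (\<Sum>s\<in>L. sum (snd (g s)) J)" by (rule sum.swap)
      finally show ?thesis by (simp add: w_def fst_sum sum.distrib add_ac)
    qed
    have "f (z + sum g L) = (\<Prod>J\<in>Pow I. R ((fst z + sum (snd z) J) + sum (w J) L))"
      unfolding f_def D_def fst_add snd_add 1 ..
    also have "\<dots> = (\<Prod>J\<in>Pow I. R (fst z + sum (snd z) J) * (\<Prod>K\<in>Pow L - {{}}. \<psi> (J, K) (fst z + sum (snd z) J)))"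
    proof (rule prod.cong[OF refl])
      fix J
      show "R ((fst z + sum (snd z) J) + sum (w J) L) =
         R (fst z + sum (snd z) J) * (\<Prod>K\<in>Pow L - {{}}. \<psi> (J, K) (fst z + sum (snd z) J))"
        unfolding moebius[OF R(1) fLL] \<psi>_def using fLL by (subst prod.remove[of _ "{}"]) auto
    qed
    also have "\<dots> = f z * (\<Prod>J\<in>Pow I. \<Prod>K\<in>Pow L - {{}}. \<psi> (J, K) (fst z + sum (snd z) J))"
      by (simp add: prod.distrib f_def D_def)
    finally have "f z * f (z + sum g L) = (f z * f z) * (\<Prod>J\<in>Pow I. \<Prod>K\<in>Pow L - {{}}. \<psi> (J, K) (fst z + sum (snd z) J))"
      by (simp add: mult.assoc)
    moreover have "f z * f z = 1" unfolding f_def using phase_sq[OF phase_D[OF R(1)]] .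
    ultimately show ?thesis by simp
  qed
  have "\<exists>F. \<forall>z\<in>?Z. G z = F (pat S (fst z) (snd z) I)"
  proof (rule factor_through)
    fix z z' assume z: "z \<in> ?Z" "z' \<in> ?Z" and eq: "pat S (fst z) (snd z) I = pat S (fst z') (snd z') I"
    have "\<psi> (J, K) (fst z + sum (snd z) J) = \<psi> (J, K) (fst z' + sum (snd z') J)"
      if JK: "J \<subseteq> I" "K \<subseteq> {..<\<tau>}" "K \<noteq> {}" for J K
    proof -
      have y: "fst z + sum (snd z) J \<in> V" "fst z' + sum (snd z') J \<in> V"
        using z JK(1) I by (auto intro!: sgD(4)[OF V] sum_cub[OF V])
      consider "card K \<le> e - 1" | "card K = e" | "e < card K" using R(3) by linarith
      then show ?thesis
      proof cases
        case 1
        then have q: "(\<psi> (J, K), e - card K, e - card K) \<in> S" unfolding S_def QQ_def using JK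
          by (intro image_eqI[of _ _ "(J, K)"]) auto
        show ?thesis using fun_cong[OF fun_cong[OF eq, of J], of "(\<psi> (J, K), e - card K, e - card K)"] q JK(1)
          by (simp add: pat_def)
      next
        case 2
        have "dg V (0 + card K) R" using R 2 by simp
        then have "dg V 0 (\<lambda>y. D R y (w J) K)" using fL[OF JK(2)] wV[OF JK(1)] by (intro dg_D[OF V]) auto
        then show ?thesis using y unfolding \<psi>_def dg.simps(1) fst_conv snd_conv by blast
      next
        case 3
        have "D R y (w J) K = 1" if "y \<in> V" for y
          using fL[OF JK(2)] wV[OF JK(1)] 3 that by (intro D_eq_1[OF V R(1) _ _ R(2)]) auto
        then show ?thesis using y unfolding \<psi>_def by simp
      qed
    qed
    note eq\<psi> = this
    have "f z * f (z + sum g L) = f z' * f (z' + sum g L)" if L: "L \<in> Pow {..<\<tau>}" for L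
      unfolding expand[OF PowD[OF L]]
    proof (intro prod.cong refl)
      fix J K assume "J \<in> Pow I" "K \<in> Pow L - {{}}"
      then show "\<psi> (J, K) (fst z + sum (snd z) J) = \<psi> (J, K) (fst z' + sum (snd z') J)"
        using L by (intro eq\<psi>) blast+
    qed
    then show "G z = G z'" unfolding G_def sum_distrib_left by (intro sum.cong refl) auto
  qed
  then obtain F where F: "\<And>z. z \<in> ?Z \<Longrightarrow> G z = F (pat S (fst z) (snd z) I)" by blast
  have "av V (\<lambda>x. pr ?W (\<lambda>h. D R x h I \<noteq> sgn (av ?Z f) * sgn (F (pat S x h I)))) =
     pr ?Z (\<lambda>z. f z \<noteq> sgn (av ?Z f) * sgn (G z))"
    unfolding pr_def av_prod by (intro av_cong refl) (simp add: F f_def)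
  also have "\<dots> \<le> \<epsilon>" using smp unfolding G_def .
  finally show ?thesis using wf lev c1 c2
    by (intro exI[of _ S] exI[of _ "\<lambda>P. sgn (av ?Z f) * sgn (F P)"]) blast
qed

section \<open>Refinement of families\<close>

definition refn :: "'v set \<Rightarrow> 'v tri set \<Rightarrow> 'v tri set \<Rightarrow> bool" where
  "refn V S S' \<longleftrightarrow> (\<forall>x\<in>V. \<forall>y\<in>V. (\<forall>p\<in>S'. ph p x = ph p y) \<longrightarrow> (\<forall>p\<in>S. ph p x = ph p y))"

lemma refn_refl: "S \<subseteq> S' \<Longrightarrow> refn V S S'"
  unfolding refn_def by blast

lemma refn_trans: "refn V S S' \<Longrightarrow> refn V S' S'' \<Longrightarrow> refn V S S''"
  unfolding refn_def by blast

lemma pat_refn: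
  assumes V: "elem2 V" and r: "refn V S S'" and I: "I \<subseteq> {..<n}"
  shows "\<exists>g. \<forall>x\<in>V. \<forall>h\<in>cubn n V. pat S x h I = g (pat S' x h I)"
proof -
  let ?W = "cubn n V"
  have "\<exists>g. \<forall>z\<in>V \<times> ?W. pat S (fst z) (snd z) I = g (pat S' (fst z) (snd z) I)"
  proof (rule factor_through)
    fix z z' assume z: "z \<in> V \<times> ?W" "z' \<in> V \<times> ?W" and eq: "pat S' (fst z) (snd z) I = pat S' (fst z') (snd z') I"
    have "ph p (fst z + sum (snd z) J) = ph p (fst z' + sum (snd z') J)" if J: "J \<subseteq> I" and p: "p \<in> S" for J p
    proof -
      have "fst z + sum (snd z) J \<in> V" "fst z' + sum (snd z') J \<in> V"
        using z J I by (auto intro!: sgD(4)[OF V] sum_cub[OF V])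
      moreover have "\<forall>p\<in>S'. ph p (fst z + sum (snd z) J) = ph p (fst z' + sum (snd z') J)"
      proof
        fix q assume "q \<in> S'"
        then show "ph q (fst z + sum (snd z) J) = ph q (fst z' + sum (snd z') J)"
          using fun_cong[OF fun_cong[OF eq, of J], of q] J by (simp add: pat_def)
      qed
      ultimately show ?thesis using r p unfolding refn_def by blast
    qed
    then show "pat S (fst z) (snd z) I = pat S (fst z') (snd z') I" by (auto simp: pat_def fun_eq_iff)
  qed
  then show ?thesis by (auto simp: mem_Times_iff)
qed

lemma detl_refn:
  assumes V: "elem2 V" and r: "refn V S S'" and d: "detl V n \<phi> S j \<epsilon>"
  shows "detl V n \<phi> S' j \<epsilon>"
  unfolding detl_def
proof (intro allI impI)
  fix I assume I: "I \<subseteq> {..<n}" "card I = j"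
  obtain \<Psi> where \<Psi>: "\<And>x. x \<in> V \<Longrightarrow> pr (cubn n V) (\<lambda>h. D \<phi> x h I \<noteq> \<Psi> (pat S x h I)) \<le> \<epsilon>"
    using d I unfolding detl_def by blast
  obtain g where g: "\<And>x h. x \<in> V \<Longrightarrow> h \<in> cubn n V \<Longrightarrow> pat S x h I = g (pat S' x h I)"
    using pat_refn[OF V r I(1)] by blast
  have "pr (cubn n V) (\<lambda>h. D \<phi> x h I \<noteq> \<Psi> (g (pat S' x h I))) \<le> \<epsilon>" if "x \<in> V" for x
    by (rule order_trans[OF pr_mono \<Psi>[OF that]]) (use g that in auto)
  then show "\<exists>\<Psi>. \<forall>x\<in>V. pr (cubn n V) (\<lambda>h. D \<phi> x h I \<noteq> \<Psi> (pat S' x h I)) \<le> \<epsilon>"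
    by (intro exI[of _ "\<lambda>P. \<Psi> (g P)"]) blast
qed

lemma D_image: assumes "inj_on \<pi> I" shows "D \<phi> x h (\<pi> ` I) = D \<phi> x (\<lambda>i. h (\<pi> i)) I"
proof -
  have "Pow (\<pi> ` I) = (\<lambda>J. \<pi> ` J) ` Pow I" by (simp add: image_Pow_surj)
  moreover have "inj_on (\<lambda>J. \<pi> ` J) (Pow I)" using assms by (rule inj_on_image_Pow)
  ultimately have "D \<phi> x h (\<pi> ` I) = (\<Prod>J\<in>Pow I. \<phi> (x + sum h (\<pi> ` J)))"
    unfolding D_def by (simp add: prod.reindex)
  also have "\<dots> = D \<phi> x (\<lambda>i. h (\<pi> i)) I" unfolding D_def
  proof (rule prod.cong[OF refl])
    fix J assume "J \<in> Pow I"
    then have "inj_on \<pi> J" using assms inj_on_subset by blast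
    then show "\<phi> (x + sum h (\<pi> ` J)) = \<phi> (x + (\<Sum>i\<in>J. h (\<pi> i)))" by (simp add: sum.reindex)
  qed
  finally show ?thesis .
qed

lemma perm_extend:
  assumes "I \<subseteq> {..<n::nat}" "I' \<subseteq> {..<n}" "card I = card I'"
  shows "\<exists>\<pi>. bij_betw \<pi> {..<n} {..<n} \<and> \<pi> ` I = I'"
proof -
  have fin: "finite I" "finite I'" using assms finite_subset by blast+
  obtain f where f: "bij_betw f I I'" using finite_same_card_bij[OF fin assms(3)] by blast
  have "card ({..<n} - I) = card ({..<n} - I')" using assms fin by (simp add: card_Diff_subset)
  then obtain g where g: "bij_betw g ({..<n} - I) ({..<n} - I')"
    using finite_same_card_bij[of "{..<n} - I" "{..<n} - I'"] by auto
  let ?\<pi> = "\<lambda>i. if i \<in> I then f i else g i"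
  have "bij_betw ?\<pi> (I \<union> ({..<n} - I)) (I' \<union> ({..<n} - I'))"
    by (rule bij_betw_disjoint_Un[OF f g]) auto
  moreover have "I \<union> ({..<n} - I) = {..<n}" "I' \<union> ({..<n} - I') = {..<n}" using assms by auto
  moreover have "?\<pi> ` I = I'" using f by (auto simp: bij_betw_def)
  ultimately show ?thesis by (intro exI[of _ ?\<pi>]) simp
qed

text \<open>Permuting the directions preserves the distribution on the cube, so one index set stands
  for all sets of its size.\<close>

lemma detl_transport:
  assumes V: "elem2 V" and I0: "I0 \<subseteq> {..<n}"
    and d: "\<And>x. x \<in> V \<Longrightarrow> pr (cubn n V) (\<lambda>h. D \<phi> x h I0 \<noteq> F (pat S x h I0)) \<le> \<epsilon>"
  shows "detl V n \<phi> S (card I0) \<epsilon>"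
  unfolding detl_def
proof (intro allI impI)
  fix I assume I: "I \<subseteq> {..<n}" "card I = card I0"
  let ?W = "cubn n V"
  obtain \<pi> where \<pi>: "bij_betw \<pi> {..<n} {..<n}" "\<pi> ` I0 = I" using perm_extend[OF I0 I(1)] I(2) by metis
  define p where "p i = (if i < n then \<pi> i else i)" for i
  define q where "q i = (if i < n then inv_into {..<n} \<pi> i else i)" for i
  have pq: "p (q i) = i" "q (p i) = i" for i
    using \<pi>(1) bij_betw_inv_into_left[OF \<pi>(1), of i] bij_betw_inv_into_right[OF \<pi>(1), of i]
      bij_betwE[OF \<pi>(1)] bij_betwE[OF bij_betw_inv_into[OF \<pi>(1)]]
    by (auto simp: p_def q_def)
  have pn: "p i < n \<longleftrightarrow> i < n" "q i < n \<longleftrightarrow> i < n" for i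
    using bij_betwE[OF \<pi>(1)] bij_betwE[OF bij_betw_inv_into[OF \<pi>(1)]] by (auto simp: p_def q_def)
  have pI: "p ` I0 = I" using \<pi>(2) I0 by (force simp: p_def image_def)
  have inj: "inj_on p A" for A using pq by (metis inj_on_inverseI)
  have bij: "bij_betw (\<lambda>h i. h (p i)) ?W ?W"
    by (rule bij_betwI[where g = "\<lambda>h i. h (q i)"]) (auto simp: cub_def pq pn)
  define F' where "F' P = F (\<lambda>J t. if J \<subseteq> I0 then P (p ` J) t else 1)" for P :: "nat set \<Rightarrow> 'a tri \<Rightarrow> real"
  have "pr ?W (\<lambda>h. D \<phi> x h I \<noteq> F' (pat S x h I)) \<le> \<epsilon>" if x: "x \<in> V" for x
  proof -
    have "pr ?W (\<lambda>h. D \<phi> x h I \<noteq> F' (pat S x h I)) = pr ?W (\<lambda>h. D \<phi> x (\<lambda>i. h (p i)) I0 \<noteq> F (pat S x (\<lambda>i. h (p i)) I0))"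
    proof -
      have "D \<phi> x h I = D \<phi> x (\<lambda>i. h (p i)) I0" for h unfolding pI[symmetric] by (rule D_image[OF inj])
      moreover have "F' (pat S x h I) = F (pat S x (\<lambda>i. h (p i)) I0)" for h
        unfolding F'_def
      proof (rule arg_cong[where f = F], intro ext)
        fix J t
        have "sum h (p ` J) = (\<Sum>i\<in>J. h (p i))" using inj by (subst sum.reindex) (auto simp: comp_def)
        moreover have "p ` J \<subseteq> I" if "J \<subseteq> I0" using pI that by blast
        ultimately show "(if J \<subseteq> I0 then pat S x h I (p ` J) t else 1) = pat S x (\<lambda>i. h (p i)) I0 J t"
          by (auto simp: pat_def)
      qed
      ultimately show ?thesis by simp
    qed
    also have "\<dots> = pr ?W (\<lambda>h. D \<phi> x h I0 \<noteq> F (pat S x h I0))"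
      unfolding pr_def by (rule av_bij[OF bij, of "\<lambda>h. of_bool (D \<phi> x h I0 \<noteq> F (pat S x h I0))"])
    finally show ?thesis using d[OF x] by simp
  qed
  then show "\<exists>\<Psi>. \<forall>x\<in>V. pr ?W (\<lambda>h. D \<phi> x h I \<noteq> \<Psi> (pat S x h I)) \<le> \<epsilon>" by blast
qed

text \<open>A family of \<open>N\<close> members has at most \<open>N * 2 ^ n\<close> free
  derivatives, so the error of \<open>near_uniform\<close> at this level of regularity is at most
  2^-\<open>K\<close>.\<close>

definition eta :: "nat \<Rightarrow> nat \<Rightarrow> nat \<Rightarrow> real" where
  "eta n N K = (1/2) ^ (N * 2 ^ n + K)"

lemma eta_pos: "0 < eta n N K" "0 \<le> eta n N K" by (simp_all add: eta_def)

lemma eta_mono: "N \<le> N' \<Longrightarrow> K \<le> K' \<Longrightarrow> eta n N' K' \<le> eta n N K"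
  unfolding eta_def by (rule power_decreasing) (auto intro: add_mono)

text \<open>The sample exponent for which \<open>sampling\<close> has error 2^-\<open>K'\<close>
  when the mean is at least 2^-(2^e * (N * 2^n + K)), a lower bound for
  \<open>eta n N K ^ (2 ^ j)\<close> with \<open>j \<le> e\<close>.\<close>

definition tau :: "nat \<Rightarrow> nat \<Rightarrow> nat \<Rightarrow> nat \<Rightarrow> nat \<Rightarrow> nat" where
  "tau n e N K K' = 2 * (2 ^ e * (N * 2 ^ n + K)) + K'"

text \<open>One step of the energy increment: a product \<open>R\<close> of members with large Gowers norm of order \<open>j\<close> is
  made determined by lower degree members.\<close>

lemma increment:
  fixes V :: "'v::ab_group_add set"
  assumes V: "elem2 V" and R: "phase R" "dg V e R" "1 \<le> e" and n: "3 * e + 2 \<le> n" and j: "j \<le> e"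
    and big: "eta n N K ^ (2 ^ j) < \<bar>U V j R\<bar>"
  obtains S where "wf_fam V S" "\<forall>p\<in>S. lev p < e"
    "card S \<le> 2 ^ j * ((tau n e N K K' + 1) ^ (e - 1) - 1)"
    "card {p\<in>S. lev p = e - 1} \<le> 2 ^ j * tau n e N K K'"
    "\<And>A M. refn V S A \<Longrightarrow> valid V n A ((1/2) ^ K') \<Longrightarrow> Rg V A (eta n M K') \<Longrightarrow> card A \<le> M \<Longrightarrow>
       detl V n R A j (4 ^ (n + 1) * (1/2) ^ K')"
proof -
  let ?I = "{..<j}"
  have I: "?I \<subseteq> {..<n}" "card ?I = j" using n j by auto
  define \<beta> where "\<beta> = (1/2 :: real) ^ (2 ^ e * (N * 2 ^ n + K))"
  have \<beta>: "0 < \<beta>" "\<beta> \<le> \<bar>U V j R\<bar>"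
  proof -
    have "\<beta> \<le> eta n N K ^ (2 ^ j)" unfolding \<beta>_def eta_def power_mult[symmetric]
      using j by (intro power_decreasing) (auto simp: mult.commute intro!: mult_right_mono)
    then show "\<beta> \<le> \<bar>U V j R\<bar>" using big by simp
  qed (simp add: \<beta>_def)
  have "(2::real) ^ tau n e N K K' * (1/2) ^ K' * \<beta>\<^sup>2 = 1"
    unfolding tau_def \<beta>_def power_mult[symmetric] power_add by (simp add: power_divide mult.commute)
  then have t: "1 \<le> 2 ^ tau n e N K K' * (1/2) ^ K' * \<beta>\<^sup>2" by simp
  obtain S F where S: "wf_fam V S" "\<forall>p\<in>S. lev p < e"
     "card S \<le> 2 ^ j * ((tau n e N K K' + 1) ^ (e - 1) - 1)"
     "card {p\<in>S. lev p = e - 1} \<le> 2 ^ j * tau n e N K K'"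
     and F: "av V (\<lambda>x. pr (cubn n V) (\<lambda>h. D R x h ?I \<noteq> F (pat S x h ?I))) \<le> (1/2) ^ K'"
    using derivative_sampling[OF V R I(1) _ \<beta>(1) t] \<beta>(2) unfolding I(2) by blast
  \<comment> \<open>The family \<open>A\<close> is chosen after \<open>S\<close>: the derivatives
    must first be adjoined and the result regularized, because \<open>upgrade\<close> needs a
    regular family.\<close>
  have "detl V n R A j (4 ^ (n + 1) * (1/2) ^ K')"
    if r: "refn V S A" and val: "valid V n A ((1/2) ^ K')" and rg: "Rg V A (eta n M K')" and AM: "card A \<le> M" for A M
  proof -
    obtain g where g: "\<And>x h. x \<in> V \<Longrightarrow> h \<in> cubn n V \<Longrightarrow> pat S x h ?I = g (pat A x h ?I)"
      using pat_refn[OF V r I(1)] by blast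
    have "av V (\<lambda>x. pr (cubn n V) (\<lambda>h. D R x h ?I \<noteq> F (g (pat A x h ?I)))) \<le> (1/2) ^ K'"
      by (rule order_trans[OF av_mono F], rule pr_mono) (use g in auto)
    moreover have "card ?I + 2 * Suc e \<le> n" using n j by simp
    ultimately obtain F' where F': "\<And>x. x \<in> V \<Longrightarrow> pr (cubn n V) (\<lambda>h. D R x h ?I \<noteq> F' (pat A x h ?I))
     \<le> 3 * (2 ^ Suc e * (1/2) ^ K') + 3 * (4 ^ n * (1/2) ^ K') + 2 * (2 ^ (card A * 2 ^ n) * eta n M K')"
      using upgrade[OF V val rg eta_pos(2) R(1,2) I(1), of "\<lambda>P. F (g P)" "(1/2) ^ K'"] by blast
    have "(2::real) ^ (card A * 2 ^ n) * eta n M K' \<le> 2 ^ (M * 2 ^ n) * eta n M K'"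
      using AM eta_pos by (intro mult_right_mono power_increasing) auto
    also have "\<dots> = (1/2) ^ K'" unfolding eta_def by (simp add: power_add power_divide)
    finally have 1: "2 * (2 ^ (card A * 2 ^ n) * eta n M K') \<le> 2 * (1/2) ^ K'" by simp
    have "(2::real) ^ Suc e \<le> 2 ^ n" using n by (intro power_increasing) auto
    then have 2: "3 * (2 ^ Suc e * (1/2) ^ K') \<le> 3 * (2 ^ n * (1/2 :: real) ^ K')" by simp
    have "3 * 2 ^ n + 2 \<le> (4::real) ^ n"
    proof -
      have "(2::real) ^ 5 \<le> 2 ^ n" using n R(3) by (intro power_increasing) auto
      then have "32 \<le> (2::real) ^ n" by simp
      moreover from this have "32 * 2 ^ n \<le> (2::real) ^ n * 2 ^ n" by (intro mult_right_mono) auto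
      moreover have "(4::real) ^ n = 2 ^ n * 2 ^ n" by (simp add: power_mult_distrib[symmetric])
      ultimately show ?thesis by linarith
    qed
    then have "(3 * 2 ^ n + 2) * (1/2 :: real) ^ K' \<le> 4 ^ n * (1/2) ^ K'"
      by (intro mult_right_mono) auto
    then have 3: "3 * (2 ^ n * (1/2 :: real) ^ K') + 2 * (1/2) ^ K' \<le> 4 ^ n * (1/2) ^ K'"
      by (simp only: distrib_right mult.assoc)
    have 4: "4 ^ (n + 1) * (1/2 :: real) ^ K' = 4 * (4 ^ n * (1/2) ^ K')" by simp
    have "3 * (2 ^ Suc e * (1/2) ^ K') + 3 * (4 ^ n * (1/2) ^ K') + 2 * (2 ^ (card A * 2 ^ n) * eta n M K') \<le> 4 ^ (n + 1) * (1/2) ^ K'"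
      unfolding 4 using 1 2 3 by linarith
    then have "pr (cubn n V) (\<lambda>h. D R x h ?I \<noteq> F' (pat A x h ?I)) \<le> 4 ^ (n + 1) * (1/2) ^ K'" if "x \<in> V" for x
      using F'[OF that] by linarith
    from detl_transport[OF V I(1) this] show ?thesis by (simp add: I(2))
  qed
  then show ?thesis using that S by blast
qed

text \<open>Without directions the event of failure at a given point has probability 0 or 1, so an
  error below 1 never occurs.\<close>

lemma detl_0:
  assumes V: "elem2 V" and d: "detl V n R A 0 \<epsilon>" "\<epsilon> < 1" and x: "x \<in> V" "y \<in> V" and eq: "\<forall>p\<in>A. ph p x = ph p y"
  shows "R x = R y"
proof -
  obtain \<Psi> where \<Psi>: "\<And>x. x \<in> V \<Longrightarrow> pr (cubn n V) (\<lambda>h. D R x h {} \<noteq> \<Psi> (pat A x h {})) \<le> \<epsilon>"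
    using d(1)[unfolded detl_def, rule_format, of "{}"] by auto
  define b where "b x = (\<lambda>J p. if J \<subseteq> ({}::nat set) \<and> p \<in> A then ph p x else 1)" for x
  have pb: "pat A x h {} = b x" for x h by (auto simp: pat_def b_def fun_eq_iff)
  have "R x = \<Psi> (b x)" if "x \<in> V" for x
  proof (rule ccontr)
    assume "R x \<noteq> \<Psi> (b x)"
    then have "pr (cubn n V) (\<lambda>h. D R x h {} \<noteq> \<Psi> (pat A x h {})) = 1"
      unfolding pb pr_def using sgD[OF V] by (simp add: av_const cub_finite cub_ne)
    then show False using \<Psi>[OF that] d(2) by simp
  qed
  moreover have "b x = b y" using eq by (auto simp: b_def fun_eq_iff)
  ultimately show ?thesis using x by simp
qed

section \<open>Regularization\<close>

text \<open>Bounds the size after the derivatives from one increment are adjoined to a family of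
  size \<open>X\<close>: \<open>tau\<close> is then linear in \<open>X\<close>, and there are about
  \<open>tau ^ (e - 1)\<close> derivatives. A phase of degree at most 1 has no non-constant
  derivatives, so nothing is added for \<open>e \<le> 1\<close>.\<close>

definition yf :: "nat \<Rightarrow> nat \<Rightarrow> nat \<Rightarrow> nat" where
  "yf n e X = (if e \<le> 1 then X else (2 ^ (n + 2 * e + 4) * X) ^ (e - 1))"

text \<open>Each of the \<open>q\<close> members of top degree \<open>Suc e\<close> can be changed
  at most \<open>e + 2\<close> times, once per stage including its removal. Every change, and the
  start, costs one regularization of the lower degrees.\<close>

fun rho :: "nat \<Rightarrow> nat \<Rightarrow> nat \<Rightarrow> nat \<Rightarrow> nat" where
  "rho n 0 q X = X"
| "rho n (Suc e) q X = ((\<lambda>Y. rho n e (yf n (Suc e) Y) (yf n (Suc e) Y)) ^^ ((e + 2) * q + 1)) X"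

lemma yf_ge: "X \<le> yf n e X"
proof (cases "e \<le> 1 \<or> X = 0")
  case False
  then have "X \<le> 2 ^ (n + 2 * e + 4) * X" by simp
  also have "\<dots> \<le> (2 ^ (n + 2 * e + 4) * X) ^ (e - 1)" using False by (intro self_le_power) auto
  finally show ?thesis using False by (simp add: yf_def)
qed (auto simp: yf_def)

lemma funpow_ge: assumes "\<And>x. x \<le> f x" shows "(x::nat) \<le> (f ^^ m) x"
  by (induction m) (auto intro: order_trans[OF _ assms])

lemma rho_ge: "X \<le> rho n e q X"
proof (induction e arbitrary: q X)
  case (Suc e)
  show ?case unfolding rho.simps by (rule funpow_ge) (rule order_trans[OF yf_ge Suc])
qed simp

lemma yf_3: assumes "2 \<le> e" shows "3 * X \<le> yf n e X"
proof (cases "X = 0")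
  case False
  have "(2::nat) ^ 2 \<le> 2 ^ (n + 2 * e + 4)" by (intro power_increasing) auto
  then have "3 * X \<le> 2 ^ (n + 2 * e + 4) * X" by (intro mult_right_mono) auto
  also have "\<dots> \<le> (2 ^ (n + 2 * e + 4) * X) ^ (e - 1)" using False assms by (intro self_le_power) auto
  finally show ?thesis using assms by (simp add: yf_def)
qed simp

lemma yf_bound:
  assumes a: "2 \<le> e \<Longrightarrow> N \<le> X \<and> K \<le> X \<and> K' \<le> 3 * X \<and> 1 \<le> X" and e1: "1 \<le> e" and je: "j \<le> e" and n2: "2 \<le> n"
  shows "X + 2 ^ j * ((tau n e N K K' + 1) ^ (e - 1) - 1) \<le> yf n e X"
proof (cases "e = 1")
  case True
  then show ?thesis by (simp add: yf_def)
next
  case False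
  then have e2: "2 \<le> e" using e1 by simp
  note assms = a[OF e2] e1 je n2
  have "tau n e N K K' \<le> 2 * (2 ^ e * (X * 2 ^ n + X)) + 3 * X"
    unfolding tau_def using assms by (intro add_mono mult_left_mono mult_right_mono) auto
  also have "\<dots> = X * (2 * 2 ^ e * 2 ^ n + (2 * 2 ^ e + 3))" by (simp add: algebra_simps)
  also have "\<dots> \<le> X * (2 * 2 ^ e * 2 ^ n + 2 * 2 ^ e * 2 ^ n)"
  proof -
    have "(2::nat) ^ 2 \<le> 2 ^ n" by (rule power_increasing) (use assms in simp_all)
    then have n4: "4 \<le> (2::nat) ^ n" by simp
    have "(2::nat) ^ 2 \<le> 2 ^ e" by (rule power_increasing) (use e2 in simp_all)
    then have "2 * 2 ^ e + 3 \<le> 2 * 2 ^ e * (4::nat)" by simp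
    also have "\<dots> \<le> 2 * 2 ^ e * 2 ^ n" using n4 by (rule mult_left_mono) simp
    finally have "2 * 2 ^ e + 3 \<le> 2 * 2 ^ e * (2 ^ n :: nat)" .
    then show ?thesis by (intro mult_left_mono add_left_mono) auto
  qed
  also have "\<dots> = 2 ^ (n + e + 2) * X" by (simp add: power_add)
  finally have "tau n e N K K' + 1 \<le> 2 ^ (n + e + 2) * X + 2 ^ (n + e + 2) * X"
    using assms(1) by (intro add_mono) (auto simp: Suc_le_eq)
  also have "\<dots> = 2 ^ (n + e + 3) * X" by (simp add: power_add)
  finally have 1: "(tau n e N K K' + 1) ^ (e - 1) \<le> (2 ^ (n + e + 3) * X) ^ (e - 1)" by (rule power_mono) simp
  let ?B = "(2 ^ (n + e + 3) * X) ^ (e - 1)"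
  have "X \<le> 2 ^ (n + e + 3) * X" by simp
  also have "\<dots> \<le> ?B" using e2 assms by (intro self_le_power) auto
  finally have 2: "X \<le> ?B" .
  have "2 ^ j * ((tau n e N K K' + 1) ^ (e - 1) - 1) \<le> 2 ^ e * ?B"
    using 1 assms by (intro mult_mono power_increasing) auto
  then have "X + 2 ^ j * ((tau n e N K K' + 1) ^ (e - 1) - 1) \<le> (1 + 2 ^ e) * ?B" using 2 by simp
  also have "\<dots> \<le> 2 ^ (e + 1) * ?B" by (intro mult_right_mono) auto
  also have "\<dots> \<le> (2 ^ (e + 1)) ^ (e - 1) * ?B"
    using e2 by (intro mult_right_mono self_le_power) auto
  also have "\<dots> = (2 ^ (n + 2 * e + 4) * X) ^ (e - 1)"
  proof -
    have "2 ^ (n + 2 * e + 4) * X = 2 ^ (e + 1) * (2 ^ (n + e + 3) * X)"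
    proof -
      have "n + 2 * e + 4 = (e + 1) + (n + e + 3)" by simp
      then show ?thesis by (simp only: power_add[of 2 "e + 1" "n + e + 3"] mult.assoc)
    qed
    then show ?thesis unfolding power_mult_distrib[symmetric] by (simp only:)
  qed
  finally show ?thesis using False e1 by (simp add: yf_def)
qed

lemma detl_top:
  assumes V: "elem2 V" and R: "phase R" "dg V e R" and e0: "0 \<le> \<epsilon>"
  shows "detl V n R A (Suc e) \<epsilon>"
  unfolding detl_def
proof (intro allI impI exI ballI)
  fix I x assume I: "I \<subseteq> {..<n}" "card I = Suc e" and x: "x \<in> V"
  have "D R x h I = 1" if "h \<in> cubn n V" for h
    using I that finite_subset[OF I(1)] by (intro D_eq_1[OF V R(1) _ _ R(2) _ x]) (auto simp: cub_def)
  then have "pr (cubn n V) (\<lambda>h. D R x h I \<noteq> (\<lambda>_. 1) (pat A x h I)) = av (cubn n V) (\<lambda>_. 0)"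
    unfolding pr_def by (intro av_cong refl) simp
  also have "\<dots> = 0" by (simp add: av_def)
  finally show "pr (cubn n V) (\<lambda>h. D R x h I \<noteq> (\<lambda>_. 1) (pat A x h I)) \<le> \<epsilon>" using e0 by simp
qed

lemma prod_remove_det:
  assumes T: "finite T" "p0 \<in> T" "\<And>p. p \<in> T \<Longrightarrow> phase (ph p)"
    and o: "\<And>p. p \<in> T - {p0} \<Longrightarrow> ph p x = ph p y" and R: "(\<Prod>p\<in>T. ph p x) = (\<Prod>p\<in>T. ph p y)"
  shows "ph p0 x = ph p0 y"
proof -
  have "(\<Prod>p\<in>T - {p0}. ph p x) = (\<Prod>p\<in>T - {p0}. ph p y)" using o by (rule prod.cong[OF refl])
  moreover have "(\<Prod>p\<in>T - {p0}. ph p y) \<noteq> 0"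
  proof -
    have "ph p y \<noteq> 0" if "p \<in> T" for p using T(3)[OF that] unfolding phase_def by (metis zero_neq_neg_one zero_neq_one)
    then show ?thesis using T(1) by (subst prod_zero_iff) auto
  qed
  ultimately show ?thesis using R unfolding prod.remove[OF T(1,2)] by simp
qed

text \<open>Induction on the degree. The lower part is kept regular; while the whole family is not,
  the product that violates regularity contains a member of top degree, which is replaced by that
  product with a smaller stage. The number \<open>s\<close> counts members kept outside the family,
  so that the regularity achieved is relative to the total size.\<close>

lemma regularize:
  fixes V :: "'v::ab_group_add set"
  assumes V: "elem2 V"
  shows "3 * e + 2 \<le> n \<Longrightarrow> wf_fam V S \<Longrightarrow> (\<forall>p\<in>S. lev p \<le> e) \<Longrightarrow> card {p\<in>S. lev p = e} \<le> q \<Longrightarrow> q \<le> X \<Longrightarrow>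
     s + card S \<le> X \<Longrightarrow> (2 \<le> e \<longrightarrow> K + 2 * n + 5 \<le> X) \<Longrightarrow>
     \<exists>S'. wf_fam V S' \<and> (\<forall>p\<in>S'. lev p \<le> e) \<and> refn V S S' \<and> valid V n S' ((1/2) ^ K) \<and>
       Rg V S' (eta n (s + card S') K) \<and> s + card S' \<le> rho n e q X"
proof (induction e arbitrary: S s K q X)
  case 0
  then have "S = {}" by (auto simp: wf_fam_def)
  then show ?case using 0(6)
    by (intro exI[of _ "{}"]) (auto simp: wf_fam_def valid_def refn_def Rg_def)
next
  case (Suc e)
  let ?E = "Suc e"
  \<comment> \<open>Chosen so that \<open>\<epsilon>\<close> is 2^-(K + q + 3): the \<open>q\<close>
    top members together contribute at most 2^-(K + 3), which fits into 2^-\<open>K\<close> beside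
    the error of the lower part.\<close>
  define K' where "K' = K + q + 2 * n + 5"
  define \<epsilon> where "\<epsilon> = (4::real) ^ (n + 1) * (1/2) ^ K'"
  define g where "g = (\<lambda>Y. rho n e (yf n ?E Y) (yf n ?E Y))"
  have g_ge: "Y \<le> g Y" for Y unfolding g_def by (rule order_trans[OF yf_ge rho_ge])
  have \<epsilon>_eq: "\<epsilon> = (1/2) ^ (K + q + 3)"
  proof -
    have "(4::real) ^ (n + 1) = 2 ^ (2 * n + 2)" using power_mult[of "2::real" 2 "n + 1"] by simp
    moreover have "(1/2 :: real) ^ K' = (1/2) ^ (K + q + 3) * (1/2) ^ (2 * n + 2)"
      unfolding power_add[symmetric] K'_def by (rule arg_cong[where f = "\<lambda>m. (1/2) ^ m"]) simp
    ultimately show ?thesis unfolding \<epsilon>_def by (simp add: power_divide)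
  qed
  have \<epsilon>1: "0 \<le> \<epsilon>" "\<epsilon> < 1" unfolding \<epsilon>_eq by (auto simp: power_less_one_iff)
  have K'X: "K' + 2 * n + 5 \<le> 3 * X \<and> K \<le> X \<and> 1 \<le> X" if "2 \<le> ?E" using Suc.prems that by (auto simp: K'_def)
  have nE: "3 * e + 2 \<le> n" "2 \<le> n" using Suc.prems(1) by auto
  \<comment> \<open>\<open>A\<close> is the regular lower part, \<open>C\<close> the top part. The
    potential, the sum of \<open>stg p + 1\<close> over \<open>C\<close>, drops in every
    round.\<close>
  have loop: "\<exists>S'. wf_fam V S' \<and> (\<forall>p\<in>S'. lev p \<le> ?E) \<and> refn V (A \<union> C) S' \<and> valid V n S' ((1/2) ^ K) \<and>
       Rg V S' (eta n (s + card S') K) \<and> s + card S' \<le> (g ^^ w) X'"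
    if C: "finite C" "card C \<le> q" "\<forall>p\<in>C. phase (ph p) \<and> dg V ?E (ph p) \<and> stg p \<le> ?E \<and> lev p = ?E \<and>
          detl V n (ph p) A (Suc (stg p)) \<epsilon>"
      and A: "\<forall>p\<in>A. lev p \<le> e" "valid V n A ((1/2) ^ K')"
      and M: "s + card C + card A \<le> M" "M \<le> X'" "Rg V A (eta n M K')" and XX: "X \<le> X'"
      and w: "(\<Sum>p\<in>C. stg p + 1) \<le> w" for w A C M X'
    using that
  proof (induction w arbitrary: A C M X' rule: nat_less_induct)
    case (1 w)
    note C = "1.prems"(1-3) and A = "1.prems"(4,5) and M = "1.prems"(6-8) and XX = "1.prems"(9) and w = "1.prems"(10)
    have wfA: "wf_fam V A" using A(2) by (simp add: valid_def)
    have finA: "finite A" using wfA by (simp add: wf_fam_def)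
    have dis: "A \<inter> C = {}" using A(1) C(3) by fastforce
    have cAC: "card (A \<union> C) = card A + card C" using finA C(1) dis by (simp add: card_Un_disjoint)
    define N where "N = s + card (A \<union> C)"
    have NM: "N \<le> M" using M(1) cAC by (simp add: N_def)
    have wfAC: "wf_fam V (A \<union> C)" using wfA C by (auto simp: wf_fam_def)
    show ?case
    proof (cases "Rg V (A \<union> C) (eta n N K)")
      case True
      obtain err where err: "\<And>p. p \<in> A \<Longrightarrow> 0 \<le> err p \<and> detl V n (ph p) (low A (lev p)) (Suc (stg p)) (err p)"
          "sum err A \<le> (1/2) ^ K'"
        using A(2) unfolding valid_def by blast
      have lowA: "low (A \<union> C) (lev p) = low A (lev p)" if "p \<in> A" for p
        using that A(1) C(3) by (fastforce simp: low_def)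
      have lowC: "low (A \<union> C) ?E = A" using A(1) C(3) by (fastforce simp: low_def)
      have "valid V n (A \<union> C) ((1/2) ^ K)"
        unfolding valid_def
      proof (intro conjI wfAC exI[of _ "\<lambda>p. if p \<in> A then err p else \<epsilon>"] ballI)
        fix p assume p: "p \<in> A \<union> C"
        show "0 \<le> (if p \<in> A then err p else \<epsilon>)" using err(1) \<epsilon>1 by auto
        show "detl V n (ph p) (low (A \<union> C) (lev p)) (Suc (stg p)) (if p \<in> A then err p else \<epsilon>)"
          using p err(1) lowA lowC C(3) by (cases "p \<in> A") auto
      next
        have "(\<Sum>p\<in>A \<union> C. if p \<in> A then err p else \<epsilon>) = sum err A + real (card C) * \<epsilon>"
        proof -
          have "(\<Sum>p\<in>C. if p \<in> A then err p else \<epsilon>) = (\<Sum>p\<in>C. \<epsilon>)" using dis by (intro sum.cong) auto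
          then show ?thesis using finA C(1) dis by (simp add: sum.union_disjoint)
        qed
        also have "\<dots> \<le> (1/2) ^ K' + real q * \<epsilon>"
          using err(2) C(2) \<epsilon>1 by (intro add_mono mult_right_mono) auto
        also have "\<dots> \<le> (1/2) ^ (K + 1) + (1/2) ^ (K + 3)"
        proof (rule add_mono)
          show "(1/2 :: real) ^ K' \<le> (1/2) ^ (K + 1)" unfolding K'_def by (intro power_decreasing) auto
          have "real q \<le> 2 ^ q" using less_exp[of q] by (metis less_imp_le of_nat_le_iff of_nat_numeral of_nat_power)
          then have "real q * (1/2) ^ q \<le> 1" by (simp add: power_divide)
          then have "(1/2) ^ (K + 3) * (real q * (1/2) ^ q) \<le> (1/2 :: real) ^ (K + 3) * 1" by (intro mult_left_mono) auto
          moreover have "real q * \<epsilon> = (1/2) ^ (K + 3) * (real q * (1/2) ^ q)"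
            unfolding \<epsilon>_eq by (simp add: power_add)
          ultimately show "real q * \<epsilon> \<le> (1/2) ^ (K + 3)" by (metis mult.right_neutral)
        qed
        also have "\<dots> = (1/2) ^ K * (5/8 :: real)" by (simp add: power_add power3_eq_cube)
        also have "\<dots> \<le> (1/2) ^ K" by simp
        finally show "(\<Sum>p\<in>A \<union> C. if p \<in> A then err p else \<epsilon>) \<le> (1/2) ^ K" .
      qed
      moreover have "s + card (A \<union> C) \<le> (g ^^ w) X'"
        using NM M(2) funpow_ge[of g X' w, OF g_ge] unfolding N_def by linarith
      ultimately show ?thesis using wfAC A(1) C(3) True unfolding N_def
        by (intro exI[of _ "A \<union> C"]) (auto simp: refn_refl)
    next
      case False
      then obtain j T where T: "T \<subseteq> {p \<in> A \<union> C. j \<le> stg p}" "T \<noteq> {}"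
         and big: "eta n N K ^ (2 ^ j) < \<bar>U V j (\<lambda>x. \<Prod>p\<in>T. ph p x)\<bar>"
        unfolding Rg_def by (auto simp: not_le)
      \<comment> \<open>\<open>A\<close> was made regular with the larger parameters
        \<open>M\<close> and \<open>K'\<close>, hence a violation must involve a member of
        \<open>C\<close>.\<close>
      have "\<not> T \<subseteq> A"
      proof
        assume "T \<subseteq> A"
        then have "\<bar>U V j (\<lambda>x. \<Prod>p\<in>T. ph p x)\<bar> \<le> eta n M K' ^ (2 ^ j)"
          using M(3) T unfolding Rg_def by blast
        also have "\<dots> \<le> eta n N K ^ (2 ^ j)"
          using eta_mono[OF NM, of K K' n] eta_pos by (intro power_mono) (auto simp: K'_def)
        finally show False using big by simp
      qed
      then obtain p0 where p0: "p0 \<in> T" "p0 \<in> C" "j \<le> stg p0" using T by blast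
      have finT: "finite T" using T(1) finA C(1) finite_subset by (metis (no_types, lifting) finite_UnI mem_Collect_eq subsetD subsetI)
      have phT: "phase (ph p)" "dg V ?E (ph p)" if "p \<in> T" for p
      proof -
        have "p \<in> A \<union> C" using that T(1) by blast
        then show "phase (ph p)" using wfAC by (auto simp: wf_fam_def)
        show "dg V ?E (ph p)"
        proof (cases "p \<in> A")
          case True
          then have "dg V (lev p) (ph p)" "lev p \<le> ?E" using wfA A(1) by (auto simp: wf_fam_def)
          then show ?thesis by (rule dg_mono[OF V])
        next
          case False
          then show ?thesis using \<open>p \<in> A \<union> C\<close> C(3) by blast
        qed
      qed
      define R where "R = (\<lambda>x. \<Prod>p\<in>T. ph p x)"
      have R: "phase R" "dg V ?E R" unfolding R_def using phT by (auto intro: phase_prod dg_prod[OF V] simp del: dg.simps)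
      have jE: "j \<le> ?E" using p0 C(3) by fastforce
      obtain SD where SD: "wf_fam V SD" "\<forall>p\<in>SD. lev p < ?E"
         "card SD \<le> 2 ^ j * ((tau n ?E N K K' + 1) ^ (?E - 1) - 1)"
         "card {p\<in>SD. lev p = ?E - 1} \<le> 2 ^ j * tau n ?E N K K'"
         and dR0: "\<And>A M. refn V SD A \<Longrightarrow> valid V n A ((1/2) ^ K') \<Longrightarrow> Rg V A (eta n M K') \<Longrightarrow> card A \<le> M \<Longrightarrow>
            detl V n R A j (4 ^ (n + 1) * (1/2) ^ K')"
        by (rule increment[OF V R _ Suc.prems(1) jE big[folded R_def], of K']) (assumption | simp)+
      note dR = dR0[folded \<epsilon>_def]
      define A2 where "A2 = A \<union> SD"
      define Y where "Y = yf n ?E X'"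
      have cA2: "s + card C + card A2 \<le> Y"
      proof -
        have "s + card C + card A2 \<le> X' + 2 ^ j * ((tau n ?E N K K' + 1) ^ (?E - 1) - 1)"
          unfolding A2_def using SD(3) M card_Un_le[of A SD] by linarith
        also have "\<dots> \<le> Y" unfolding Y_def
          using NM M(2) XX K'X jE nE by (intro yf_bound) fastforce+
        finally show ?thesis .
      qed
      have wfA2: "wf_fam V A2" "\<forall>p\<in>A2. lev p \<le> e"
        using wfA SD A(1) unfolding A2_def by (auto simp: wf_fam_def)
      \<comment> \<open>For the recursive call the number of members of the new top degree is
        estimated by the whole size, so both arguments of \<open>rho\<close> become
        \<open>Y\<close>.\<close>
      have "card {p \<in> A2. lev p = e} \<le> Y"
        using cA2 wfA2 card_mono[of A2 "{p \<in> A2. lev p = e}"] by (auto simp: wf_fam_def)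
      moreover have "2 \<le> e \<longrightarrow> K' + 2 * n + 5 \<le> Y"
        using K'X XX yf_3[of ?E X' n] unfolding Y_def by fastforce
      ultimately obtain A3 where A3: "wf_fam V A3" "\<forall>p\<in>A3. lev p \<le> e" "refn V A2 A3" "valid V n A3 ((1/2) ^ K')"
          "Rg V A3 (eta n (s + card C + card A3) K')" "s + card C + card A3 \<le> g X'"
        using Suc.IH[OF nE(1) wfA2 _ order_refl, of Y "s + card C" K'] cA2 unfolding g_def Y_def by auto
      have rA: "refn V A A3" and rS: "refn V SD A3"
        using refn_trans[OF refn_refl A3(3)] unfolding A2_def by blast+
      have dR3: "detl V n R A3 j \<epsilon>" by (rule dR[OF rS A3(4,5)]) simp
      \<comment> \<open>The derivatives of \<open>R\<close> of order \<open>j\<close> are now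
        forced, so \<open>R\<close> takes the place of \<open>p0\<close> with stage
        \<open>j - 1\<close>. If \<open>j = 0\<close>, \<open>R\<close> itself is a function of the
        lower part and \<open>p0\<close> is dropped.\<close>
      define C' where "C' = (if j = 0 then C - {p0} else insert (R, ?E, j - 1) (C - {p0}))"
      have finC': "finite C'" using C(1) by (simp add: C'_def)
      have cC': "card C' \<le> card C"
      proof -
        have "card (C - {p0}) < card C" using C(1) p0 by (intro card_Diff1_less)
        then show ?thesis using C(1) by (auto simp: C'_def card_insert_if)
      qed
      have propC': "\<forall>p\<in>C'. phase (ph p) \<and> dg V ?E (ph p) \<and> stg p \<le> ?E \<and> lev p = ?E \<and> detl V n (ph p) A3 (Suc (stg p)) \<epsilon>"
      proof
        fix p assume "p \<in> C'"
        then consider "p \<in> C" | "j \<noteq> 0" "p = (R, ?E, j - 1)" by (auto simp: C'_def split: if_splits)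
        then show "phase (ph p) \<and> dg V ?E (ph p) \<and> stg p \<le> ?E \<and> lev p = ?E \<and> detl V n (ph p) A3 (Suc (stg p)) \<epsilon>"
        proof cases
          case 1
          then show ?thesis using C(3) detl_refn[OF V rA] by blast
        next
          case 2
          then show ?thesis using R dR3 jE by (auto simp del: dg.simps)
        qed
      qed
      have wC': "(\<Sum>p\<in>C'. stg p + 1) < (\<Sum>p\<in>C. stg p + 1)"
      proof -
        have "(\<Sum>p\<in>C'. stg p + 1) \<le> j + (\<Sum>p\<in>C - {p0}. stg p + 1)"
          using C(1) by (auto simp: C'_def sum.insert_if)
        moreover have "(\<Sum>p\<in>C. stg p + 1) = (stg p0 + 1) + (\<Sum>p\<in>C - {p0}. stg p + 1)"
          by (rule sum.remove[OF C(1) p0(2)])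
        ultimately show ?thesis using p0(3) by linarith
      qed
      then obtain w' where w': "w = Suc w'" "(\<Sum>p\<in>C'. stg p + 1) \<le> w'" using w by (cases w) auto
      have "\<exists>S'. wf_fam V S' \<and> (\<forall>p\<in>S'. lev p \<le> ?E) \<and> refn V (A3 \<union> C') S' \<and> valid V n S' ((1/2) ^ K) \<and>
         Rg V S' (eta n (s + card S') K) \<and> s + card S' \<le> (g ^^ w') (g X')"
      proof (rule 1(1)[rule_format, of w' C' A3 "s + card C + card A3" "g X'"])
        show "w' < w" using w' by simp
        show "card C' \<le> q" using cC' C(2) by simp
        show "s + card C' + card A3 \<le> s + card C + card A3" using cC' by simp
        show "X \<le> g X'" using XX g_ge order_trans by blast
      qed (use finC' propC' A3 w' in auto)
      then obtain S' where S': "wf_fam V S'" "\<forall>p\<in>S'. lev p \<le> ?E" "refn V (A3 \<union> C') S'" "valid V n S' ((1/2) ^ K)"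
         "Rg V S' (eta n (s + card S') K)" "s + card S' \<le> (g ^^ w') (g X')" by blast
      have "refn V (A \<union> C) (A3 \<union> C')"
        unfolding refn_def
      proof (intro ballI impI)
        fix x y p assume xy: "x \<in> V" "y \<in> V" and ag: "\<forall>p\<in>A3 \<union> C'. ph p x = ph p y" and p: "p \<in> A \<union> C"
        have aA: "ph p x = ph p y" if "p \<in> A" for p using rA xy ag that unfolding refn_def by blast
        have aC: "ph p x = ph p y" if "p \<in> C - {p0}" for p using ag that by (auto simp: C'_def)
        have Rxy: "R x = R y"
        proof (cases "j = 0")
          case True
          then show ?thesis using detl_0[OF V _ \<epsilon>1(2) xy, of n R A3] dR3 ag by auto
        next
          case False
          then have "(R, ?E, j - 1) \<in> A3 \<union> C'" by (simp add: C'_def)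
          then show ?thesis using ag by force
        qed
        have "ph p0 x = ph p0 y"
        proof (rule prod_remove_det[OF finT p0(1) phT(1)])
          show "ph p x = ph p y" if "p \<in> T - {p0}" for p
            using that T(1) aA aC by blast
          show "(\<Prod>p\<in>T. ph p x) = (\<Prod>p\<in>T. ph p y)" using Rxy by (simp add: R_def)
        qed
        then show "ph p x = ph p y" using p aA aC by blast
      qed
      then have "refn V (A \<union> C) S'" using S'(3) refn_trans by blast
      moreover have "(g ^^ w') (g X') = (g ^^ w) X'" using w' by (simp add: funpow_swap1)
      ultimately show ?thesis using S' by auto
    qed
  qed
  define A0 where "A0 = {p \<in> S. lev p \<le> e}"
  \<comment> \<open>The stage is set to the full degree, where validity is automatic by
    \<open>detl_top\<close>.\<close>
  define C0 where "C0 = (\<lambda>p. (ph p, ?E, ?E)) ` {p \<in> S. lev p = ?E}"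
  have finS: "finite S" using Suc.prems by (simp add: wf_fam_def)
  have cC0: "card C0 \<le> card {p \<in> S. lev p = ?E}" unfolding C0_def using finS by (intro card_image_le) simp
  have SA: "S = A0 \<union> {p \<in> S. lev p = ?E}" "A0 \<inter> {p \<in> S. lev p = ?E} = {}" using Suc.prems(3) unfolding A0_def by force+
  have cS: "card S = card A0 + card {p \<in> S. lev p = ?E}"
    using finS SA card_Un_disjoint[of A0 "{p \<in> S. lev p = ?E}"] by (auto simp: A0_def)
  define Y where "Y = yf n ?E X"
  have XY: "X \<le> Y" unfolding Y_def by (rule yf_ge)
  have wfA0: "wf_fam V A0" "\<forall>p\<in>A0. lev p \<le> e" using Suc.prems(2) by (auto simp: wf_fam_def A0_def)
  have sY: "s + card C0 + card A0 \<le> Y" using Suc.prems(6) cS cC0 XY by linarith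
  have "card {p \<in> A0. lev p = e} \<le> Y"
  proof -
    have "card {p \<in> A0. lev p = e} \<le> card A0" using finS by (intro card_mono) (auto simp: A0_def)
    then show ?thesis using sY by linarith
  qed
  moreover have "2 \<le> e \<longrightarrow> K' + 2 * n + 5 \<le> Y"
    using K'X yf_3[of ?E X n] unfolding Y_def by fastforce
  ultimately obtain A where A: "wf_fam V A" "\<forall>p\<in>A. lev p \<le> e" "refn V A0 A" "valid V n A ((1/2) ^ K')"
      "Rg V A (eta n (s + card C0 + card A) K')" "s + card C0 + card A \<le> g X"
    using Suc.IH[OF nE(1) wfA0 _ order_refl, of Y "s + card C0" K'] sY unfolding g_def Y_def by auto
  define w where "w = (e + 2) * q"
  have "\<exists>S'. wf_fam V S' \<and> (\<forall>p\<in>S'. lev p \<le> ?E) \<and> refn V (A \<union> C0) S' \<and> valid V n S' ((1/2) ^ K) \<and>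
       Rg V S' (eta n (s + card S') K) \<and> s + card S' \<le> (g ^^ w) (g X)"
  proof (rule loop[OF _ _ _ A(2,4) order_refl A(6,5) g_ge])
    show "finite C0" unfolding C0_def using finS by simp
    show "card C0 \<le> q" using cC0 Suc.prems(4) by simp
    show "\<forall>p\<in>C0. phase (ph p) \<and> dg V ?E (ph p) \<and> stg p \<le> ?E \<and> lev p = ?E \<and> detl V n (ph p) A (Suc (stg p)) \<epsilon>"
    proof
      fix p assume "p \<in> C0"
      then obtain r where r: "r \<in> S" "lev r = ?E" "p = (ph r, ?E, ?E)" by (auto simp: C0_def)
      then have "phase (ph r)" "dg V ?E (ph r)" using Suc.prems(2) unfolding wf_fam_def by (metis, metis)
      then show "phase (ph p) \<and> dg V ?E (ph p) \<and> stg p \<le> ?E \<and> lev p = ?E \<and> detl V n (ph p) A (Suc (stg p)) \<epsilon>"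
        using r detl_top[OF V _ _ \<epsilon>1(1)] by (auto simp del: dg.simps)
    qed
    have "(\<Sum>p\<in>C0. stg p + 1) = (\<Sum>p\<in>C0. e + 2)" by (intro sum.cong) (auto simp: C0_def)
    also have "\<dots> = (e + 2) * card C0" by simp
    also have "\<dots> \<le> w" unfolding w_def using cC0 Suc.prems(4) by (intro mult_left_mono) auto
    finally show "(\<Sum>p\<in>C0. stg p + 1) \<le> w" .
  qed
  then obtain S' where S': "wf_fam V S'" "\<forall>p\<in>S'. lev p \<le> ?E" "refn V (A \<union> C0) S'" "valid V n S' ((1/2) ^ K)"
     "Rg V S' (eta n (s + card S') K)" "s + card S' \<le> (g ^^ w) (g X)" by blast
  have "refn V S (A \<union> C0)"
    unfolding refn_def
  proof (intro ballI impI)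
    fix x y p assume xy: "x \<in> V" "y \<in> V" "\<forall>p\<in>A \<union> C0. ph p x = ph p y" and p: "p \<in> S"
    show "ph p x = ph p y"
    proof (cases "lev p = ?E")
      case True
      then have "(ph p, ?E, ?E) \<in> A \<union> C0" using p by (auto simp: C0_def)
      from bspec[OF xy(3) this] show ?thesis by simp
    next
      case False
      then have "p \<in> A0" using SA p by blast
      then show ?thesis using A(3) xy unfolding refn_def by blast
    qed
  qed
  then have "refn V S S'" using S'(3) by (rule refn_trans)
  moreover have "(g ^^ w) (g X) = rho n ?E q X"
    unfolding rho.simps g_def[symmetric] w_def by (simp add: funpow_swap1)
  then have "s + card S' \<le> rho n ?E q X" using S'(6) by (simp only:)
  ultimately show ?case using S'(1,2,4,5) by blast
qed

section \<open>Eliminating biased products of lower degree\<close>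

text \<open>Twice the bias \<open>2 powr (- 3 * S / 2) / 4\<close> at which the theorem evaluates \<open>c\<close>; the factor 2 pays for one gate.\<close>

definition thr :: "nat \<Rightarrow> real" where
  "thr S = 2 powr (- (3 * real S / 2) - 1)"

lemma thr_pos: "0 < thr S" by (simp add: thr_def)

lemma half_powr: "(1/2 :: real) ^ k = 2 powr (- real k)"
  by (simp add: powr_minus powr_realpow power_one_over inverse_eq_divide)

definition unbiased :: "('v::ab_group_add) set \<Rightarrow> 'v tri set \<Rightarrow> nat \<Rightarrow> bool" where
  "unbiased V L S \<longleftrightarrow> (\<forall>T. T \<subseteq> L \<longrightarrow> T \<noteq> {} \<longrightarrow> \<bar>av V (\<lambda>x. \<Prod>p\<in>T. ph p x)\<bar> < thr S)"

text \<open>A sample exponent for a product with bias at least \<open>thr S\<close> and error 2^-(e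
  + 6): \<open>(thr S)\<^sup>2\<close> is 2^-(3 * S + 2), and the summand 2 inside the parentheses
  absorbs the rounding of 3 * S / 2.\<close>

definition taue :: "nat \<Rightarrow> nat \<Rightarrow> nat" where
  "taue e S = 2 * ((3 * S) div 2 + 2) + (e + 6)"

text \<open>Size bound after a biased product of degree at most \<open>e\<close> has been traded for
  derivatives and everything below \<open>e\<close> has been regularized. Of the derivatives, at
  most \<open>t\<close> have degree \<open>e - 1\<close>. The term \<open>4 * n + 9\<close> is the
  lower bound that \<open>regularize\<close> demands of its size argument when \<open>e - 1\<close>
  is at least 2, for \<open>K = 2 * n + 4\<close>.\<close>

definition beta :: "nat \<Rightarrow> nat \<Rightarrow> nat" where
  "beta e S = (let n = 3 * e + 3; t = taue e S in
     rho n (e - 1) (S + t) (S + (t + 1) ^ (e - 1) + (if 3 \<le> e then 4 * n + 9 else 0)))"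

text \<open>Regularity of order 0 is a bound on biases, and \<open>eta\<close> lies below
  \<open>thr\<close>. The number \<open>b\<close> counts the members of degree at least
  \<open>e\<close>, which are not touched but enter the size at which the bias is compared.\<close>

lemma low_regularize:
  assumes V: "elem2 V" and L: "wf_fam V L" "\<forall>p\<in>L. lev p < e" and e: "2 \<le> e"
    and X: "card {p\<in>L. lev p = e - 1} \<le> S + taue e S" "b + card L \<le> S + (taue e S + 1) ^ (e - 1)"
  shows "\<exists>L'. wf_fam V L' \<and> (\<forall>p\<in>L'. lev p < e) \<and> refn V L L' \<and> unbiased V L' (b + card L') \<and>
    valid V (3 * e + 3) L' ((1/2) ^ (2 * (3 * e + 3) + 4)) \<and>
    Rg V L' (eta (3 * e + 3) (b + card L') (2 * (3 * e + 3) + 4)) \<and> b + card L' \<le> beta e S"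
proof -
  define n where "n = 3 * e + 3"
  define K where "K = 2 * n + 4"
  define Z where "Z = S + (taue e S + 1) ^ (e - 1) + (if 3 \<le> e then 4 * n + 9 else 0)"
  have q: "S + taue e S \<le> Z"
  proof -
    have "taue e S + 1 \<le> (taue e S + 1) ^ (e - 1)" using e by (intro self_le_power) auto
    then show ?thesis by (simp add: Z_def)
  qed
  have "3 * (e - 1) + 2 \<le> n" "\<forall>p\<in>L. lev p \<le> e - 1" using e L by (auto simp: n_def)
  moreover have "b + card L \<le> Z" using X(2) by (simp add: Z_def)
  moreover have "2 \<le> e - 1 \<longrightarrow> K + 2 * n + 5 \<le> Z" by (auto simp: Z_def K_def)
  ultimately obtain L' where L': "wf_fam V L'" "\<forall>p\<in>L'. lev p \<le> e - 1" "refn V L L'" "valid V n L' ((1/2) ^ K)"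
       "Rg V L' (eta n (b + card L') K)" "b + card L' \<le> rho n (e - 1) (S + taue e S) Z"
    using regularize[OF V, of "e - 1" n L "S + taue e S" Z b K] L(1) X(1) q by blast
  have "unbiased V L' (b + card L')" unfolding unbiased_def
  proof (intro allI impI)
    fix T assume T: "T \<subseteq> L'" "T \<noteq> {}"
    have "\<bar>U V 0 (\<lambda>x. \<Prod>p\<in>T. ph p x)\<bar> \<le> eta n (b + card L') K ^ (2 ^ 0)"
      using L'(5)[unfolded Rg_def, rule_format, of T 0] T by auto
    also have "\<dots> = 2 powr (- real ((b + card L') * 2 ^ n + K))" unfolding eta_def half_powr by simp
    also have "\<dots> < thr (b + card L')" unfolding thr_def
    proof (rule powr_less_mono)
      have "2 * (b + card L') \<le> (b + card L') * 2 ^ n"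
      proof -
        have "2 \<le> (2::nat) ^ n" using power_increasing[of 1 n "2::nat"] by (simp add: n_def)
        then have "(b + card L') * 2 \<le> (b + card L') * 2 ^ n" by (rule mult_left_mono) simp
        then show ?thesis by (simp add: mult.commute)
      qed
      then have "real (2 * (b + card L')) \<le> real ((b + card L') * 2 ^ n)" by (rule of_nat_mono)
      moreover have "real K \<ge> 4" by (simp add: K_def)
      ultimately show "- real ((b + card L') * 2 ^ n + K) < - (3 * real (b + card L') / 2) - 1"
        unfolding of_nat_add[of "(b + card L') * 2 ^ n"] by linarith
    qed simp
    finally show "\<bar>av V (\<lambda>x. \<Prod>p\<in>T. ph p x)\<bar> < thr (b + card L')" by simp
  qed
  moreover have "\<forall>p\<in>L'. lev p < e" using L'(2) e by fastforce
  ultimately show ?thesis using L' unfolding n_def K_def beta_def Let_def Z_def by blast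
qed

lemma low_elim:
  assumes V: "elem2 V" and F: "wf_fam V F" and e: "2 \<le> e"
  shows "\<exists>F'. wf_fam V F' \<and> refn V F F' \<and> {p\<in>F'. e \<le> lev p} = {p\<in>F. e \<le> lev p} \<and>
     card F' \<le> beta e (card F) \<and> unbiased V {p\<in>F'. lev p < e} (card F')"
proof -
  define L where "L = {p\<in>F. lev p < e}"
  define H where "H = {p\<in>F. e \<le> lev p}"
  have fin: "finite F" using F by (simp add: wf_fam_def)
  have FU: "F = H \<union> L" "H \<inter> L = {}" by (auto simp: H_def L_def)
  have cF: "card F = card H + card L" using FU fin by (metis card_Un_disjoint finite_Un)
  have wL: "wf_fam V L" "\<forall>p\<in>L. lev p < e" using F by (auto simp: wf_fam_def L_def)
  have 1: "card {p\<in>L. lev p = e - 1} \<le> card F + taue e (card F)"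
    using card_mono[of F "{p\<in>L. lev p = e - 1}"] fin by (auto simp: L_def intro: trans_le_add1)
  have 2: "card H + card L \<le> card F + (taue e (card F) + 1) ^ (e - 1)" using cF by simp
  obtain L' where L': "wf_fam V L'" "\<forall>p\<in>L'. lev p < e" "refn V L L'" "unbiased V L' (card H + card L')"
     "card H + card L' \<le> beta e (card F)"
    using low_regularize[OF V wL e 1 2] by blast
  define F' where "F' = H \<union> L'"
  have finL': "finite L'" using L'(1) by (simp add: wf_fam_def)
  have dis: "H \<inter> L' = {}" using L'(2) by (auto simp: H_def)
  have cF': "card F' = card H + card L'" unfolding F'_def using dis finL' fin by (intro card_Un_disjoint) (auto simp: H_def)
  have low': "{p\<in>F'. lev p < e} = L'" using L'(2) by (auto simp: F'_def H_def)
  have "wf_fam V F'" using F L'(1) unfolding F'_def wf_fam_def H_def by auto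
  moreover have "{p\<in>F'. e \<le> lev p} = {p\<in>F. e \<le> lev p}" using L'(2) by (auto simp: F'_def H_def)
  moreover have "refn V F F'" using L'(3) unfolding FU(1) F'_def refn_def by (metis Un_iff)
  ultimately show ?thesis using L'(4,5) cF' low' by (intro exI[of _ F']) simp
qed

text \<open>With an empty index set, \<open>derivative_sampling\<close> approximates the biased
  product itself by phases of lower degree. After regularization \<open>upgrade\<close> brings the
  error at every point below 1, so the product is exactly a function of lower members, and
  \<open>p0\<close> can be recovered from it and the other factors.\<close>

lemma mid_elim:
  assumes V: "elem2 V" and F: "wf_fam V F" and e: "2 \<le> e"
    and T: "T \<subseteq> F" "\<forall>p\<in>T. lev p \<le> e" "p0 \<in> T" "lev p0 = e"
    and big: "thr (card F) \<le> \<bar>av V (\<lambda>x. \<Prod>p\<in>T. ph p x)\<bar>"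
  shows "\<exists>F'. wf_fam V F' \<and> refn V F F' \<and> {p\<in>F'. e \<le> lev p} = {p\<in>F. e \<le> lev p} - {p0} \<and>
     card F' \<le> beta e (card F) \<and> unbiased V {p\<in>F'. lev p < e} (card F')"
proof -
  define S where "S = card F"
  define n where "n = 3 * e + 3"
  define K where "K = 2 * n + 4"
  define L where "L = {p\<in>F. lev p < e}"
  define H where "H = {p\<in>F. e \<le> lev p} - {p0}"
  have fin: "finite F" using F by (simp add: wf_fam_def)
  have p0F: "p0 \<in> F" using T by blast
  have FU: "F = insert p0 (H \<union> L)" "p0 \<notin> H \<union> L" "H \<inter> L = {}" using T p0F by (auto simp: H_def L_def)
  have finHL: "finite H" "finite L" using fin by (auto simp: H_def L_def)
  have cF: "S = Suc (card H + card L)"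
    unfolding S_def by (subst FU(1)) (use FU(2,3) finHL in \<open>simp add: card_Un_disjoint\<close>)
  have phT: "phase (ph p)" "dg V e (ph p)" if "p \<in> T" for p
  proof -
    have "phase (ph p)" "dg V (lev p) (ph p)" "lev p \<le> e" using that T(1,2) F by (auto simp: wf_fam_def)
    then show "phase (ph p)" "dg V e (ph p)" using dg_mono[OF V] by blast+
  qed
  define R where "R = (\<lambda>x. \<Prod>p\<in>T. ph p x)"
  have R: "phase R" "dg V e R" unfolding R_def using phT by (auto intro: phase_prod dg_prod[OF V] simp del: dg.simps)
  define \<tau> where "\<tau> = taue e S"
  define \<epsilon> where "\<epsilon> = (1/2 :: real) ^ (e + 6)"
  have tt: "1 \<le> 2 ^ \<tau> * \<epsilon> * (thr S)\<^sup>2"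
  proof -
    have "(2::real) ^ \<tau> * \<epsilon> * (thr S)\<^sup>2 = 2 powr real \<tau> * 2 powr (- real (e + 6)) * 2 powr (2 * (- (3 * real S / 2) - 1))"
      unfolding \<epsilon>_def half_powr thr_def power2_eq_square by (simp add: powr_realpow flip: powr_add)
    also have "\<dots> = 2 powr (real \<tau> - real (e + 6) + 2 * (- (3 * real S / 2) - 1))"
      by (simp add: powr_add[symmetric])
    also have "1 \<le> \<dots>"
    proof -
      have "3 * S \<le> 2 * ((3 * S) div 2) + 1" by simp
      then have "3 * real S \<le> 2 * real ((3 * S) div 2) + 1" by linarith
      moreover have "real \<tau> = 2 * (real ((3 * S) div 2) + 2) + real (e + 6)" unfolding \<tau>_def taue_def by simp
      ultimately have "0 \<le> real \<tau> - real (e + 6) + 2 * (- (3 * real S / 2) - 1)" by argo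
      then show ?thesis by (simp add: ge_one_powr_ge_zero)
    qed
    finally show ?thesis .
  qed
  have bU: "thr S \<le> \<bar>U V (card ({}::nat set)) R\<bar>" using big by (simp add: S_def R_def)
  have "1 \<le> e" using e by simp
  from derivative_sampling[OF V R this empty_subsetI bU thr_pos tt, of n] obtain SD F0 where SD: "wf_fam V SD" "\<forall>p\<in>SD. lev p < e"
     "card SD \<le> 2 ^ card ({}::nat set) * ((\<tau> + 1) ^ (e - 1) - 1)" "card {p\<in>SD. lev p = e - 1} \<le> 2 ^ card ({}::nat set) * \<tau>"
     "av V (\<lambda>x. pr (cubn n V) (\<lambda>h. D R x h {} \<noteq> F0 (pat SD x h {}))) \<le> \<epsilon>"
    by blast
  define L2 where "L2 = L \<union> SD"
  have wL2: "wf_fam V L2" "\<forall>p\<in>L2. lev p < e" using F SD by (auto simp: wf_fam_def L2_def L_def)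
  have 1: "card {p\<in>L2. lev p = e - 1} \<le> S + taue e S"
  proof -
    have "{p\<in>L2. lev p = e - 1} = {p\<in>L. lev p = e - 1} \<union> {p\<in>SD. lev p = e - 1}" by (auto simp: L2_def)
    then have "card {p\<in>L2. lev p = e - 1} \<le> card {p\<in>L. lev p = e - 1} + card {p\<in>SD. lev p = e - 1}"
      by (simp only: card_Un_le)
    moreover have "card {p\<in>L. lev p = e - 1} \<le> card F" using fin by (intro card_mono) (auto simp: L_def)
    ultimately show ?thesis using SD(4) by (simp add: S_def \<tau>_def)
  qed
  have 2: "card H + card L2 \<le> S + (taue e S + 1) ^ (e - 1)"
  proof -
    have "card SD \<le> (taue e S + 1) ^ (e - 1)" using SD(3) by (simp add: \<tau>_def)
    then show ?thesis using card_Un_le[of L SD] cF unfolding L2_def by linarith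
  qed
  obtain L' where L': "wf_fam V L'" "\<forall>p\<in>L'. lev p < e" "refn V L2 L'" "unbiased V L' (card H + card L')"
    "valid V n L' ((1/2) ^ K)" "Rg V L' (eta n (card H + card L') K)" "card H + card L' \<le> beta e S"
    using low_regularize[OF V wL2 e 1 2] unfolding n_def[symmetric] K_def[symmetric] by blast
  have rL: "refn V L L'" and rS: "refn V SD L'" using refn_trans[OF refn_refl L'(3)] unfolding L2_def by blast+
  obtain g where g: "\<And>x h. x \<in> V \<Longrightarrow> h \<in> cubn n V \<Longrightarrow> pat SD x h {} = g (pat L' x h {})"
    using pat_refn[OF V rS, of "{}" n] by blast
  have "av V (\<lambda>x. pr (cubn n V) (\<lambda>h. D R x h {} \<noteq> F0 (g (pat L' x h {})))) \<le> \<epsilon>"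
    by (rule order_trans[OF av_mono SD(5)], rule pr_mono) (use g in auto)
  moreover have "card ({}::nat set) + 2 * Suc e \<le> n" by (simp add: n_def)
  ultimately obtain F1 where F1: "\<And>x. x \<in> V \<Longrightarrow> pr (cubn n V) (\<lambda>h. D R x h {} \<noteq> F1 (pat L' x h {}))
     \<le> 3 * (2 ^ Suc e * \<epsilon>) + 3 * (4 ^ n * (1/2) ^ K) + 2 * (2 ^ (card L' * 2 ^ n) * eta n (card H + card L') K)"
    using upgrade[OF V L'(5,6) eta_pos(2) R empty_subsetI, of "\<lambda>P. F0 (g P)" \<epsilon>] by blast
  define err where "err = 3 * (2 ^ Suc e * \<epsilon>) + 3 * (4 ^ n * (1/2) ^ K) + 2 * (2 ^ (card L' * 2 ^ n) * eta n (card H + card L') K)"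
  \<comment> \<open>\<open>\<epsilon>\<close> times 2^(e + 1) is 2^-5 and \<open>K\<close> exceeds 2
    * n by 4, so the total is at most 3/32 + 3/16 + 2/16 = 13/32.\<close>
  have err: "err < 1"
  proof -
    have "(2::real) ^ (card L' * 2 ^ n) * eta n (card H + card L') K \<le> 2 ^ ((card H + card L') * 2 ^ n) * eta n (card H + card L') K"
      using eta_pos by (intro mult_right_mono power_increasing) auto
    also have "\<dots> = (1/2) ^ K" unfolding eta_def by (simp add: power_add power_divide)
    also have "\<dots> \<le> (1/2) ^ 4" unfolding K_def by (intro power_decreasing) auto
    finally have a: "2 ^ (card L' * 2 ^ n) * eta n (card H + card L') K \<le> (1/2) ^ 4" .
    have b: "(4::real) ^ n * (1/2) ^ K = (1/2) ^ 4"
    proof -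
      have "(4::real) ^ n = 2 ^ (2 * n)" by (simp add: power_mult)
      then show ?thesis unfolding K_def by (simp add: power_add power_divide)
    qed
    have c: "(2::real) ^ Suc e * \<epsilon> = (1/2) ^ 5" unfolding \<epsilon>_def by (simp add: power_add power_divide)
    show ?thesis unfolding err_def b c using a by (simp add: power_divide)
  qed
  have "detl V n R L' (card ({}::nat set)) err"
    by (rule detl_transport[OF V empty_subsetI, of n R F1]) (use F1 in \<open>simp add: err_def\<close>)
  then have dR: "detl V n R L' 0 err" by simp
  define F' where "F' = H \<union> L'"
  have finL': "finite L'" using L'(1) by (simp add: wf_fam_def)
  have dis: "H \<inter> L' = {}" using L'(2) by (auto simp: H_def)
  have cF': "card F' = card H + card L'" unfolding F'_def using dis finL' finHL by (intro card_Un_disjoint) auto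
  have low': "{p\<in>F'. lev p < e} = L'" using L'(2) by (auto simp: F'_def H_def)
  have "wf_fam V F'" using F L'(1) unfolding F'_def wf_fam_def H_def by auto
  moreover have "{p\<in>F'. e \<le> lev p} = {p\<in>F. e \<le> lev p} - {p0}" using L'(2) by (auto simp: F'_def H_def)
  moreover have "refn V F F'"
    unfolding refn_def
  proof (intro ballI impI)
    fix x y p assume xy: "x \<in> V" "y \<in> V" and ag: "\<forall>p\<in>F'. ph p x = ph p y" and p: "p \<in> F"
    have aL: "ph p x = ph p y" if "p \<in> L" for p using rL xy ag that unfolding refn_def F'_def by blast
    have aH: "ph p x = ph p y" if "p \<in> H" for p using ag that by (auto simp: F'_def)
    have Rxy: "R x = R y" by (rule detl_0[OF V dR err xy]) (use ag in \<open>auto simp: F'_def\<close>)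
    have "ph p0 x = ph p0 y"
    proof (rule prod_remove_det[OF _ T(3) phT(1)])
      show "finite T" using T(1) fin finite_subset by blast
      show "ph p x = ph p y" if "p \<in> T - {p0}" for p
        using that T(1) aL aH FU(1) by blast
      show "(\<Prod>p\<in>T. ph p x) = (\<Prod>p\<in>T. ph p y)" using Rxy by (simp add: R_def)
    qed
    then show "ph p x = ph p y" using p FU(1) aL aH by blast
  qed
  ultimately show ?thesis using L'(4,7) cF' low' unfolding S_def by (intro exI[of _ F']) simp
qed

text \<open>By Parseval the collision probability of the patterns is the sum of squared biases over
  2^\<open>card F\<close>, so their distribution is within \<open>\<theta>\<close> of uniform in l2.
  Cauchy-Schwarz then compares Pr[P] with the share of accepted patterns. Because the deviations
  \<open>u\<close> sum to 0, the indicator of \<open>Q\<close> may be replaced by a sign, which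
  gains the factor 2.\<close>

lemma parseval_bound:
  fixes V :: "'v::ab_group_add set"
  assumes V: "elem2 V" and F: "wf_fam V F" and \<theta>: "0 \<le> \<theta>"
    and small: "\<And>T. T \<subseteq> F \<Longrightarrow> T \<noteq> {} \<Longrightarrow> \<bar>av V (\<lambda>x. \<Prod>p\<in>T. ph p x)\<bar> \<le> \<theta>"
    and P: "\<And>x y. x \<in> V \<Longrightarrow> y \<in> V \<Longrightarrow> \<forall>p\<in>F. ph p x = ph p y \<Longrightarrow> P x = P y"
  shows "\<exists>a::nat. (2 * (pr V P - real a / 2 ^ card F))\<^sup>2 \<le> 2 ^ card F * \<theta>\<^sup>2"
proof -
  have fV: "finite V" "V \<noteq> {}" using sgD[OF V] by auto
  have fF: "finite F" and phF: "\<And>p. p \<in> F \<Longrightarrow> phase (ph p)" using F by (auto simp: wf_fam_def)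
  let ?X = "sgn_cub F"
  define Z :: "'v \<Rightarrow> 'v tri \<Rightarrow> real" where "Z x = (\<lambda>p. ph p x)" for x
  define f where "f = (1 / 2 ^ card F :: real)"
  have pm: "Z x p = 1 \<or> Z x p = -1" if "p \<in> F" for x p using phF[OF that] by (auto simp: Z_def phase_def)
  have inX: "res F (Z x) \<in> ?X" for x by (intro res_in pm)
  have fX: "finite ?X" "card ?X = 2 ^ card F" using sgn_cub_fin[of F] fF by auto
  define q where "q z = pr V (\<lambda>x. res F (Z x) = z)" for z
  define b where "b A = av V (\<lambda>x. \<Prod>p\<in>A. ph p x)" for A :: "'v tri set"
  have sum1: "(\<Sum>z\<in>?X. of_bool (res F (Z x) = z) * w z) = w (res F (Z x))" for x and w :: "('v tri \<Rightarrow> real) \<Rightarrow> real"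
    using fX(1) inX[of x] by (subst sum.remove[of _ "res F (Z x)"]) (auto intro!: sum.neutral)
  have qsum: "(\<Sum>z\<in>?X. q z * w z) = av V (\<lambda>x. w (res F (Z x)))" for w
    unfolding q_def pr_def av_cmult_right[symmetric] av_sum[symmetric] sum1 ..
  have "(\<Sum>z\<in>?X. (q z)\<^sup>2) = av V (\<lambda>x. q (res F (Z x)))" unfolding power2_eq_square by (rule qsum)
  also have "\<dots> = av V (\<lambda>x. av V (\<lambda>y. (\<Sum>A\<in>Pow F. (\<Prod>p\<in>A. Z x p) * (\<Prod>p\<in>A. Z y p)) * f))"
  proof (intro av_cong refl)
    fix x
    have "q (res F (Z x)) = av V (\<lambda>y. of_bool (res F (Z y) = res F (Z x)))" by (simp add: q_def pr_def)
    also have "\<dots> = av V (\<lambda>y. (\<Sum>A\<in>Pow F. (\<Prod>p\<in>A. Z x p) * (\<Prod>p\<in>A. Z y p)) * f)"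
    proof (intro av_cong refl)
      fix y
      have "(\<Prod>p\<in>A. res F (Z x) p) = (\<Prod>p\<in>A. Z x p)" if "A \<in> Pow F" for A
        using that by (intro prod.cong) (auto simp: res_def)
      then show "of_bool (res F (Z y) = res F (Z x)) = (\<Sum>A\<in>Pow F. (\<Prod>p\<in>A. Z x p) * (\<Prod>p\<in>A. Z y p)) * f"
        by (subst ind_expand[OF fF inX pm]) (auto simp: f_def)
    qed
    finally show "q (res F (Z x)) = av V (\<lambda>y. (\<Sum>A\<in>Pow F. (\<Prod>p\<in>A. Z x p) * (\<Prod>p\<in>A. Z y p)) * f)" .
  qed
  also have "\<dots> = (\<Sum>A\<in>Pow F. (b A)\<^sup>2) * f"
    by (simp only: av_cmult_right av_sum av_cmult) (simp add: b_def Z_def power2_eq_square)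
  also have "(\<Sum>A\<in>Pow F. (b A)\<^sup>2) = 1 + (\<Sum>A\<in>Pow F - {{}}. (b A)\<^sup>2)"
    using fF fV by (subst sum.remove[of _ "{}"]) (auto simp: b_def av_const)
  also have "\<dots> * f \<le> (1 + 2 ^ card F * \<theta>\<^sup>2) * f"
  proof -
    have "(\<Sum>A\<in>Pow F - {{}}. (b A)\<^sup>2) \<le> (\<Sum>A\<in>Pow F - {{}}. \<theta>\<^sup>2)"
    proof (rule sum_mono)
      fix A assume "A \<in> Pow F - {{}}"
      then have "\<bar>b A\<bar> \<le> \<theta>" using small by (auto simp: b_def)
      then show "(b A)\<^sup>2 \<le> \<theta>\<^sup>2" using power_mono[of "\<bar>b A\<bar>" \<theta> 2] by simp
    qed
    also have "\<dots> \<le> 2 ^ card F * \<theta>\<^sup>2"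
    proof -
      have "real (card (Pow F - {{}})) \<le> 2 ^ card F"
        using fF by (simp add: card_Diff_singleton card_Pow)
      then show ?thesis by (simp add: mult_right_mono)
    qed
    finally show ?thesis by (intro mult_right_mono) (auto simp: f_def)
  qed
  finally have q2: "(\<Sum>z\<in>?X. (q z)\<^sup>2) \<le> (1 + 2 ^ card F * \<theta>\<^sup>2) * f" .
  have q1: "(\<Sum>z\<in>?X. q z) = 1" using qsum[of "\<lambda>_. 1"] fV by (simp add: av_const)
  have cf: "real (card ?X) * f = 1" by (simp add: fX f_def)
  define u where "u z = q z - f" for z
  have u0: "(\<Sum>z\<in>?X. u z) = 0" unfolding u_def sum_subtractf q1 using cf by simp
  have "(\<Sum>z\<in>?X. (u z)\<^sup>2) = (\<Sum>z\<in>?X. (q z)\<^sup>2 - 2 * f * q z + f\<^sup>2)"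
    by (intro sum.cong refl) (simp add: u_def power2_diff)
  also have "\<dots> = (\<Sum>z\<in>?X. (q z)\<^sup>2) - 2 * f + (real (card ?X) * f) * f"
    by (simp add: sum.distrib sum_subtractf sum_distrib_left[symmetric] q1 power2_eq_square)
  also have "\<dots> \<le> \<theta>\<^sup>2"
  proof -
    have "(1 + 2 ^ card F * \<theta>\<^sup>2) * f = f + \<theta>\<^sup>2" by (simp add: f_def field_simps)
    then show ?thesis using q2 cf by simp
  qed
  finally have u2: "(\<Sum>z\<in>?X. (u z)\<^sup>2) \<le> \<theta>\<^sup>2" .
  have "\<exists>Q. \<forall>x\<in>V. P x = Q (res F (Z x))"
  proof (rule factor_through)
    fix x y assume xy: "x \<in> V" "y \<in> V" and eq: "res F (Z x) = res F (Z y)"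
    show "P x = P y"
    proof (rule P[OF xy], rule ballI)
      fix p assume "p \<in> F"
      then show "ph p x = ph p y" using fun_cong[OF eq, of p] by (simp add: res_def Z_def)
    qed
  qed
  then obtain Q where Q: "\<And>x. x \<in> V \<Longrightarrow> P x = Q (res F (Z x))" by blast
  define a where "a = card {z\<in>?X. Q z}"
  have ae: "(\<Sum>z\<in>?X. of_bool (Q z) :: real) = real a"
    using fX(1) by (simp add: a_def of_bool_def sum.If_cases Int_def)
  have prP: "pr V P = (\<Sum>z\<in>?X. q z * of_bool (Q z))"
    unfolding qsum pr_def by (intro av_cong refl) (simp add: Q)
  have "2 * (pr V P - real a / 2 ^ card F) = (\<Sum>z\<in>?X. u z * (2 * of_bool (Q z) - 1))"
  proof -
    have "(\<Sum>z\<in>?X. u z * (2 * of_bool (Q z) - 1)) = 2 * (\<Sum>z\<in>?X. u z * of_bool (Q z)) - (\<Sum>z\<in>?X. u z)"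
      by (simp add: sum_distrib_left sum_subtractf[symmetric] algebra_simps)
    also have "(\<Sum>z\<in>?X. u z * of_bool (Q z)) = pr V P - f * real a"
      unfolding u_def prP ae[symmetric] sum_distrib_left by (simp add: sum_subtractf[symmetric] algebra_simps)
    finally show ?thesis using u0 by (simp add: f_def)
  qed
  also have "\<dots> = real (card ?X) * av ?X (\<lambda>z. u z * (2 * of_bool (Q z) - 1))"
    using fX by (simp add: av_def)
  finally have "(2 * (pr V P - real a / 2 ^ card F))\<^sup>2 =
      (real (card ?X))\<^sup>2 * (av ?X (\<lambda>z. u z * (2 * of_bool (Q z) - 1)))\<^sup>2"
    by (simp add: power_mult_distrib)
  also have "\<dots> \<le> (real (card ?X))\<^sup>2 * av ?X (\<lambda>z. (u z * (2 * of_bool (Q z) - 1))\<^sup>2)"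
    by (intro mult_left_mono av_sq[OF fX(1)]) simp
  also have "av ?X (\<lambda>z. (u z * (2 * of_bool (Q z) - 1))\<^sup>2) = av ?X (\<lambda>z. (u z)\<^sup>2)"
    by (intro av_cong refl) (auto simp: power_mult_distrib)
  also have "(real (card ?X))\<^sup>2 * \<dots> = real (card ?X) * (\<Sum>z\<in>?X. (u z)\<^sup>2)"
    using fX by (simp add: av_def power2_eq_square)
  also have "\<dots> \<le> real (card ?X) * \<theta>\<^sup>2" using u2 by (intro mult_left_mono) auto
  also have "real (card ?X) = 2 ^ card F" by (simp add: fX)
  finally show ?thesis by (intro exI[of _ a])
qed

lemma third_dist: "1 / (3 * 2 ^ S) \<le> \<bar>real a / 2 ^ S - 1 / 3\<bar>"
proof -
  have "\<not> 3 dvd (2::nat) ^ S"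
  proof
    assume "3 dvd (2::nat) ^ S"
    moreover have "coprime (3::nat) (2 ^ S)" by (simp add: coprime_power_right_iff)
    ultimately show False using coprime_common_divisor[of "3::nat" "2 ^ S" 3] by simp
  qed
  then have "int (3 * a) \<noteq> 2 ^ S" by (metis dvd_triv_left of_nat_eq_iff of_nat_numeral of_nat_power)
  then have "1 \<le> \<bar>int (3 * a) - 2 ^ S\<bar>" by linarith
  then have "1 \<le> \<bar>3 * real a - 2 ^ S\<bar>"
    by (metis (mono_tags, opaque_lifting) of_int_1_le_iff of_int_abs of_int_diff of_int_of_nat_eq of_int_numeral of_int_power of_nat_mult of_nat_numeral)
  then have "1 / (3 * 2 ^ S) \<le> \<bar>3 * real a - 2 ^ S\<bar> / (3 * 2 ^ S)" by (intro divide_right_mono) auto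
  also have "\<dots> = \<bar>(3 * real a - 2 ^ S) / (3 * 2 ^ S)\<bar>" by simp
  also have "(3 * real a - 2 ^ S) / (3 * 2 ^ S) = real a / 2 ^ S - 1 / 3" by (simp add: field_simps)
  finally show ?thesis .
qed

text \<open>\<open>thr\<close> is the bias for which Parseval gives a deviation of at most 2^-S / 4
  from a multiple of 2^-S. Such a multiple is at least 2^-S / 3 away from 1/3, and 1/3 - 1/4 =
  1/12.\<close>

lemma final_estimate:
  assumes V: "elem2 V" and F: "wf_fam V F"
    and small: "unbiased V F (card F)"
    and P: "\<And>x y. x \<in> V \<Longrightarrow> y \<in> V \<Longrightarrow> \<forall>p\<in>F. ph p x = ph p y \<Longrightarrow> P x = P y"
  shows "(1/2) ^ card F / 12 \<le> \<bar>pr V P - 1 / 3\<bar>"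
proof -
  let ?S = "card F"
  have "\<exists>a::nat. (2 * (pr V P - real a / 2 ^ ?S))\<^sup>2 \<le> 2 ^ ?S * (thr ?S)\<^sup>2"
  proof (rule parseval_bound[OF V F less_imp_le[OF thr_pos]])
    show "\<bar>av V (\<lambda>x. \<Prod>p\<in>T. ph p x)\<bar> \<le> thr ?S" if "T \<subseteq> F" "T \<noteq> {}" for T
      using small that unfolding unbiased_def by (blast intro: less_imp_le)
  qed (rule P)
  then obtain a where a: "(2 * (pr V P - real a / 2 ^ ?S))\<^sup>2 \<le> 2 ^ ?S * (thr ?S)\<^sup>2" by blast
  have "2 ^ ?S * (thr ?S)\<^sup>2 = 2 powr real ?S * 2 powr (2 * (- (3 * real ?S / 2) - 1))"
    unfolding thr_def power2_eq_square by (simp add: powr_realpow flip: powr_add)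
  also have "\<dots> = 2 powr (2 * (- real ?S - 1))" by (simp add: powr_add[symmetric] algebra_simps)
  also have "\<dots> = (2 powr (- real ?S - 1))\<^sup>2" unfolding power2_eq_square by (simp add: powr_add[symmetric])
  also have "2 powr (- real ?S - 1) = (1/2) ^ ?S / 2" unfolding half_powr by (simp add: powr_diff)
  finally have "(2 * (pr V P - real a / 2 ^ ?S))\<^sup>2 \<le> ((1/2) ^ ?S / 2)\<^sup>2" using a by simp
  then have "\<bar>2 * (pr V P - real a / 2 ^ ?S)\<bar> \<le> (1/2) ^ ?S / 2" by (subst (asm) abs_le_square_iff[symmetric]) simp
  then have "2 * \<bar>pr V P - real a / 2 ^ ?S\<bar> \<le> (1/2) ^ ?S / 2" by (simp only: abs_mult abs_numeral)
  moreover have "2 * u \<le> v / 2 \<Longrightarrow> u \<le> v / 4" for u v :: real by simp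
  ultimately have 1: "\<bar>pr V P - real a / 2 ^ ?S\<bar> \<le> (1/2) ^ ?S / 4" by blast
  have "(1/2 :: real) ^ ?S / 3 = 1 / (3 * 2 ^ ?S)" by (simp add: power_one_over)
  then have "(1/2) ^ ?S / 3 \<le> \<bar>real a / 2 ^ ?S - 1 / 3\<bar>" using third_dist[of ?S a] by simp
  moreover have "\<bar>p - b\<bar> \<le> v / 4 \<Longrightarrow> v / 3 \<le> \<bar>b - 1 / 3\<bar> \<Longrightarrow> v / 12 \<le> \<bar>p - 1 / 3\<bar>" for p b v :: real
    by linarith
  ultimately show ?thesis using 1 by blast
qed

section \<open>The recursion psi and the main descent\<close>

declare psi.simps [simp del]

lemma psi_least:
  assumes "M = (x # replicate k 0) @ (Suc y # rest)"
  shows "(LEAST l. 1 \<le> l \<and> l < length M \<and> M ! l > 0) = Suc k"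
proof (rule Least_equality)
  show "1 \<le> Suc k \<and> Suc k < length M \<and> M ! Suc k > 0"
    unfolding assms by (simp add: nth_append)
  fix l assume l: "1 \<le> l \<and> l < length M \<and> M ! l > 0"
  show "Suc k \<le> l"
  proof (rule ccontr)
    assume "\<not> Suc k \<le> l"
    then have "M ! l = 0" using l unfolding assms by (cases l) (auto simp: nth_append)
    then show False using l by simp
  qed
qed

lemma psi_unfold:
  assumes "M = (x # replicate k 0) @ (Suc y # rest)"
  shows "psi f M = psi f (psi_step f M)"
proof -
  have "M ! Suc k \<noteq> 0" "Suc k < length M" unfolding assms by (simp_all add: nth_append)
  then have "\<not> (\<forall>i. 1 \<le> i \<and> i < length M \<longrightarrow> M ! i = 0)"
    by (intro notI) (drule spec[of _ "Suc k"], simp)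
  then show ?thesis by (subst psi.simps) auto
qed

lemma psi_step_0:
  "psi f ([x] @ (Suc y # rest)) = psi f ([x + f (x + Suc y + sum_list rest)] @ (y # rest))"
proof -
  have "psi_step f ([x] @ (Suc y # rest)) = [x + f (x + Suc y + sum_list rest)] @ (y # rest)"
    unfolding psi_step_def using psi_least[of "[x] @ (Suc y # rest)" x 0 y rest] by (simp add: Let_def add.assoc)
  then show ?thesis using psi_unfold[of "[x] @ (Suc y # rest)" x 0 y rest f] by simp
qed

lemma list_update_two: "length pre = k \<Longrightarrow> (pre @ (a # b # r))[k := v, Suc k := w] = pre @ (v # w # r)"
  by (auto simp: list_update_append)

lemma psi_step_Suc:
  "psi f ((x # replicate (Suc k) 0) @ (Suc y # rest)) =
   psi f ((x # replicate k 0) @ (f (x + Suc y + sum_list rest) # y # rest))"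
proof -
  let ?M = "(x # replicate (Suc k) 0) @ (Suc y # rest)"
  let ?v = "f (x + Suc y + sum_list rest)"
  have 1: "(LEAST l. 1 \<le> l \<and> l < length ?M \<and> ?M ! l > 0) = Suc (Suc k)" by (rule psi_least) simp
  have 2: "sum_list ?M = x + Suc y + sum_list rest" by (simp add: sum_list_replicate)
  have 5: "?M = (x # replicate k 0) @ (0 # Suc y # rest)"
    by (simp add: replicate_app_Cons_same)
  have 3: "?M ! Suc k = 0" unfolding 5 by (simp add: nth_append)
  have 4: "?M ! Suc (Suc k) = Suc y" unfolding 5 by (simp add: nth_append)
  have 6: "length (x # replicate k (0::nat)) = Suc k" by simp
  have "psi_step f ?M = ?M[Suc k := ?v, Suc (Suc k) := y]"
    unfolding psi_step_def Let_def 1 2 using 3 4 by simp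
  also have "\<dots> = (x # replicate k 0) @ (?v # y # rest)"
    unfolding 5 by (rule list_update_two[OF 6])
  finally show ?thesis using psi_unfold[of ?M x "Suc k" y rest f] by simp
qed

text \<open>Each step removes one unit and adds \<open>f\<close> of the sum, which is at least one;
  in the end the first entry is the sum.\<close>

lemma psi_ge_sum:
  assumes f: "\<And>k. 1 \<le> f k"
  shows "sum_list M \<le> psi f M"
  using f
proof (induction f M rule: psi.induct)
  case (1 f M)
  show ?case
  proof (cases "\<forall>i. 1 \<le> i \<and> i < length M \<longrightarrow> M ! i = 0")
    case True
    then have e: "psi f M = (if M = [] then 0 else hd M)" by (subst psi.simps) simp
    show ?thesis
    proof (cases M)
      case (Cons x xs)
      have "\<forall>y\<in>set xs. y = 0"
      proof
        fix y assume "y \<in> set xs"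
        then obtain i where "i < length xs" "xs ! i = y" by (auto simp: in_set_conv_nth)
        then show "y = 0" using True[rule_format, of "Suc i"] Cons by simp
      qed
      then have "sum_list xs = 0" by simp
      then show ?thesis using e Cons by simp
    qed simp
  next
    case False
    then have e: "psi f M = psi f (psi_step f M)" by (subst psi.simps) auto
    define l where "l = (LEAST l. 1 \<le> l \<and> l < length M \<and> M ! l > 0)"
    have ex: "\<exists>l. 1 \<le> l \<and> l < length M \<and> M ! l > 0" using False by auto
    have l: "1 \<le> l" "l < length M" "M ! l > 0"
      using LeastI_ex[OF ex] unfolding l_def by auto
    have st: "psi_step f M = M[l - 1 := M ! (l - 1) + f (sum_list M), l := M ! l - 1]"
      unfolding psi_step_def l_def Let_def by simp
    have "sum_list M \<le> sum_list (psi_step f M)"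
    proof -
      let ?A = "M[l - 1 := M ! (l - 1) + f (sum_list M)]"
      have 1: "sum_list ?A = sum_list M + f (sum_list M)"
        using l by (subst sum_list_update) (auto simp: elem_le_sum_list)
      have 2: "?A ! l = M ! l" using l by simp
      have "M ! l \<le> sum_list M" using l by (intro elem_le_sum_list) simp
      moreover have "sum_list (?A[l := M ! l - 1]) = sum_list ?A + (M ! l - 1) - ?A ! l"
        by (rule sum_list_update) (use l in simp)
      ultimately have 3: "sum_list (psi_step f M) = sum_list M + f (sum_list M) - 1"
        unfolding st 1 2 using l(3) by linarith
      show ?thesis using "1.prems"[of "sum_list M"] 3 by simp
    qed
    also have "\<dots> \<le> psi f (psi_step f M)" using 1(1)[OF False] "1.prems" by blast
    finally show ?thesis using e by simp
  qed
qed

text \<open>Lower bound for the sum of the list of psi after one unit at index \<open>Suc k\<close>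
  has been spent and the entries between it and the first are 0 again. Spending it creates at least
  \<open>fl S\<close> units one place lower, each of which is spent in turn, hence the iteration: a
  fast-growing hierarchy over \<open>fl\<close>.\<close>

fun al :: "(nat \<Rightarrow> nat) \<Rightarrow> nat \<Rightarrow> nat \<Rightarrow> nat" where
  "al fl 0 S = S - 1 + fl S"
| "al fl (Suc k) S = (al fl k ^^ fl S) (S - 1 + fl S)"

lemma funpow_mono2:
  fixes g :: "nat \<Rightarrow> nat"
  assumes "mono g" "\<And>x. x \<le> g x" "m \<le> m'" "x \<le> y"
  shows "(g ^^ m) x \<le> (g ^^ m') y"
proof -
  have "(g ^^ m) x \<le> (g ^^ m) y" by (rule funpow_mono[OF assms(1,4)])
  also have "\<dots> \<le> (g ^^ (m' - m)) ((g ^^ m) y)" by (rule funpow_ge[OF assms(2)])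
  also have "\<dots> = (g ^^ m') y" using assms(3) by (simp add: funpow_add[symmetric] flip: comp_apply[of "g ^^ (m' - m)" "g ^^ m"])
  finally show ?thesis .
qed

lemma al_props:
  assumes fl: "mono fl" "\<And>k. 1 \<le> fl k"
  shows "mono (al fl k)" "\<And>x. x \<le> al fl k x"
proof (induction k)
  case 0
  case 1 show ?case using fl(1) by (intro monoI) (auto intro!: add_mono diff_le_mono dest: monoD)
  case 2 show ?case using fl(2)[of x] by simp
next
  case (Suc k)
  case 1 show ?case
  proof (rule monoI)
    fix x y :: nat assume "x \<le> y"
    then have "fl x \<le> fl y" using fl(1) by (rule monoD[rotated])
    then show "al fl (Suc k) x \<le> al fl (Suc k) y" using \<open>x \<le> y\<close>
      unfolding al.simps by (intro funpow_mono2 Suc add_mono diff_le_mono)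
  qed
  case 2
  have "x \<le> x - 1 + fl x" using fl(2)[of x] by linarith
  also have "\<dots> \<le> (al fl k ^^ fl x) (x - 1 + fl x)" by (rule funpow_ge[OF Suc(2)])
  finally show ?case by simp
qed

text \<open>Only the sum is tracked. The function \<open>f\<close> need not be monotone, so
  estimates are made with a monotone minorant \<open>fl\<close>, for which they can be
  composed.\<close>

lemma psi_run:
  assumes fl: "mono fl" "\<And>k. 1 \<le> fl k" and ff: "\<And>k. fl k \<le> f k"
  shows "\<exists>x'. psi f ((x # replicate k 0) @ (Suc y # rest)) = psi f ((x' # replicate k 0) @ (y # rest)) \<and>
     al fl k (x + Suc y + sum_list rest) \<le> x' + y + sum_list rest"
proof (induction k arbitrary: x y rest)
  case 0
  show ?case
    using psi_step_0[of f x y rest] ff[of "x + Suc y + sum_list rest"]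
    by (intro exI[of _ "x + f (x + Suc y + sum_list rest)"]) simp
next
  case (Suc k)
  let ?S = "x + Suc y + sum_list rest"
  have run: "\<exists>x'. psi f ((x # replicate k 0) @ (m # rest)) = psi f ((x' # replicate k 0) @ (0 # rest)) \<and>
     (al fl k ^^ m) (x + m + sum_list rest) \<le> x' + sum_list rest" for m x rest
  proof (induction m arbitrary: x)
    case 0 show ?case by (intro exI[of _ x]) simp
  next
    case (Suc m)
    obtain x1 where x1: "psi f ((x # replicate k 0) @ (Suc m # rest)) = psi f ((x1 # replicate k 0) @ (m # rest))"
       "al fl k (x + Suc m + sum_list rest) \<le> x1 + m + sum_list rest" using Suc.prems \<open>\<And>y x rest. \<exists>x'. psi f ((x # replicate k 0) @ (Suc y # rest)) = psi f ((x' # replicate k 0) @ (y # rest)) \<and> al fl k (x + Suc y + sum_list rest) \<le> x' + y + sum_list rest\<close> by blast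
    obtain x2 where x2: "psi f ((x1 # replicate k 0) @ (m # rest)) = psi f ((x2 # replicate k 0) @ (0 # rest))"
       "(al fl k ^^ m) (x1 + m + sum_list rest) \<le> x2 + sum_list rest" using Suc.IH by blast
    have "(al fl k ^^ Suc m) (x + Suc m + sum_list rest) = (al fl k ^^ m) (al fl k (x + Suc m + sum_list rest))"
      by (simp add: funpow_swap1)
    also have "\<dots> \<le> (al fl k ^^ m) (x1 + m + sum_list rest)" by (rule funpow_mono[OF al_props(1)[OF fl] x1(2)])
    finally show ?case using x1(1) x2 by (intro exI[of _ x2]) simp
  qed
  obtain x' where x': "psi f ((x # replicate k 0) @ (f ?S # (y # rest))) = psi f ((x' # replicate k 0) @ (0 # (y # rest)))"
      "(al fl k ^^ f ?S) (x + f ?S + sum_list (y # rest)) \<le> x' + sum_list (y # rest)"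
    using run[of x "f ?S" "y # rest"] by blast
  have "al fl (Suc k) ?S \<le> (al fl k ^^ f ?S) (x + f ?S + sum_list (y # rest))"
    unfolding al.simps using ff[of ?S] by (intro funpow_mono2 al_props[OF fl]) auto
  also note x'(2)
  finally show ?case using x'(1) psi_step_Suc[of f x k y rest]
    by (intro exI[of _ x']) (simp add: replicate_app_Cons_same add.assoc)
qed

lemma psi_run_many:
  assumes fl: "mono fl" "\<And>k. 1 \<le> fl k" and ff: "\<And>k. fl k \<le> f k"
  shows "\<exists>x'. psi f ((x # replicate k 0) @ (m # rest)) = psi f ((x' # replicate k 0) @ (0 # rest)) \<and>
     (al fl k ^^ m) (x + m + sum_list rest) \<le> x' + sum_list rest"
proof (induction m arbitrary: x)
  case 0 show ?case by (intro exI[of _ x]) simp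
next
  case (Suc m)
  obtain x1 where x1: "psi f ((x # replicate k 0) @ (Suc m # rest)) = psi f ((x1 # replicate k 0) @ (m # rest))"
     "al fl k (x + Suc m + sum_list rest) \<le> x1 + m + sum_list rest" using psi_run[OF fl ff] by blast
  obtain x2 where x2: "psi f ((x1 # replicate k 0) @ (m # rest)) = psi f ((x2 # replicate k 0) @ (0 # rest))"
     "(al fl k ^^ m) (x1 + m + sum_list rest) \<le> x2 + sum_list rest" using Suc.IH by blast
  have "(al fl k ^^ Suc m) (x + Suc m + sum_list rest) = (al fl k ^^ m) (al fl k (x + Suc m + sum_list rest))"
    by (simp add: funpow_swap1)
  also have "\<dots> \<le> (al fl k ^^ m) (x1 + m + sum_list rest)" by (rule funpow_mono[OF al_props(1)[OF fl] x1(2)])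
  finally show ?case using x1(1) x2 by (intro exI[of _ x2]) simp
qed

lemma card_filter_pos: "finite F \<Longrightarrow> p \<in> F \<Longrightarrow> Q p \<Longrightarrow> 0 < card {p\<in>F. Q p}"
  using card_gt_0_iff[of "{p\<in>F. Q p}"] by fastforce

text \<open>The two recursions run in parallel: \<open>F\<close> is the family that represents \<open>P\<close>, and the list
  \<open>x, 0, \<dots>, 0, N', s'\<close> is the state of \<open>psi\<close>.  The flag \<open>b\<close> reserves one step of \<open>psi\<close> for
  regularizing the members of degree less than \<open>e\<close>.\<close>

lemma descent:
  fixes V :: "'v::ab_group_add set"
  assumes V: "elem2 V" and e: "2 \<le> e"
    and fl: "mono fl" "\<And>k. 1 \<le> fl k" "\<And>k. fl k \<le> f0 k" and f0: "\<And>k. f0 k \<le> f k" "\<And>k j. f0 k + j \<le> f0 (k + j)"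
    and f4: "4 \<le> f0 1"
    and h: "mono h" "\<And>S. Suc S \<le> h S" "\<And>S. h (beta e S) \<le> al fl (e - 2) (h S)"
       "\<And>Y. 4 \<le> Y \<Longrightarrow> h (Y - 1) \<le> al fl (e - 2) Y" "\<And>S. 2 \<le> S \<Longrightarrow> 2 * S \<le> al fl (e - 2) S"
    and topel: "\<And>F T p0. wf_fam V F \<Longrightarrow> \<forall>p\<in>F. lev p \<le> Suc e \<Longrightarrow> T \<subseteq> F \<Longrightarrow> p0 \<in> T \<Longrightarrow> lev p0 = Suc e \<Longrightarrow>
       thr (card F) \<le> \<bar>av V (\<lambda>x. \<Prod>p\<in>T. ph p x)\<bar> \<Longrightarrow>
       \<exists>M. wf_fam V M \<and> (\<forall>p\<in>M. lev p = e) \<and> Suc (card M) \<le> f0 (card F) \<and> refn V F (F - {p0} \<union> M)"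
    and F: "wf_fam V F" "\<forall>p\<in>F. lev p \<le> Suc e"
    and P: "\<And>x y. x \<in> V \<Longrightarrow> y \<in> V \<Longrightarrow> \<forall>p\<in>F. ph p x = ph p y \<Longrightarrow> P x = P y"
    and low: "b = 0 \<Longrightarrow> unbiased V {p\<in>F. lev p < e} (card F)"
    and s: "card {p\<in>F. lev p = Suc e} \<le> s'" and N: "card {p\<in>F. lev p = e} + b \<le> N'"
    and hF: "h (card F) \<le> x + N' + s'"
  shows "(1/2) ^ psi f ((x # replicate (e - 2) 0) @ [N', s']) / 12 \<le> \<bar>pr V P - 1 / 3\<bar>"
  using F P low s N hF
proof (induction "(s', N')" arbitrary: s' N' F x b rule: wf_induct_rule[OF wf_lex_prod[OF wf_less_than wf_less_than]])
  case (1 s' N' F x b)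
  note IH = 1(1) and F = 1(2,3) and P = 1(4) and low = 1(5) and s = 1(6) and N = 1(7) and hF = 1(8)
  have fl': "\<And>k. fl k \<le> f k" using fl(3) f0(1) order_trans by blast
  have f1: "\<And>k. 1 \<le> f k" using fl(2) fl' order_trans by blast
  have fin: "finite F" using F by (simp add: wf_fam_def)
  have refP: "P x = P y" if "refn V F F'" "x \<in> V" "y \<in> V" "\<forall>p\<in>F'. ph p x = ph p y" for F' x y
    using that P unfolding refn_def by blast
  let ?\<alpha> = "al fl (e - 2)"
  have \<alpha>: "mono ?\<alpha>" "\<And>x. x \<le> ?\<alpha> x" using al_props[OF fl(1,2)] by blast+
  let ?S = "card F"
  show ?case
  proof (cases "unbiased V F ?S")
    case True
    have "?S \<le> h ?S" using h(2)[of ?S] by simp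
    also have "\<dots> \<le> sum_list ((x # replicate (e - 2) 0) @ [N', s'])" using hF by (simp add: sum_list_replicate)
    also have "\<dots> \<le> psi f ((x # replicate (e - 2) 0) @ [N', s'])" by (rule psi_ge_sum[OF f1])
    finally have "(1/2 :: real) ^ psi f ((x # replicate (e - 2) 0) @ [N', s']) \<le> (1/2) ^ ?S"
      by (intro power_decreasing) auto
    moreover have "(1/2) ^ ?S / 12 \<le> \<bar>pr V P - 1 / 3\<bar>"
      by (rule final_estimate[OF V F(1) True]) (rule P)
    ultimately show ?thesis by linarith
  next
    case False
    then obtain T where T: "T \<subseteq> F" "T \<noteq> {}" "thr ?S \<le> \<bar>av V (\<lambda>x. \<Prod>p\<in>T. ph p x)\<bar>"
      unfolding unbiased_def by (auto simp: not_less)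
    consider (top) p0 where "p0 \<in> T" "lev p0 = Suc e"
      | (mid) p0 where "\<forall>p\<in>T. lev p \<le> e" "p0 \<in> T" "lev p0 = e"
      | (low) "\<forall>p\<in>T. lev p < e"
      using T(1) F(2) by (metis le_Suc_eq le_neq_implies_less subsetD)
    then show ?thesis
    proof cases
      case top
      obtain M where M: "wf_fam V M" "\<forall>p\<in>M. lev p = e" "Suc (card M) \<le> f0 ?S" "refn V F (F - {p0} \<union> M)"
        using topel[OF F T(1) top T(3)] by blast
      define F1 where "F1 = F - {p0} \<union> M"
      have p0: "p0 \<in> F" using T(1) top by blast
      have "0 < card {p\<in>F. lev p = Suc e}"
        using card_filter_pos[OF fin p0, of "\<lambda>p. lev p = Suc e"] top(2) by simp
      then obtain s1 where s1: "s' = Suc s1" using s by (cases s') auto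
      have wfF1: "wf_fam V F1" "\<forall>p\<in>F1. lev p \<le> Suc e" using F M(1,2) unfolding F1_def by (auto simp: wf_fam_def)
      have cF1: "card F1 \<le> ?S + f0 ?S - 2"
      proof -
        have "card F1 \<le> card (F - {p0}) + card M" unfolding F1_def by (rule card_Un_le)
        moreover have "card (F - {p0}) = ?S - 1" "?S \<noteq> 0" using p0 fin by (auto simp: card_Diff_singleton)
        ultimately show ?thesis using M(3) by linarith
      qed
      have tops: "card {p\<in>F1. lev p = Suc e} \<le> s1"
      proof -
        have "{p\<in>F1. lev p = Suc e} = {p\<in>F. lev p = Suc e} - {p0}" using M(2) by (auto simp: F1_def)
        then have "card {p\<in>F1. lev p = Suc e} = card {p\<in>F. lev p = Suc e} - 1"
          using p0 top(2) fin by (simp add: card_Diff_singleton)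
        then show ?thesis using s s1 by linarith
      qed
      have mids: "card {p\<in>F1. lev p = e} + 1 \<le> card {p\<in>F. lev p = e} + f0 ?S"
      proof -
        have "{p\<in>F1. lev p = e} \<subseteq> {p\<in>F. lev p = e} \<union> M" by (auto simp: F1_def)
        then have "card {p\<in>F1. lev p = e} \<le> card ({p\<in>F. lev p = e} \<union> M)"
          using fin M(1) by (intro card_mono) (auto simp: wf_fam_def)
        also have "\<dots> \<le> card {p\<in>F. lev p = e} + card M" by (rule card_Un_le)
        finally show ?thesis using M(3) by linarith
      qed
      \<comment> \<open>psi touches \<open>s'\<close> only when all \<open>N'\<close> units are
        gone. Spending them costs the argument nothing, since the sum only grows.\<close>
      obtain x1 where x1: "psi f ((x # replicate (e - 2) 0) @ (N' # [s'])) = psi f ((x1 # replicate (e - 2) 0) @ (0 # [s']))"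
         "(?\<alpha> ^^ N') (x + N' + s') \<le> x1 + s'"
        using psi_run_many[OF fl(1,2) fl', where x = x and k = "e - 2" and m = N' and rest = "[s']"] by auto
      define \<Sigma> where "\<Sigma> = x1 + s'"
      have \<Sigma>1: "h ?S \<le> \<Sigma>" using hF x1(2) funpow_ge[OF \<alpha>(2), of "x + N' + s'" N'] unfolding \<Sigma>_def by linarith
      \<comment> \<open>If \<open>N' = 0\<close>, there are no members of degree \<open>e\<close>.
        Otherwise spending the units at least doubles the sum, which makes room both for
        \<open>card F\<close> and for the members of degree \<open>e\<close>.\<close>
      have \<Sigma>2: "?S + card {p\<in>F. lev p = e} + 1 \<le> \<Sigma>"
      proof (cases "N' = 0")
        case True
        then show ?thesis using \<Sigma>1 h(2)[of ?S] N by simp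
      next
        case False
        have cS: "card {p\<in>F. lev p = e} \<le> ?S" "1 \<le> ?S" using fin p0 by (auto intro: card_mono simp: Suc_le_eq card_gt_0_iff)
        have "2 * (x + N' + s') \<le> ?\<alpha> (x + N' + s')"
          using h(5)[of "x + N' + s'"] hF h(2)[of ?S] cS by linarith
        also have "\<dots> = (?\<alpha> ^^ 1) (x + N' + s')" by simp
        also have "\<dots> \<le> (?\<alpha> ^^ N') (x + N' + s')" using False by (intro funpow_mono2 \<alpha>) auto
        finally have "2 * (x + N' + s') \<le> x1 + s'" using x1(2) by (rule order_trans)
        moreover have "\<lbrakk>2 * a \<le> B; H \<le> a; Suc m \<le> H; n \<le> m\<rbrakk> \<Longrightarrow> m + n + 1 \<le> B" for a B H m n :: nat by linarith
        ultimately show ?thesis using hF h(2)[of ?S] cS(1) unfolding \<Sigma>_def by blast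
      qed
      have step: "psi f ((x1 # replicate (e - 2) 0) @ (0 # [s'])) = psi f ((x1 # replicate (e - 2) 0) @ (f \<Sigma> # [s1]))"
      proof -
        show ?thesis
          using psi_step_Suc[of f x1 "e - 2" s1 "[]"] unfolding \<Sigma>_def s1
          by (simp add: replicate_app_Cons_same)
      qed
      have "1 \<le> f \<Sigma>" by (rule f1)
      then obtain m where m: "f \<Sigma> = Suc m" by (cases "f \<Sigma>") auto
      \<comment> \<open>One of the new units is spent at once, so that the sum catches up with
        \<open>h\<close> of the enlarged family.\<close>
      obtain x2 where x2: "psi f ((x1 # replicate (e - 2) 0) @ (Suc m # [s1])) = psi f ((x2 # replicate (e - 2) 0) @ (m # [s1]))"
         "?\<alpha> (x1 + Suc m + s1) \<le> x2 + m + s1"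
        using psi_run[OF fl(1,2) fl', where x = x1 and k = "e - 2" and y = m and rest = "[s1]"] by auto
      define Y where "Y = x1 + Suc m + s1"
      \<comment> \<open>Room for the old members of degree \<open>e\<close>, for the at most
        \<open>f0 ?S - 1\<close> new ones, and for two more units: the one spent at once and the one
        reserved by \<open>b = 1\<close>.\<close>
      have f0\<Sigma>: "f0 ?S + card {p\<in>F. lev p = e} + 1 \<le> f \<Sigma>"
      proof -
        have "f0 ?S + (\<Sigma> - ?S) \<le> f0 (?S + (\<Sigma> - ?S))" by (rule f0(2))
        then show ?thesis using \<Sigma>2 f0(1)[of \<Sigma>] by simp
      qed
      have SS: "1 \<le> ?S" using fin p0 by (auto simp: Suc_le_eq card_gt_0_iff)
      have Y4: "4 \<le> Y"
      proof -
        have "f0 1 + (\<Sigma> - 1) \<le> f0 (1 + (\<Sigma> - 1))" by (rule f0(2))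
        then have "4 \<le> f0 \<Sigma>" using f4 \<Sigma>2 by simp
        then show ?thesis using f0(1)[of \<Sigma>] m unfolding Y_def by linarith
      qed
      have "h (card F1) \<le> h (Y - 1)"
      proof (rule monoD[OF h(1)])
        show "card F1 \<le> Y - 1" using cF1 f0\<Sigma> \<Sigma>2 m s1 unfolding Y_def \<Sigma>_def by linarith
      qed
      also have "\<dots> \<le> ?\<alpha> Y" by (rule h(4)[OF Y4])
      finally have hF1: "h (card F1) \<le> x2 + m + s1" using x2(2) unfolding Y_def by simp
      have "(1/2) ^ psi f ((x2 # replicate (e - 2) 0) @ [m, s1]) / 12 \<le> \<bar>pr V P - 1 / 3\<bar>"
      proof (rule IH[OF _ wfF1 _ _ tops _ hF1, where b = 1])
        show "((s1, m), s', N') \<in> less_than <*lex*> less_than" using s1 by simp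
        show "P x = P y" if "x \<in> V" "y \<in> V" "\<forall>p\<in>F1. ph p x = ph p y" for x y
          using refP[OF M(4) that(1,2)] that(3) unfolding F1_def by blast
        show "card {p\<in>F1. lev p = e} + 1 \<le> m" using mids f0\<Sigma> m by linarith
      qed simp
      then show ?thesis using x1(1) step x2(1) m by simp
    next
      case mid
      have p0: "p0 \<in> F" using T(1) mid by blast
      obtain F1 where F1: "wf_fam V F1" "refn V F F1" "{p\<in>F1. e \<le> lev p} = {p\<in>F. e \<le> lev p} - {p0}"
         "card F1 \<le> beta e ?S" "unbiased V {p\<in>F1. lev p < e} (card F1)"
        using mid_elim[OF V F(1) e T(1) mid T(3)] by blast
      have lev1: "{p\<in>F1. lev p = k} = {p\<in>F. lev p = k} - {p0}" if "e \<le> k" for k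
        using F1(3) that by (auto simp: set_eq_iff)
      have "card {p\<in>F1. lev p = e} = card {p\<in>F. lev p = e} - 1"
        unfolding lev1[OF order_refl] using p0 mid(3) by (simp add: card_Diff_singleton)
      moreover have "0 < card {p\<in>F. lev p = e}"
        using card_filter_pos[OF fin p0, of "\<lambda>p. lev p = e"] mid(3) by simp
      ultimately obtain m where m: "N' = Suc m" "card {p\<in>F1. lev p = e} \<le> m" using N by (cases N') auto
      obtain x2 where x2: "psi f ((x # replicate (e - 2) 0) @ (Suc m # [s'])) = psi f ((x2 # replicate (e - 2) 0) @ (m # [s']))"
         "?\<alpha> (x + Suc m + s') \<le> x2 + m + s'"
        using psi_run[OF fl(1,2) fl', where x = x and k = "e - 2" and y = m and rest = "[s']"] by auto
      have "h (card F1) \<le> h (beta e ?S)" by (rule monoD[OF h(1) F1(4)])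
      also have "\<dots> \<le> ?\<alpha> (h ?S)" by (rule h(3))
      also have "\<dots> \<le> ?\<alpha> (x + Suc m + s')" using hF m by (intro monoD[OF \<alpha>(1)]) simp
      finally have hF1: "h (card F1) \<le> x2 + m + s'" using x2(2) by simp
      have "(1/2) ^ psi f ((x2 # replicate (e - 2) 0) @ [m, s']) / 12 \<le> \<bar>pr V P - 1 / 3\<bar>"
      proof (rule IH[OF _ F1(1) _ _ _ _ _ hF1, where b = 0])
        show "((s', m), s', N') \<in> less_than <*lex*> less_than" using m by simp
        show "\<forall>p\<in>F1. lev p \<le> Suc e"
        proof
          fix p assume p: "p \<in> F1"
          show "lev p \<le> Suc e"
          proof (cases "e \<le> lev p")
            case True
            then have "p \<in> {p\<in>F. e \<le> lev p} - {p0}" using p unfolding F1(3)[symmetric] by simp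
            then show ?thesis using F(2) by blast
          qed simp
        qed
        show "P x = P y" if "x \<in> V" "y \<in> V" "\<forall>p\<in>F1. ph p x = ph p y" for x y
          using refP[OF F1(2) that(1,2)] that(3) by blast
        show "unbiased V {p\<in>F1. lev p < e} (card F1)" by (rule F1(5))
        have "card {p\<in>F1. lev p = Suc e} \<le> card {p\<in>F. lev p = Suc e}" unfolding lev1[OF le_SucI[OF order_refl]]
          using fin by (intro card_mono) auto
        then show "card {p\<in>F1. lev p = Suc e} \<le> s'" using s by simp
        show "card {p\<in>F1. lev p = e} + 0 \<le> m" using m by simp
      qed
      then show ?thesis using x2(1) m by simp
    next
      case low
      have "\<not> unbiased V {p\<in>F. lev p < e} ?S"
      proof
        assume "unbiased V {p\<in>F. lev p < e} ?S"
        moreover have "T \<subseteq> {p\<in>F. lev p < e}" using T(1) low by blast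
        ultimately show False using T(2,3) unfolding unbiased_def by (meson not_less)
      qed
      \<comment> \<open>A bias among the low members alone arises only right after a move at top
        degree, and that move has reserved a unit.\<close>
      then have "b \<noteq> 0" using 1(5) by blast
      then obtain m where m: "N' = Suc m" "card {p\<in>F. lev p = e} \<le> m" using N by (cases N') auto
      obtain F1 where F1: "wf_fam V F1" "refn V F F1" "{p\<in>F1. e \<le> lev p} = {p\<in>F. e \<le> lev p}"
         "card F1 \<le> beta e ?S" "unbiased V {p\<in>F1. lev p < e} (card F1)"
        using low_elim[OF V F(1) e] by blast
      have lev1: "{p\<in>F1. lev p = k} = {p\<in>F. lev p = k}" if "e \<le> k" for k
        using F1(3) that by (auto simp: set_eq_iff)
      obtain x2 where x2: "psi f ((x # replicate (e - 2) 0) @ (Suc m # [s'])) = psi f ((x2 # replicate (e - 2) 0) @ (m # [s']))"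
         "?\<alpha> (x + Suc m + s') \<le> x2 + m + s'"
        using psi_run[OF fl(1,2) fl', where x = x and k = "e - 2" and y = m and rest = "[s']"] by auto
      have "h (card F1) \<le> h (beta e ?S)" by (rule monoD[OF h(1) F1(4)])
      also have "\<dots> \<le> ?\<alpha> (h ?S)" by (rule h(3))
      also have "\<dots> \<le> ?\<alpha> (x + Suc m + s')" using hF m by (intro monoD[OF \<alpha>(1)]) simp
      finally have hF1: "h (card F1) \<le> x2 + m + s'" using x2(2) by simp
      have "(1/2) ^ psi f ((x2 # replicate (e - 2) 0) @ [m, s']) / 12 \<le> \<bar>pr V P - 1 / 3\<bar>"
      proof (rule IH[OF _ F1(1) _ _ _ _ _ hF1, where b = 0])
        show "((s', m), s', N') \<in> less_than <*lex*> less_than" using m by simp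
        show "\<forall>p\<in>F1. lev p \<le> Suc e"
        proof
          fix p assume p: "p \<in> F1"
          show "lev p \<le> Suc e"
          proof (cases "e \<le> lev p")
            case True
            then have "p \<in> {p\<in>F. e \<le> lev p}" using p unfolding F1(3)[symmetric] by simp
            then show ?thesis using F(2) by blast
          qed simp
        qed
        show "P x = P y" if "x \<in> V" "y \<in> V" "\<forall>p\<in>F1. ph p x = ph p y" for x y
          using refP[OF F1(2) that(1,2)] that(3) by blast
        show "unbiased V {p\<in>F1. lev p < e} (card F1)" by (rule F1(5))
        show "card {p\<in>F1. lev p = Suc e} \<le> s'" using s by (simp add: lev1)
        show "card {p\<in>F1. lev p = e} + 0 \<le> m" using m by (simp add: lev1)
      qed
      then show ?thesis using x2(1) m by simp
    qed
  qed
qed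

section \<open>Polynomials as phases\<close>

definition vs :: "nat \<Rightarrow> (nat \<Rightarrow> bit) set" where "vs m = {x. \<forall>i\<ge>m. x i = 0}"
definition chi :: "nat set \<Rightarrow> nat \<Rightarrow> bit" where "chi S i = (if i \<in> S then 1 else 0)"
definition supp :: "(nat \<Rightarrow> bit) \<Rightarrow> nat set" where "supp x = {i. x i = 1}"
definition pz :: "(nat set \<Rightarrow> bool) \<Rightarrow> (nat \<Rightarrow> bit) \<Rightarrow> real" where "pz Q x = (if Q (supp x) then -1 else 1)"

lemma supp_chi [simp]: "supp (chi S) = S" by (auto simp: supp_def chi_def)
lemma chi_supp [simp]: "chi (supp x) = x" by (rule ext) (auto simp: supp_def chi_def)
lemma chi_in: "S \<in> points m \<Longrightarrow> chi S \<in> vs m" by (auto simp: vs_def chi_def points_def)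
lemma supp_in: "x \<in> vs m \<Longrightarrow> supp x \<in> points m" 
  by (auto simp: vs_def supp_def points_def) (metis bit_not_zero_iff leI zero_neq_one)

lemma chi_bij: "bij_betw chi (points m) (vs m)"
  by (rule bij_betwI[where g = supp]) (auto simp: chi_in supp_in)

lemma phase_pz: "phase (pz Q)" by (auto simp: phase_def pz_def)

lemma sg_vs: "elem2 (vs m)"
proof -
  have "finite (vs m)" using bij_betw_finite[OF chi_bij, of m] by (simp add: points_def)
  moreover have "x + x = 0" for x :: "nat \<Rightarrow> bit" by (rule ext) simp
  ultimately show ?thesis unfolding elem2_def by (auto simp: vs_def)
qed

lemma card_vs: "card (vs m) = 2 ^ m"
  using bij_betw_same_card[OF chi_bij, of m] by (simp add: points_def card_Pow)

lemma bias_av: "bias m Q = \<bar>av (vs m) (pz Q)\<bar>"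
proof -
  have "(\<Sum>x\<in>vs m. pz Q x) = (\<Sum>x\<in>points m. pz Q (chi x))"
    by (rule sum.reindex_bij_betw[OF chi_bij, symmetric])
  then show ?thesis unfolding bias_def av_def by (simp add: pz_def card_vs)
qed

lemma prob_pr: "prob_one m P = pr (vs m) (\<lambda>x. P (supp x))"
proof -
  have "(\<Sum>x\<in>vs m. (if P (supp x) then 1 else 0 :: real)) = (\<Sum>x\<in>points m. if P (supp (chi x)) then 1 else 0)"
    by (rule sum.reindex_bij_betw[OF chi_bij, symmetric])
  also have "\<dots> = real (card {x \<in> points m. P x})"
    by (simp add: sum.If_cases points_def Int_def Collect_conj_eq[symmetric])
  finally show ?thesis unfolding prob_one_def pr_def av_def by (simp add: card_vs of_bool_def)
qed

section \<open>Operations on phases and their effect on the degree\<close>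

lemma dg_cong: "elem2 V \<Longrightarrow> dg V e \<phi> \<Longrightarrow> (\<And>x. x \<in> V \<Longrightarrow> \<phi> x = \<psi> x) \<Longrightarrow> dg V e \<psi>"
proof (induction e arbitrary: \<phi> \<psi>)
  case 0
  then show ?case unfolding dg.simps(1) by metis
next
  case (Suc e)
  show ?case unfolding dg.simps(2)
  proof
    fix h assume h: "h \<in> V"
    have "dg V e (der h \<phi>)" using Suc.prems(2) h by simp
    then show "dg V e (der h \<psi>)" using Suc.prems(1,3) h
      by (rule_tac Suc.IH[of "der h \<phi>"]) (auto simp: der_def elem2_def)
  qed
qed

lemma dg_pull:
  assumes "\<And>x. x \<in> V \<Longrightarrow> g x \<in> W" "\<And>x y. g (x + y) = g x + g y"
  shows "dg W e \<phi> \<Longrightarrow> dg V e (\<lambda>x. \<phi> (g x))"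
proof (induction e arbitrary: \<phi>)
  case 0
  then show ?case using assms(1) unfolding dg.simps(1) by blast
next
  case (Suc e)
  have "der h (\<lambda>x. \<phi> (g x)) = (\<lambda>x. der (g h) \<phi> (g x))" for h by (rule ext) (simp add: der_def assms(2))
  then show ?case using Suc assms(1) by simp
qed

lemma dg_shift: assumes "elem2 V" "phase \<phi>" "dg V e \<phi>" "h \<in> V" shows "dg V e (\<lambda>x. \<phi> (x + h))"
proof (cases e)
  case 0
  have "\<forall>x\<in>V. \<forall>y\<in>V. \<phi> x = \<phi> y" using assms(3) unfolding 0 dg.simps(1) .
  then show ?thesis unfolding 0 dg.simps(1) using sgD(4)[OF assms(1) _ assms(4)] by blast
next
  case (Suc e')
  have "\<phi> (x + h) = \<phi> x * der h \<phi> x" for x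
    using phase_sq[OF assms(2), of x] by (simp add: der_def algebra_simps)
  moreover have "dg V e' (der h \<phi>)" using assms(3,4) unfolding Suc by simp
  then have "dg V e (der h \<phi>)" unfolding Suc by (rule dg_Suc[OF assms(1)])
  ultimately show ?thesis using dg_mult[OF assms(3), of "der h \<phi>"] by simp
qed

text \<open>This is the phase of t times the polynomial of \<open>B\<close>. Its derivative along
  \<open>h\<close> is the same construction applied to \<open>der h B\<close>, times either 1 or a
  translate of \<open>B\<close>, and both factors have degree at most \<open>e\<close>.\<close>

lemma dg_gate:
  fixes t :: "'v::ab_group_add \<Rightarrow> bit"
  assumes V: "elem2 V" and t: "\<And>x y. t (x + y) = t x + t y"
  shows "phase B \<Longrightarrow> dg V e B \<Longrightarrow> dg V (Suc e) (\<lambda>y. if t y = 0 then 1 else B y)"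
proof (induction e arbitrary: B)
  have dec: "der h (\<lambda>y. if t y = 0 then 1 else B y) =
      (\<lambda>y. (if t y = 0 then 1 else der h B y) * (if t h = 0 then 1 else B (y + h)))" if B: "phase B" for h B
    using phase_sq[OF B] by (intro ext) (auto simp: der_def t algebra_simps)
  {
    case 0
    have "dg V 0 (der h (\<lambda>y. if t y = 0 then 1 else B y))" if h: "h \<in> V" for h
    proof -
      have 1: "der h B y = 1" if "y \<in> V" for y
      proof -
        have "B (y + h) = B y" using 0(2)[unfolded dg.simps(1)] that sgD(4)[OF V that h] by blast
        then show ?thesis using phase_sq[OF 0(1), of y] by (simp add: der_def)
      qed
      have "dg V 0 (\<lambda>y. if t h = 0 then 1 else B (y + h))"
        using dg_shift[OF V 0 h] dg_const[OF V, of 0 1] by (cases "t h = 0") (simp_all only: if_True if_False not_False_eq_True refl)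
      then show ?thesis unfolding dec[OF 0(1)] by (rule dg_cong[OF V]) (simp only: 1 if_cancel mult_1)
    qed
    then show ?case unfolding dg.simps(2) by blast
  next
    case (Suc e)
    have "dg V (Suc e) (der h (\<lambda>y. if t y = 0 then 1 else B y))" if h: "h \<in> V" for h
    proof -
      have "dg V (Suc e) (\<lambda>y. if t y = 0 then 1 else der h B y)"
        using Suc.prems(2)[unfolded dg.simps(2)] h by (intro Suc.IH phase_der Suc.prems(1)) blast
      moreover have "dg V (Suc e) (\<lambda>y. if t h = 0 then 1 else B (y + h))"
        using dg_shift[OF V Suc.prems h] dg_const[OF V, of "Suc e" 1] by (cases "t h = 0") (simp_all only: if_True if_False not_False_eq_True refl)
      ultimately show ?thesis unfolding dec[OF Suc.prems(1)] by (rule dg_mult)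
    qed
    then show ?case unfolding dg.simps(2)[of V "Suc e"] by blast
  }
qed

lemma dg_monomial:
  assumes "finite S"
  shows "dg (vs m) (card S) (\<lambda>x. if S \<subseteq> supp x then -1 else 1)"
  using assms
proof (induction S)
  case empty
  show ?case using dg_const[OF sg_vs] by simp
next
  case (insert i S)
  have "(\<lambda>x. if insert i S \<subseteq> supp x then -1 else (1::real)) = (\<lambda>x. if x i = 0 then 1 else if S \<subseteq> supp x then -1 else 1)"
    by (rule ext) (auto simp: supp_def)
  moreover have "dg (vs m) (Suc (card S)) (\<lambda>x. if x i = 0 then 1 else if S \<subseteq> supp x then -1 else (1::real))"
    by (rule dg_gate[OF sg_vs _ _ insert.IH]) (auto simp: phase_def)
  ultimately show ?case using insert by simp
qed

lemma prod_sign: "finite M \<Longrightarrow> (\<Prod>S\<in>M. if R S then -1 else 1 :: real) = (if odd (card {S\<in>M. R S}) then -1 else 1)"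
proof (induction M rule: finite_induct)
  case (insert a M)
  have "{S\<in>insert a M. R S} = (if R a then insert a {S\<in>M. R S} else {S\<in>M. R S})" by auto
  then show ?case using insert by auto
qed simp

lemma poly_dg: assumes "is_poly_deg m e Q" shows "dg (vs m) e (pz Q)"
proof -
  obtain M where M: "M \<subseteq> {S. S \<subseteq> {..<m} \<and> card S \<le> e}" "\<forall>x\<in>points m. Q x = poly_eval M x"
    using assms unfolding is_poly_deg_def by blast
  have fin: "finite M" by (rule finite_subset[of _ "Pow {..<m}"]) (use M(1) in auto)
  have "dg (vs m) e (\<lambda>x. \<Prod>S\<in>M. if S \<subseteq> supp x then -1 else 1)"
  proof (rule dg_prod[OF sg_vs])
    fix S assume "S \<in> M"
    then have "finite S" "card S \<le> e" using M(1) finite_subset[of S "{..<m}"] by auto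
    then show "dg (vs m) e (\<lambda>x. if S \<subseteq> supp x then -1 else 1)" using dg_mono[OF sg_vs dg_monomial] by blast
  qed
  moreover have "(\<Prod>S\<in>M. if S \<subseteq> supp x then -1 else 1) = pz Q x" if "x \<in> vs m" for x
    unfolding prod_sign[OF fin] pz_def using M(2) supp_in[OF that] by (simp add: poly_eval_def)
  ultimately show ?thesis by (rule dg_cong[OF sg_vs])
qed

text \<open>The derivatives at 0 along sets of coordinate directions are the coefficients of the
  multilinear form, by \<open>moebius\<close>; those of order above the degree are trivial.\<close>

lemma dg_poly:
  assumes ph: "phase \<phi>" and dg: "dg (vs m) e \<phi>"
  shows "is_poly_deg m e (\<lambda>S. \<phi> (chi S) = -1)"
proof -
  define u where "u i = chi {i}" for i
  define M where "M = {S. S \<subseteq> {..<m} \<and> D \<phi> 0 u S = -1}"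
  have sumu: "sum u J = chi J" if "finite J" for J
    using that by (induction J rule: finite_induct) (auto simp: u_def chi_def fun_eq_iff)
  have uin: "u i \<in> vs m" if "i < m" for i using that by (auto simp: u_def chi_def vs_def)
  have "card S \<le> e" if "S \<in> M" for S
  proof (rule ccontr)
    assume "\<not> card S \<le> e"
    moreover have "finite S" using that finite_subset[of S "{..<m}"] by (auto simp: M_def)
    ultimately have "D \<phi> 0 u S = 1"
      using D_eq_1[OF sg_vs ph _ _ dg, of S u 0] uin that sgD(2)[OF sg_vs] by (auto simp: M_def)
    then show False using that by (simp add: M_def)
  qed
  moreover have "(\<phi> (chi J) = -1) = poly_eval M J" if J: "J \<in> points m" for J
  proof -
    have fJ: "finite J" "J \<subseteq> {..<m}" using J finite_subset by (auto simp: points_def)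
    have "\<phi> (chi J) = (\<Prod>K\<in>Pow J. D \<phi> 0 u K)" using moebius[OF ph fJ(1), of 0 u] sumu[OF fJ(1)] by simp
    also have "\<dots> = (\<Prod>K\<in>Pow J. if D \<phi> 0 u K = -1 then -1 else 1)"
      using phase_D'[OF ph] by (intro prod.cong) auto
    also have "\<dots> = (if odd (card {K\<in>Pow J. D \<phi> 0 u K = -1}) then -1 else 1)" using fJ by (intro prod_sign) simp
    also have "{K\<in>Pow J. D \<phi> 0 u K = -1} = {S\<in>M. S \<subseteq> J}" using fJ(2) by (auto simp: M_def)
    finally show ?thesis by (simp add: poly_eval_def)
  qed
  ultimately show ?thesis unfolding is_poly_deg_def by (intro exI[of _ M]) (auto simp: M_def)
qed

text \<open>Rank at most \<open>k\<close>, with the outer function replaced by a condition on pairs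
  of points. Here \<open>k = 0\<close> is allowed and means constant on \<open>V\<close>; padding
  with constant phases makes the notion monotone in \<open>k\<close>.\<close>

definition detby :: "('v::ab_group_add) set \<Rightarrow> nat \<Rightarrow> nat \<Rightarrow> ('v \<Rightarrow> real) \<Rightarrow> bool" where
  "detby V e k \<phi> \<longleftrightarrow> (\<exists>\<psi>::nat \<Rightarrow> 'v \<Rightarrow> real. (\<forall>i<k. phase (\<psi> i) \<and> dg V e (\<psi> i)) \<and>
     (\<forall>x\<in>V. \<forall>y\<in>V. (\<forall>i<k. \<psi> i x = \<psi> i y) \<longrightarrow> \<phi> x = \<phi> y))"

lemma detby_mono: assumes "detby V e k \<phi>" "k \<le> k'" "elem2 V" shows "detby V e k' \<phi>"
proof -
  obtain \<psi> where \<psi>: "\<forall>i<k. phase (\<psi> i) \<and> dg V e (\<psi> i)"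
     "\<forall>x\<in>V. \<forall>y\<in>V. (\<forall>i<k. \<psi> i x = \<psi> i y) \<longrightarrow> \<phi> x = \<phi> y" using assms(1) unfolding detby_def by blast
  have "\<forall>i<k'. phase (if i < k then \<psi> i else (\<lambda>_. 1)) \<and> dg V e (if i < k then \<psi> i else (\<lambda>_. 1))"
    using \<psi>(1) dg_const[OF assms(3), of e 1] by (auto simp: phase_def)
  moreover have "\<forall>x\<in>V. \<forall>y\<in>V. (\<forall>i<k'. (if i < k then \<psi> i else (\<lambda>_. 1)) x = (if i < k then \<psi> i else (\<lambda>_. 1)) y) \<longrightarrow> \<phi> x = \<phi> y"
  proof (intro ballI impI)
    fix x y assume xy: "x \<in> V" "y \<in> V" and eq: "\<forall>i<k'. (if i < k then \<psi> i else (\<lambda>_. 1)) x = (if i < k then \<psi> i else (\<lambda>_. 1)) y"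
    have "\<psi> i x = \<psi> i y" if "i < k" for i using eq[rule_format, of i] that assms(2) by simp
    then show "\<phi> x = \<phi> y" using \<psi>(2) xy by blast
  qed
  ultimately show ?thesis unfolding detby_def by (intro exI[of _ "\<lambda>i. if i < k then \<psi> i else (\<lambda>_. 1)"]) blast
qed

lemma rank_detby:
  assumes "rank_deg m e P = k"
    and ex: "\<exists>k>0. \<exists>Q \<Gamma>. (\<forall>i<k. is_poly_deg m e (Q i)) \<and> (\<forall>x \<in> points m. P x = \<Gamma> (map (\<lambda>i. Q i x) [0..<k]))"
  shows "detby (vs m) e k (pz P)"
proof -
  have "k > 0 \<and> (\<exists>(Q :: nat \<Rightarrow> nat set \<Rightarrow> bool) \<Gamma>. (\<forall>i<k. is_poly_deg m e (Q i)) \<and> (\<forall>x \<in> points m. P x = \<Gamma> (map (\<lambda>i. Q i x) [0..<k])))"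
    unfolding assms(1)[symmetric] rank_deg_def by (rule LeastI_ex) (use ex in blast)
  then obtain Q \<Gamma> where Q: "\<forall>i<k. is_poly_deg m e (Q i)" "\<forall>x \<in> points m. P x = \<Gamma> (map (\<lambda>i. Q i x) [0..<k])" by blast
  have "pz P x = pz P y" if xy: "x \<in> vs m" "y \<in> vs m" and eq: "\<forall>i<k. pz (Q i) x = pz (Q i) y" for x y
  proof -
    have "Q i (supp x) = Q i (supp y)" if "i < k" for i
      using eq[rule_format, OF that] by (auto simp: pz_def split: if_splits)
    then have "map (\<lambda>i. Q i (supp x)) [0..<k] = map (\<lambda>i. Q i (supp y)) [0..<k]" by auto
    then show ?thesis using Q(2) supp_in xy unfolding pz_def by metis
  qed
  then show ?thesis using Q(1) poly_dg phase_pz unfolding detby_def by (intro exI[of _ "\<lambda>i. pz (Q i)"]) blast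
qed

text \<open>The least number in \<open>rank_deg\<close> has meaning only if some decomposition
  exists; the coordinate functions give one. Using \<open>Suc m\<close> of them keeps their number
  positive when \<open>m = 0\<close>.\<close>

lemma rank_exists:
  assumes "1 \<le> e"
  shows "\<exists>k>0. \<exists>Q \<Gamma>. (\<forall>i<k. is_poly_deg m e (Q i)) \<and> (\<forall>x \<in> points m. P x = \<Gamma> (map (\<lambda>i. Q i x) [0..<k]))"
proof -
  define Q :: "nat \<Rightarrow> nat set \<Rightarrow> bool" where "Q i x \<longleftrightarrow> i < m \<and> i \<in> x" for i x
  define \<Gamma> where "\<Gamma> l = P {i. i < m \<and> l ! i}" for l :: "bool list"
  have "is_poly_deg m e (Q i)" for i
  proof -
    have "card {S \<in> (if i < m then {{i}} else {}). S \<subseteq> x} = (if i < m \<and> i \<in> x then 1 else 0)" for x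
    proof -
      have "{S \<in> (if i < m then {{i}} else {}). S \<subseteq> x} = (if i < m \<and> i \<in> x then {{i}} else {})" by auto
      then show ?thesis by simp
    qed
    then show ?thesis unfolding is_poly_deg_def
      by (intro exI[of _ "if i < m then {{i}} else {}"]) (use assms in \<open>auto simp: poly_eval_def Q_def\<close>)
  qed
  moreover have "P x = \<Gamma> (map (\<lambda>i. Q i x) [0..<Suc m])" if "x \<in> points m" for x
  proof -
    have "{i. i < m \<and> map (\<lambda>i. Q i x) [0..<Suc m] ! i} = x"
      using that by (auto simp: Q_def points_def nth_map_upt simp del: upt_Suc)
    then show ?thesis unfolding \<Gamma>_def by simp
  qed
  ultimately show ?thesis by (intro exI[of _ "Suc m"]) blast
qed

lemma KL_detby:
  assumes KL: "KL_bound c" and e: "1 \<le> e" and ph: "phase \<phi>" "dg (vs m) (Suc e) \<phi>"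
    and \<delta>: "0 < \<delta>" "\<delta> \<le> \<bar>av (vs m) \<phi>\<bar>"
  shows "detby (vs m) e (c (Suc e) \<delta>) \<phi>"
proof (cases "\<forall>x\<in>vs m. \<phi> x = 1")
  \<comment> \<open>This is the zero polynomial, about which \<open>KL_bound\<close> says
    nothing.\<close>
  case True
  then have "detby (vs m) e 0 \<phi>" by (auto simp: detby_def)
  then show ?thesis using detby_mono[OF _ _ sg_vs] by blast
next
  case False
  define Q where "Q S \<longleftrightarrow> \<phi> (chi S) = -1" for S
  have pz: "pz Q = \<phi>"
  proof
    show "pz Q x = \<phi> x" for x using ph(1) unfolding pz_def Q_def phase_def by auto
  qed
  obtain x where "x \<in> vs m" "\<phi> x \<noteq> 1" using False by blast
  then have "\<exists>x\<in>points m. Q x"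
    using supp_in[of x m] ph(1) by (intro bexI[of _ "supp x"]) (auto simp: Q_def phase_def)
  moreover have "is_poly_deg m (Suc e) Q" unfolding Q_def by (rule dg_poly[OF ph])
  moreover have "\<delta> \<le> bias m Q" using \<delta>(2) by (simp add: bias_av pz)
  ultimately have "rank_deg m e Q \<le> c (Suc e) \<delta>"
    using KL \<delta>(1) unfolding KL_bound_def by (metis diff_Suc_1 zero_less_Suc)
  moreover have "detby (vs m) e (rank_deg m e Q) (pz Q)" by (rule rank_detby[OF refl rank_exists[OF e]])
  ultimately show ?thesis using detby_mono[OF _ _ sg_vs] unfolding pz by blast
qed

section \<open>Growth of the recursion\<close>

lemma taue_le: "taue e S \<le> 3 * S + e + 10" "S + e + 9 \<le> taue e S"
  unfolding taue_def by presburger+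

lemma rho_1: "rho n (Suc 0) q X = X"
proof -
  have "((\<lambda>Y. Y) ^^ m) X = X" for m by (induction m) auto
  then show ?thesis by (simp add: yf_def)
qed

text \<open>The growth obtained for free from \<open>worst_rank\<close>: a worst rank above
  \<open>3 * k\<close> and one extra unit for the removed member.\<close>

definition fl :: "nat \<Rightarrow> nat" where "fl k = 3 * k + 2"

text \<open>For \<open>e = 2\<close> only linear members lie below \<open>e\<close> and
  \<open>rho\<close> is the identity there, so \<open>beta 2 S\<close> is at most 4 * S + 13. The
  offset 4 in the measure S + 4 balances this against \<open>al fl 0\<close>, which is about
  multiplication by 4.\<close>

lemma growth_2:
  "S + 4 \<le> al fl 0 (S + 4)" "beta 2 S + 4 \<le> al fl 0 (S + 4)"
  "4 \<le> Y \<Longrightarrow> (Y - 1) + 4 \<le> al fl 0 Y" "2 \<le> S \<Longrightarrow> 2 * S \<le> al fl 0 S"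
proof -
  have e: "(2::nat) - 1 = Suc 0" by simp
  have "beta 2 S = S + (taue 2 S + 1)" unfolding beta_def Let_def e rho_1 by simp
  then show "beta 2 S + 4 \<le> al fl 0 (S + 4)" using taue_le(1)[of 2 S] by (simp add: fl_def)
qed (auto simp: fl_def)

lemma fl: "mono fl" "1 \<le> fl k" "k \<le> fl k"
  unfolding fl_def by (auto intro!: monoI)

section \<open>Comparing regularization with the fast-growing hierarchy\<close>

abbreviation A4 :: "nat \<Rightarrow> nat \<Rightarrow> nat" where "A4 \<equiv> al fl"

lemma A4_mono: "mono (A4 k)" and A4_ge: "x \<le> A4 k x"
  using al_props[OF fl(1,2)] by blast+

lemma A4_0: "4 * S \<le> A4 0 S"
  by (simp add: fl_def)

lemma A4_Suc_ge: "A4 k (A4 k S) \<le> A4 (Suc k) S"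
proof -
  have "2 \<le> fl S" by (simp add: fl_def)
  moreover have "S \<le> S - 1 + fl S" using fl(2)[of S] by linarith
  ultimately have "(A4 k ^^ 2) S \<le> (A4 k ^^ fl S) (S - 1 + fl S)"
    by (intro funpow_mono2 A4_mono A4_ge)
  then show ?thesis by (simp add: numeral_2_eq_2)
qed

lemma A4_4: "4 * S \<le> A4 k S"
proof (induction k arbitrary: S)
  case 0 then show ?case by (rule A4_0)
next
  case (Suc k)
  have "4 * S \<le> A4 k S" by (rule Suc)
  also have "\<dots> \<le> A4 k (A4 k S)" by (rule A4_ge)
  finally show ?case using A4_Suc_ge order_trans by blast
qed

lemma A4_pow4: "4 ^ m * x \<le> (A4 k ^^ m) x"
proof (induction m)
  case (Suc m)
  have "4 ^ Suc m * x \<le> 4 * (A4 k ^^ m) x" using Suc by simp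
  also have "\<dots> \<le> A4 k ((A4 k ^^ m) x)" by (rule A4_4)
  finally show ?case by simp
qed simp

lemma A4_pow2: "2 ^ m * x \<le> (A4 k ^^ m) x"
proof -
  have "2 ^ m * x \<le> 4 ^ m * x" by (intro mult_right_mono power_mono) auto
  then show ?thesis using A4_pow4 order_trans by blast
qed

lemma A4_iter: "(A4 k ^^ S) S \<le> A4 (Suc k) S"
proof -
  have "S \<le> S - 1 + fl S" using fl(2)[of S] by linarith
  then show ?thesis unfolding al.simps by (intro funpow_mono2 A4_mono A4_ge fl(3))
qed

lemma A4_exp: "2 ^ S \<le> A4 (Suc k) S"
proof (cases "S = 0")
  case True
  then show ?thesis using A4_pow2[of 2 2 k] by (simp add: fl_def numeral_2_eq_2)
next
  case False
  then have "(2::nat) ^ S \<le> 2 ^ S * S" by simp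
  also have "\<dots> \<le> (A4 k ^^ S) S" by (rule A4_pow2)
  finally show ?thesis using A4_iter order_trans by blast
qed

text \<open>The number of inner rounds is a power of \<open>X\<close> with exponent below
  \<open>e\<close>. Its logarithm is at most linear in \<open>X\<close> with a factor polynomial in
  \<open>e\<close>, and multiplication by 2^(3 * e + 8) exceeds that factor.\<close>

lemma large_exponent:
  assumes e: "3 \<le> e" and j: "j + 2 \<le> e" and X: "1 \<le> X" and W: "2 ^ (3 * e + 8) * X \<le> W"
  shows "(3 * e + 11) * ((j + 1) * (2 ^ (3 * e + 3 + 2 * j + 6) * X) ^ j + 1) \<le> 2 ^ W"
proof -
  have "(2 ^ (3 * e + 3 + 2 * j + 6) * X) ^ j \<le> (2 ^ (5 * e + 5) * X) ^ j"
    using j by (intro power_mono mult_right_mono power_increasing) auto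
  also have "\<dots> \<le> (2 ^ (5 * e + 5) * X) ^ e" using j X by (intro power_increasing) auto
  also have "\<dots> \<le> (2 ^ (5 * e + 5) * 2 ^ X) ^ e"
    using less_exp[of X] by (intro power_mono mult_left_mono) auto
  also have "\<dots> = 2 ^ ((5 * e + 5 + X) * e)" by (simp add: power_add power_mult)
  finally have Y: "(2 ^ (3 * e + 3 + 2 * j + 6) * X) ^ j \<le> 2 ^ ((5 * e + 5 + X) * e)" .
  have "(j + 1) * (2 ^ (3 * e + 3 + 2 * j + 6) * X) ^ j + 1 \<le> e * 2 ^ ((5 * e + 5 + X) * e)"
  proof -
    have "(j + 1) * (2 ^ (3 * e + 3 + 2 * j + 6) * X) ^ j \<le> (e - 1) * 2 ^ ((5 * e + 5 + X) * e)"
      using Y j by (intro mult_mono) auto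
    moreover have "e * 2 ^ ((5 * e + 5 + X) * e) = (e - 1) * 2 ^ ((5 * e + 5 + X) * e) + 2 ^ ((5 * e + 5 + X) * e)"
      using e by (cases e) auto
    moreover have "1 \<le> (2::nat) ^ ((5 * e + 5 + X) * e)" by simp
    ultimately show ?thesis by linarith
  qed
  then have "(3 * e + 11) * ((j + 1) * (2 ^ (3 * e + 3 + 2 * j + 6) * X) ^ j + 1) \<le>
     (3 * e + 11) * (e * 2 ^ ((5 * e + 5 + X) * e))" by (rule mult_left_mono) simp
  also have "\<dots> \<le> 2 ^ (3 * e + 11) * (2 ^ e * 2 ^ ((5 * e + 5 + X) * e))"
    using less_exp[of "3 * e + 11"] less_exp[of e] by (intro mult_mono) auto
  also have "\<dots> = 2 ^ (3 * e + 11 + (e + (5 * e + 5 + X) * e))" by (simp only: power_add)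
  also have "\<dots> \<le> 2 ^ W"
  proof (rule power_increasing)
    have "e * e \<le> 2 ^ (2 * e)"
    proof -
      have "e * e \<le> 2 ^ e * 2 ^ e" using less_exp[of e] by (intro mult_mono) auto
      then show ?thesis by (simp add: mult_2 power_add)
    qed
    have e3: "e \<le> e * e" using e by simp
    have "3 * e + 11 + (e + (5 * e + 5 + X) * e) = 9 * e + 11 + 5 * (e * e) + X * e" by (simp add: algebra_simps)
    also have "\<dots> \<le> 26 * (e * e) * X"
    proof -
      have "X * e \<le> (e * e) * X" using mult_left_mono[OF e3, of X] by (simp add: mult.commute)
      moreover have "11 \<le> 11 * (e * e)" using e by simp
      then have "9 * e + 11 + 5 * (e * e) \<le> 25 * (e * e)" using e3 by linarith
      moreover have "25 * (e * e) * 1 \<le> 25 * (e * e) * X" using X by (rule mult_left_mono) simp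
      moreover have "26 * (e * e) * X = 25 * (e * e) * X + (e * e) * X" by (simp add: algebra_simps)
      ultimately show ?thesis by linarith
    qed
    also have "\<dots> \<le> 2 ^ 8 * 2 ^ (3 * e) * X"
    proof -
      have "26 * (e * e) \<le> 2 ^ 8 * 2 ^ (3 * e)"
        using order_trans[OF \<open>e * e \<le> 2 ^ (2 * e)\<close> power_increasing[of "2 * e" "3 * e" "2::nat"]] by (intro mult_mono) auto
      then show ?thesis by (rule mult_right_mono) simp
    qed
    also have "\<dots> = 2 ^ (3 * e + 8) * X" by (simp add: power_add)
    finally show "3 * e + 11 + (e + (5 * e + 5 + X) * e) \<le> W" using W by linarith
  qed simp
  finally show ?thesis .
qed

lemma A4_iter_le:
  assumes g: "\<And>y. 1 \<le> y \<Longrightarrow> g y \<le> (A4 j ^^ C) y" "\<And>y::nat. y \<le> g y" and y: "1 \<le> y"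
  shows "(g ^^ m) y \<le> (A4 j ^^ (C * m)) y"
proof (induction m)
  case (Suc m)
  have "1 \<le> (g ^^ m) y" using funpow_ge[of g y m] g(2) y by (meson order_trans)
  then have "g ((g ^^ m) y) \<le> (A4 j ^^ C) ((g ^^ m) y)" by (rule g(1))
  also have "\<dots> \<le> (A4 j ^^ C) ((A4 j ^^ (C * m)) y)" using Suc.IH by (intro funpow_mono A4_mono)
  also have "\<dots> = (A4 j ^^ (C * Suc m)) y" by (simp add: funpow_add)
  finally show ?case by simp
qed simp

text \<open>One round at a given degree is an iteration of the rounds one degree lower, and
  \<open>A4 (Suc j)\<close> iterates \<open>A4 j\<close> as often as its argument says. A number of
  applications that depends on \<open>e\<close> only therefore suffices at every degree.\<close>

lemma rho_growth:
  assumes e: "3 \<le> e"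
  shows "j + 3 \<le> e \<Longrightarrow> 1 \<le> X \<Longrightarrow>
    rho (3 * e + 3) (Suc j) (yf (3 * e + 3) (Suc (Suc j)) X) (yf (3 * e + 3) (Suc (Suc j)) X) \<le> (A4 j ^^ (3 * e + 11)) X"
proof (induction j arbitrary: X)
  case 0
  have "yf (3 * e + 3) 2 X = 2 ^ (3 * e + 11) * X" by (simp add: yf_def)
  then show ?case unfolding rho_1 numeral_2_eq_2[symmetric] by (simp only: A4_pow2)
next
  case (Suc j)
  let ?n = "3 * e + 3" and ?C = "3 * e + 11"
  let ?g = "\<lambda>Y. rho ?n (Suc j) (yf ?n (Suc (Suc j)) Y) (yf ?n (Suc (Suc j)) Y)"
  define Y where "Y = yf ?n (Suc (Suc (Suc j))) X"
  have Ye: "Y = (2 ^ (?n + 2 * (j + 2) + 6) * X) ^ (j + 2)" unfolding Y_def by (simp add: yf_def algebra_simps)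
  have XY: "1 \<le> Y" using Suc.prems(2) unfolding Ye by simp
  have "rho ?n (Suc (Suc j)) Y Y = (?g ^^ ((j + 3) * Y + 1)) Y"
  proof -
    have "Suc j + 2 = j + 3" by simp
    then show ?thesis unfolding rho.simps(2)[of ?n "Suc j"] by (simp only:)
  qed
  also have "\<dots> \<le> (A4 j ^^ (?C * ((j + 3) * Y + 1))) Y" using XY Suc.prems(1)
    by (intro A4_iter_le Suc.IH order_trans[OF yf_ge rho_ge]) auto
  also have "\<dots> \<le> (A4 (Suc j) ^^ ?C) X"
  proof -
    \<comment> \<open>The count 3 * e + 11 is spent as follows: 3 * e + 8 applications reach
      \<open>W\<close>, two more exceed 2^\<open>W\<close> and hence the number of inner rounds, and
      the last one performs these rounds.\<close>
    define W where "W = (A4 (Suc j) ^^ (3 * e + 8)) X"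
    define Z where "Z = A4 (Suc j) (A4 (Suc j) W)"
    have W: "2 ^ (3 * e + 8) * X \<le> W" unfolding W_def by (rule A4_pow2)
    have "?C * ((j + 3) * Y + 1) \<le> 2 ^ W"
      using large_exponent[OF e _ Suc.prems(2) W, of "j + 2"] Suc.prems(1) unfolding Ye by (simp add: algebra_simps)
    also have "\<dots> \<le> Z" unfolding Z_def using A4_exp A4_ge order_trans by blast
    finally have Z: "?C * ((j + 3) * Y + 1) \<le> Z" .
    have YZ: "Y \<le> Z"
    proof -
      have "Y \<le> 1 * ((j + 3) * Y)" by simp
      also have "\<dots> \<le> ?C * ((j + 3) * Y + 1)" by (intro mult_mono) auto
      finally show ?thesis using Z by simp
    qed
    have "(A4 j ^^ (?C * ((j + 3) * Y + 1))) Y \<le> (A4 j ^^ Z) Z" by (intro funpow_mono2 A4_mono A4_ge Z YZ)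
    also have "\<dots> \<le> A4 (Suc j) Z" by (rule A4_iter)
    also have "\<dots> = (A4 (Suc j) ^^ ?C) X"
    proof -
      have C: "?C = 3 + (3 * e + 8)" by simp
      have "(A4 (Suc j) ^^ 3) W = A4 (Suc j) Z" unfolding Z_def by (simp only: numeral_3_eq_3 funpow.simps comp_apply id_apply)
      moreover have "(A4 (Suc j) ^^ (3 + (3 * e + 8))) X = (A4 (Suc j) ^^ 3) W"
        unfolding W_def by (simp only: funpow_add[of 3 "3 * e + 8"] comp_apply)
      ultimately show ?thesis by (simp only: C)
    qed
    finally show ?thesis .
  qed
  finally show ?case unfolding Y_def .
qed

lemma cube_le: "3 \<le> e \<Longrightarrow> e ^ 3 \<le> (4::nat) ^ e"
proof (induction e rule: dec_induct)
  case (step e)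
  have "Suc e ^ 3 \<le> 4 * e ^ 3"
  proof -
    have "3 * e \<le> e * e" using step(1) by (rule mult_right_mono) simp
    moreover have "3 * (e * e) \<le> e * (e * e)" using step(1) by (rule mult_right_mono) simp
    moreover have "Suc e ^ 3 = e * (e * e) + 3 * (e * e) + 3 * e + 1" "e ^ 3 = e * (e * e)"
      by (simp_all add: power3_eq_cube algebra_simps)
    ultimately show ?thesis using step(1) by linarith
  qed
  then show ?case using step by simp
qed simp

text \<open>Linear in \<open>S\<close>, with a factor large enough that \<open>fl\<close> of it
  exceeds the number of applications of the previous hierarchy level needed to reach
  \<open>beta\<close>; this is the content of \<open>growth_exponent\<close>.\<close>

definition size_bound :: "nat \<Rightarrow> nat \<Rightarrow> nat" where "size_bound e S = 40 * e ^ 3 * (S + 1)"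

lemma growth_start:
  assumes "3 \<le> e"
  shows "S + (taue e S + 1) ^ (e - 1) + (4 * (3 * e + 3) + 9) \<le> 4 ^ ((taue e S + 1) * e + 12 * e + 22 + S)"
proof -
  define t where "t = taue e S"
  define w where "w = (t + 1) * e + 12 * e + 21 + S"
  have "S < 2 ^ w" by (rule less_le_trans[OF less_exp]) (auto simp: w_def intro!: power_increasing)
  moreover have "(t + 1) ^ (e - 1) \<le> 2 ^ w"
  proof -
    have "(t + 1) ^ (e - 1) \<le> (2 ^ (t + 1)) ^ (e - 1)" using less_exp[of "t + 1"] by (intro power_mono) auto
    also have "\<dots> = 2 ^ ((t + 1) * (e - 1))" by (rule power_mult[symmetric])
    also have "\<dots> \<le> 2 ^ w" unfolding w_def by (intro power_increasing trans_le_add1 mult_le_mono2) auto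
    finally show ?thesis .
  qed
  moreover have "12 * e + 21 < 2 ^ w" by (rule less_le_trans[OF less_exp]) (auto simp: w_def intro!: power_increasing)
  ultimately have "S + (t + 1) ^ (e - 1) + (12 * e + 21) \<le> 4 * 2 ^ w" by linarith
  also have "\<dots> \<le> 4 * 4 ^ w" by (intro mult_left_mono power_mono) auto
  also have "\<dots> = 4 ^ ((t + 1) * e + 12 * e + 22 + S)" unfolding w_def by (simp add: power_add)
  finally show ?thesis unfolding t_def by simp
qed

lemma growth_exponent:
  assumes e: "3 \<le> e"
  shows "(e + 5) + ((3 * e + 11) * (e * (S + taue e S) + 1) + ((taue e S + 1) * e + 12 * e + 22 + S)) \<le> fl (size_bound e S)"
proof -
  define t where "t = taue e S"
  define E where "E = e ^ 3"
  have t: "t \<le> 3 * S + e + 10" using taue_le(1) by (simp add: t_def)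
  have 1: "3 * e \<le> e * e" using e by (rule mult_right_mono) simp
  have 2: "3 * (e * e) \<le> E" using e mult_right_mono[of 3 e "e * e"] by (simp add: E_def power3_eq_cube mult.assoc)
  have E: "27 \<le> E" using e 1 2 by linarith
  have 3: "(3 * e + 11) * (e * (S + t) + 1) \<le> 7 * e * (e * (4 * S + 5 * e))"
  proof (rule mult_mono)
    have "e * (S + t) + 1 \<le> e * (S + t) + e" using e by simp
    also have "\<dots> = e * (S + t + 1)" by simp
    also have "\<dots> \<le> e * (4 * S + 5 * e)" using t e by (intro mult_left_mono) auto
    finally show "e * (S + t) + 1 \<le> e * (4 * S + 5 * e)" .
  qed (use e in auto)
  have 4: "7 * e * (e * (4 * S + 5 * e)) = 28 * (e * e * S) + 35 * E" by (simp add: E_def power3_eq_cube algebra_simps)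
  have 5: "(t + 1) * e \<le> (3 * S + e + 11) * e" using t by (intro mult_right_mono) auto
  have 6: "(3 * S + e + 11) * e = 3 * (e * S) + e * e + 11 * e" by (simp add: algebra_simps)
  have 7: "e * e * S \<le> E * S" "e * S \<le> E * S" "S \<le> E * S"
  proof -
    have "e * e \<le> E" "e \<le> E" "1 \<le> E" using 1 2 E e by linarith+
    then show "e * e * S \<le> E * S" "e * S \<le> E * S" "S \<le> E * S"
      using mult_right_mono[of 1 E S] by (auto intro: mult_right_mono)
  qed
  have "fl (size_bound e S) = 120 * (E * S) + 120 * E + 2" by (simp add: fl_def size_bound_def E_def algebra_simps)
  then show ?thesis using 3 4 5 6 7 1 2 E e unfolding t_def[symmetric] by linarith
qed

text \<open>\<open>beta e S\<close> is reached from 1 by a number of applications of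
  \<open>A4 j\<close>, with \<open>e = j + 3\<close>, that is linear in \<open>S\<close>; one
  application of \<open>al fl (e - 2)\<close> performs \<open>fl (size_bound e S)\<close> of
  them.\<close>

lemma growth_ge_3:
  assumes e: "3 \<le> e"
  shows "mono (size_bound e)" "Suc S \<le> size_bound e S" "size_bound e (beta e S) \<le> al fl (e - 2) (size_bound e S)"
    "4 \<le> Y \<Longrightarrow> size_bound e (Y - 1) \<le> al fl (e - 2) Y" "2 * S \<le> al fl (e - 2) S"
proof -
  show "mono (size_bound e)" by (auto simp: size_bound_def intro!: monoI)
  have "1 \<le> 40 * e ^ 3" using e by simp
  then have "1 * (S + 1) \<le> size_bound e S" unfolding size_bound_def by (rule mult_right_mono) simp
  then show "Suc S \<le> size_bound e S" by simp
  show "2 * S \<le> al fl (e - 2) S" using A4_4[of S "e - 2"] by linarith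
  obtain j where j: "e = j + 3" using e by (metis le_Suc_ex add.commute)
  have e2: "e - 2 = Suc j" using j by simp
  define n where "n = 3 * e + 3"
  define C where "C = 3 * e + 11"
  define q where "q = S + taue e S"
  define X where "X = S + (taue e S + 1) ^ (e - 1) + (4 * n + 9)"
  define b where "b = (taue e S + 1) * e + 12 * e + 22 + S"
  have "beta e S = rho n (Suc (Suc j)) q X" unfolding beta_def Let_def n_def q_def X_def using j by simp
  also have "\<dots> = ((\<lambda>Y. rho n (Suc j) (yf n (Suc (Suc j)) Y) (yf n (Suc (Suc j)) Y)) ^^ (e * q + 1)) X"
  proof -
    have "Suc j + 2 = e" using j by simp
    then show ?thesis unfolding rho.simps(2)[of n "Suc j"] by (simp only:)
  qed
  also have "\<dots> \<le> (A4 j ^^ (C * (e * q + 1))) X"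
    unfolding n_def C_def by (intro A4_iter_le rho_growth[OF e] order_trans[OF yf_ge rho_ge]) (auto simp: j X_def)
  finally have B: "beta e S \<le> (A4 j ^^ (C * (e * q + 1))) X" .
  have "X \<le> 4 ^ b * 1" using growth_start[OF e] unfolding X_def b_def n_def by simp
  also have "\<dots> \<le> (A4 j ^^ b) 1" by (rule A4_pow4)
  finally have "(A4 j ^^ (C * (e * q + 1))) X \<le> (A4 j ^^ (C * (e * q + 1))) ((A4 j ^^ b) 1)"
    by (intro funpow_mono A4_mono)
  then have B2: "beta e S \<le> (A4 j ^^ (C * (e * q + 1) + b)) 1" using B by (simp add: funpow_add)
  have "size_bound e (beta e S) \<le> 4 ^ (e + 5) * (A4 j ^^ (C * (e * q + 1) + b)) 1"
  proof -
    let ?B = "(A4 j ^^ (C * (e * q + 1) + b)) 1"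
    have 1: "1 \<le> ?B" by (rule funpow_ge[OF A4_ge])
    have "size_bound e (beta e S) \<le> 40 * 4 ^ e * (2 * ?B)"
      unfolding size_bound_def using cube_le[OF e] B2 1 by (intro mult_mono) auto
    also have "\<dots> \<le> 4 ^ (e + 5) * ?B" by (simp add: power_add)
    finally show ?thesis .
  qed
  also have "\<dots> \<le> (A4 j ^^ (e + 5)) ((A4 j ^^ (C * (e * q + 1) + b)) 1)" by (rule A4_pow4)
  also have "\<dots> = (A4 j ^^ ((e + 5) + (C * (e * q + 1) + b))) 1" by (simp only: funpow_add comp_apply)
  also have "\<dots> \<le> (A4 j ^^ fl (size_bound e S)) (size_bound e S - 1 + fl (size_bound e S))"
  proof (intro funpow_mono2 A4_mono A4_ge)
    show "(e + 5) + (C * (e * q + 1) + b) \<le> fl (size_bound e S)"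
      using growth_exponent[OF e, of S] unfolding C_def q_def b_def .
    show "1 \<le> size_bound e S - 1 + fl (size_bound e S)" using fl(2)[of "size_bound e S"] by linarith
  qed
  finally show "size_bound e (beta e S) \<le> al fl (e - 2) (size_bound e S)" unfolding e2 by simp
  show "size_bound e (Y - 1) \<le> al fl (e - 2) Y" if Y: "4 \<le> Y"
  proof -
    have **: "4 ^ (k + 14) * Y \<le> A4 (Suc k) Y" for k
    proof -
      have "4 ^ 14 * Y \<le> (A4 0 ^^ 14) Y" by (rule A4_pow4)
      also have "\<dots> \<le> (A4 0 ^^ fl Y) (Y - 1 + fl Y)"
        using Y by (intro funpow_mono2 A4_mono A4_ge) (auto simp: fl_def)
      finally have 0: "4 ^ 14 * Y \<le> A4 (Suc 0) Y" by simp
      show ?thesis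
      proof (induction k)
        case 0 show ?case using \<open>4 ^ 14 * Y \<le> A4 (Suc 0) Y\<close> by simp
      next
        case (Suc k)
        have "4 ^ (Suc k + 14) * Y = 4 * (4 ^ (k + 14) * Y)" by (simp only: add_Suc power_Suc mult.assoc)
        also have "\<dots> \<le> 4 * A4 (Suc k) Y" using Suc by (rule mult_left_mono) simp
        also have "\<dots> \<le> A4 (Suc k) (A4 (Suc k) Y)" by (rule A4_4)
        finally show ?case using A4_Suc_ge order_trans by blast
      qed
    qed
    have "size_bound e (Y - 1) = 40 * e ^ 3 * Y" using Y by (simp add: size_bound_def)
    also have "\<dots> \<le> 4 ^ 11 * 4 ^ e * Y" using cube_le[OF e] by (intro mult_right_mono mult_mono) auto
    also have "\<dots> = 4 ^ (j + 14) * Y" using j by (simp add: power_add)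
    also have "\<dots> \<le> A4 (Suc j) Y" by (rule **)
    finally show ?thesis unfolding e2 .
  qed
qed

section \<open>Gates: forcing the rank bound to grow\<close>

definition corr_bound :: "('v::ab_group_add) set \<Rightarrow> nat \<Rightarrow> ('v \<Rightarrow> real) \<Rightarrow> real \<Rightarrow> bool" where
  "corr_bound V e \<phi> \<epsilon> \<longleftrightarrow> (\<forall>\<chi>. phase \<chi> \<longrightarrow> dg V e \<chi> \<longrightarrow> \<bar>av V (\<lambda>x. \<phi> x * \<chi> x)\<bar> \<le> \<epsilon>)"

lemma cb_nonneg: assumes "elem2 V" "corr_bound V e \<phi> \<epsilon>" shows "0 \<le> \<epsilon>"
  using assms(2)[unfolded corr_bound_def, rule_format, of "\<lambda>_. 1"] dg_const[OF assms(1), of e 1]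
  by (auto simp: phase_def)

lemma av_phase_le: assumes "elem2 V" "phase \<phi>" shows "\<bar>av V \<phi>\<bar> \<le> 1"
proof -
  have "\<bar>av V \<phi>\<bar> \<le> av V (\<lambda>x. \<bar>\<phi> x\<bar>)" by (rule av_abs)
  also have "\<dots> = 1" using assms sgD[OF assms(1)] by (simp add: av_const)
  finally show ?thesis .
qed

text \<open>The \<open>k\<close> determining phases take at most 2^\<open>k\<close> patterns, so two
  random points collide with probability at least 2^-\<open>k\<close>. On collisions the values of
  \<open>\<phi>\<close> agree, so the product of these values may be inserted; the expansion into
  characters then becomes 2^-\<open>k\<close> times a sum of 2^\<open>k\<close> squared correlations
  of \<open>\<phi>\<close> with phases of degree \<open>e\<close>.\<close>

lemma corr_detby:
  assumes V: "elem2 V" and ph: "phase \<phi>" and corr_bound: "corr_bound V e \<phi> \<epsilon>" and det: "detby V e k \<phi>"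
  shows "1 \<le> 2 ^ k * \<epsilon>\<^sup>2"
proof -
  obtain \<psi> where \<psi>: "\<And>i. i < k \<Longrightarrow> phase (\<psi> i)" "\<And>i. i < k \<Longrightarrow> dg V e (\<psi> i)"
    "\<And>x y. x \<in> V \<Longrightarrow> y \<in> V \<Longrightarrow> (\<forall>i<k. \<psi> i x = \<psi> i y) \<Longrightarrow> \<phi> x = \<phi> y" using det unfolding detby_def by blast
  have fV: "finite V" "V \<noteq> {}" using sgD[OF V] by auto
  define F where "F = {..<k}"
  let ?X = "sgn_cub F"
  define Z where "Z x i = \<psi> i x" for x and i :: nat
  define f where "f = (1 / 2 ^ k :: real)"
  have fF: "finite F" "card F = k" by (auto simp: F_def)
  have pm: "Z x p = 1 \<or> Z x p = -1" if "p \<in> F" for x p using \<psi>(1) that by (auto simp: Z_def phase_def F_def)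
  have inX: "res F (Z x) \<in> ?X" for x by (intro res_in pm)
  have fX: "finite ?X" "card ?X = 2 ^ k" using sgn_cub_fin[of F] fF by auto
  define q where "q z = pr V (\<lambda>x. res F (Z x) = z)" for z
  define b where "b A = av V (\<lambda>x. \<phi> x * (\<Prod>p\<in>A. Z x p))" for A
  have sum1: "(\<Sum>z\<in>?X. of_bool (res F (Z x) = z) * w z) = w (res F (Z x))" for x and w :: "(nat \<Rightarrow> real) \<Rightarrow> real"
    using fX(1) inX[of x] by (subst sum.remove[of _ "res F (Z x)"]) (auto intro!: sum.neutral)
  have qsum: "(\<Sum>z\<in>?X. q z * w z) = av V (\<lambda>x. w (res F (Z x)))" for w
    unfolding q_def pr_def av_cmult_right[symmetric] av_sum[symmetric] sum1 ..
  have q1: "(\<Sum>z\<in>?X. q z) = 1" using qsum[of "\<lambda>_. 1"] fV by (simp add: av_const)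
  have "0 \<le> (\<Sum>z\<in>?X. (q z - f)\<^sup>2)" by (simp add: sum_nonneg)
  also have "\<dots> = (\<Sum>z\<in>?X. (q z)\<^sup>2 - 2 * f * q z + f\<^sup>2)" by (intro sum.cong refl) (simp add: power2_diff)
  also have "\<dots> = (\<Sum>z\<in>?X. (q z)\<^sup>2) - 2 * f + (real (card ?X) * f) * f"
    by (simp add: sum.distrib sum_subtractf sum_distrib_left[symmetric] q1 power2_eq_square)
  also have "real (card ?X) * f = 1" by (simp add: fX f_def)
  finally have "f \<le> (\<Sum>z\<in>?X. (q z)\<^sup>2)" by simp
  also have "\<dots> = av V (\<lambda>x. q (res F (Z x)))" unfolding power2_eq_square by (rule qsum)
  also have "\<dots> = av V (\<lambda>x. av V (\<lambda>y. (\<Sum>A\<in>Pow F. (\<phi> x * (\<Prod>p\<in>A. Z x p)) * (\<phi> y * (\<Prod>p\<in>A. Z y p))) * f))"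
  proof (intro av_cong refl)
    fix x assume x: "x \<in> V"
    have "q (res F (Z x)) = av V (\<lambda>y. of_bool (res F (Z y) = res F (Z x)))" by (simp add: q_def pr_def)
    also have "\<dots> = av V (\<lambda>y. (\<Sum>A\<in>Pow F. (\<phi> x * (\<Prod>p\<in>A. Z x p)) * (\<phi> y * (\<Prod>p\<in>A. Z y p))) * f)"
    proof (intro av_cong refl)
      fix y assume y: "y \<in> V"
      have 1: "(\<Prod>p\<in>A. res F (Z x) p) = (\<Prod>p\<in>A. Z x p)" if "A \<in> Pow F" for A
        using that by (intro prod.cong) (auto simp: res_def)
      have 2: "of_bool (res F (Z y) = res F (Z x)) = (\<Sum>A\<in>Pow F. (\<Prod>p\<in>A. Z x p) * (\<Prod>p\<in>A. Z y p)) * f"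
        by (subst ind_expand[OF fF(1) inX pm]) (auto simp: f_def fF 1)
      \<comment> \<open>Inserting \<open>\<phi> x * \<phi> y\<close> turns the biases of the
        expansion into correlations with \<open>\<phi>\<close>.\<close>
      have 3: "of_bool (res F (Z y) = res F (Z x)) = \<phi> x * \<phi> y * (of_bool (res F (Z y) = res F (Z x)) :: real)"
      proof (cases "res F (Z y) = res F (Z x)")
        case True
        have "\<psi> i x = \<psi> i y" if "i < k" for i
          using fun_cong[OF True, of i] that by (simp add: res_def Z_def F_def)
        then have "\<phi> x = \<phi> y" using \<psi>(3) x y by blast
        then show ?thesis using phase_sq[OF ph, of y] by simp
      qed simp
      have "of_bool (res F (Z y) = res F (Z x)) = \<phi> x * \<phi> y * ((\<Sum>A\<in>Pow F. (\<Prod>p\<in>A. Z x p) * (\<Prod>p\<in>A. Z y p)) * f)"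
        by (subst 3) (simp only: 2)
      also have "\<dots> = (\<Sum>A\<in>Pow F. (\<phi> x * (\<Prod>p\<in>A. Z x p)) * (\<phi> y * (\<Prod>p\<in>A. Z y p))) * f"
        by (simp add: sum_distrib_left sum_distrib_right mult_ac)
      finally show "of_bool (res F (Z y) = res F (Z x)) = (\<Sum>A\<in>Pow F. (\<phi> x * (\<Prod>p\<in>A. Z x p)) * (\<phi> y * (\<Prod>p\<in>A. Z y p))) * f" .
    qed
    finally show "q (res F (Z x)) = av V (\<lambda>y. (\<Sum>A\<in>Pow F. (\<phi> x * (\<Prod>p\<in>A. Z x p)) * (\<phi> y * (\<Prod>p\<in>A. Z y p))) * f)" .
  qed
  also have "\<dots> = (\<Sum>A\<in>Pow F. (b A)\<^sup>2) * f"
    by (simp only: av_cmult_right av_sum av_cmult) (simp add: b_def power2_eq_square)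
  also have "\<dots> \<le> (\<Sum>A\<in>Pow F. \<epsilon>\<^sup>2) * f"
  proof (intro mult_right_mono sum_mono)
    fix A assume A: "A \<in> Pow F"
    have "\<bar>b A\<bar> \<le> \<epsilon>" unfolding b_def Z_def
      using corr_bound[unfolded corr_bound_def, rule_format, of "\<lambda>x. \<Prod>p\<in>A. \<psi> p x"] A \<psi>(1,2)
      by (auto simp: F_def intro!: phase_prod dg_prod[OF V])
    then show "(b A)\<^sup>2 \<le> \<epsilon>\<^sup>2" using power_mono[of "\<bar>b A\<bar>" \<epsilon> 2] by simp
  qed (simp add: f_def)
  also have "\<dots> = (2 ^ k * \<epsilon>\<^sup>2) * f" using fF by (simp add: card_Pow)
  finally have "1 * f \<le> (2 ^ k * \<epsilon>\<^sup>2) * f" by simp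
  then show ?thesis by (rule mult_right_le_imp_le) (simp add: f_def)
qed

lemma detby_set:
  assumes "finite I" "\<And>i. i \<in> I \<Longrightarrow> phase (\<psi> i)" "\<And>i. i \<in> I \<Longrightarrow> dg V e (\<psi> i)"
    "\<And>x y. x \<in> V \<Longrightarrow> y \<in> V \<Longrightarrow> (\<forall>i\<in>I. \<psi> i x = \<psi> i y) \<Longrightarrow> \<phi> x = \<phi> y"
  shows "detby V e (card I) \<phi>"
proof -
  obtain b where b: "bij_betw b {0..<card I} I" using ex_bij_betw_nat_finite[OF assms(1)] by blast
  have bI: "b i \<in> I" if "i < card I" for i using bij_betwE[OF b] that by auto
  have "\<phi> x = \<phi> y" if xy: "x \<in> V" "y \<in> V" and eq: "\<forall>i<card I. \<psi> (b i) x = \<psi> (b i) y" for x y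
  proof (rule assms(4)[OF xy], rule ballI)
    fix i assume "i \<in> I"
    then have "i \<in> b ` {0..<card I}" using bij_betw_imp_surj_on[OF b] by blast
    then obtain j where "j < card I" "i = b j" by auto
    then show "\<psi> i x = \<psi> i y" using eq by simp
  qed
  then show ?thesis unfolding detby_def using assms(2,3) bI by (intro exI[of _ "\<lambda>i. \<psi> (b i)"]) blast
qed

section \<open>The gate: joining two phases by a selector coordinate\<close>

definition jn :: "nat \<Rightarrow> (nat \<Rightarrow> bit) \<Rightarrow> bit \<Rightarrow> (nat \<Rightarrow> bit) \<Rightarrow> nat \<Rightarrow> bit" where
  "jn m x t w i = (if i < m then x i else if i = m then t else w (i - Suc m))"
definition prX :: "nat \<Rightarrow> (nat \<Rightarrow> bit) \<Rightarrow> nat \<Rightarrow> bit" where "prX m y i = (if i < m then y i else 0)"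
definition prW :: "nat \<Rightarrow> (nat \<Rightarrow> bit) \<Rightarrow> nat \<Rightarrow> bit" where "prW m y i = y (Suc (m + i))"

lemma jn_pr: "x \<in> vs m \<Longrightarrow> prX m (jn m x t w) = x" "prW m (jn m x t w) = w" "jn m x t w m = t"
  by (rule ext, auto simp: jn_def prX_def prW_def vs_def)+

lemma jn_in: "w \<in> vs n \<Longrightarrow> jn m x t w \<in> vs (Suc (m + n))"
  by (auto simp: vs_def jn_def)

lemma pr_in: "prX m y \<in> vs m" "y \<in> vs (Suc (m + n)) \<Longrightarrow> prW m y \<in> vs n"
  by (auto simp: vs_def prX_def prW_def)

lemma jn_add: "jn m x t w + jn m x' t' w' = jn m (x + x') (t + t') (w + w')"
  by (rule ext) (simp add: jn_def)

lemma av_jn: "av (vs (Suc (m + n))) f = (av (vs m) (\<lambda>x. av (vs n) (\<lambda>w. f (jn m x 0 w))) +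
   av (vs m) (\<lambda>x. av (vs n) (\<lambda>w. f (jn m x 1 w)))) / 2"
proof -
  let ?g = "\<lambda>(x, w, t). jn m x t w" and ?A = "vs m \<times> vs n \<times> (UNIV :: bit set)"
  have U: "(UNIV :: bit set) = {0, 1}" by (auto simp: bit_not_zero_iff)
  have b: "bij_betw ?g ?A (vs (Suc (m + n)))"
  proof (rule bij_betwI[where g = "\<lambda>y. (prX m y, prW m y, y m)"])
    show "?g \<in> ?A \<rightarrow> vs (Suc (m + n))" by (auto intro: jn_in)
    show "(\<lambda>y. (prX m y, prW m y, y m)) \<in> vs (Suc (m + n)) \<rightarrow> ?A" by (auto intro: pr_in)
    show "(\<lambda>y. (prX m y, prW m y, y m)) (?g p) = p" if "p \<in> ?A" for p using that by (auto simp: jn_pr)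
    show "?g ((\<lambda>y. (prX m y, prW m y, y m)) y) = y" for y
      by (rule ext) (auto simp: jn_def prX_def prW_def)
  qed
  have "av (vs (Suc (m + n))) f = av ?A (\<lambda>p. f (?g p))"
    unfolding av_def bij_betw_same_card[OF b] sum.reindex_bij_betw[OF b, symmetric] ..
  also have "\<dots> = av (vs m) (\<lambda>x. av (vs n) (\<lambda>w. (f (jn m x 0 w) + f (jn m x 1 w)) * (1/2)))"
    unfolding av_prod by (intro av_cong refl) (simp add: av_def U)
  finally show ?thesis unfolding av_cmult_right av_add by simp
qed

definition gate :: "nat \<Rightarrow> ((nat \<Rightarrow> bit) \<Rightarrow> real) \<Rightarrow> ((nat \<Rightarrow> bit) \<Rightarrow> real) \<Rightarrow> (nat \<Rightarrow> bit) \<Rightarrow> real" where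
  "gate m \<phi> B y = \<phi> (prX m y) * (if y m = 0 then 1 else B (prW m y))"

lemma gate_jn: "x \<in> vs m \<Longrightarrow> gate m \<phi> B (jn m x t w) = \<phi> x * (if t = 0 then 1 else B w)"
  by (simp add: gate_def jn_pr)

lemma gate_phase: "phase \<phi> \<Longrightarrow> phase B \<Longrightarrow> phase (gate m \<phi> B)"
  unfolding phase_def gate_def by (smt (verit) mult_cancel_left1 mult_minus_left mult_minus_right)

lemma gate_dg:
  assumes "phase B" "dg (vs m) (Suc e) \<phi>" "dg (vs n) e B"
  shows "dg (vs (Suc (m + n))) (Suc e) (gate m \<phi> B)"
  unfolding gate_def[abs_def]
proof (rule dg_mult)
  show "dg (vs (Suc (m + n))) (Suc e) (\<lambda>y. \<phi> (prX m y))"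
    by (rule dg_pull[OF _ _ assms(2)]) (auto simp: pr_in prX_def fun_eq_iff)
  show "dg (vs (Suc (m + n))) (Suc e) (\<lambda>y. if y m = 0 then 1 else B (prW m y))"
  proof (rule dg_gate[OF sg_vs])
    show "dg (vs (Suc (m + n))) e (\<lambda>y. B (prW m y))"
      by (rule dg_pull[OF _ _ assms(3)]) (auto simp: pr_in prW_def fun_eq_iff)
  qed (use assms(1) in \<open>auto simp: phase_def\<close>)
qed

lemma gate_av: "av (vs (Suc (m + n))) (gate m \<phi> B) = av (vs m) \<phi> * (1 + av (vs n) B) / 2"
proof -
  have "av (vs m) (\<lambda>x. av (vs n) (\<lambda>w. gate m \<phi> B (jn m x 0 w))) = av (vs m) \<phi>"
    using sgD[OF sg_vs[of n]] by (intro av_cong refl) (simp add: gate_jn av_const)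
  moreover have "av (vs m) (\<lambda>x. av (vs n) (\<lambda>w. gate m \<phi> B (jn m x 1 w))) = av (vs m) (\<lambda>x. \<phi> x * av (vs n) B)"
    by (intro av_cong refl) (simp add: gate_jn av_cmult)
  ultimately show ?thesis unfolding av_jn by (simp add: av_cmult_right algebra_simps)
qed

lemma dg_jn:
  assumes "phase R" "dg (vs (Suc (m + n))) e R"
  shows "w \<in> vs n \<Longrightarrow> dg (vs m) e (\<lambda>x. R (jn m x t w))" 
    "dg (vs n) e (\<lambda>w. R (jn m x t w))"
proof -
  have sh: "dg (vs (Suc (m + n))) e (\<lambda>y. R (y + jn m x t w))" if "w \<in> vs n" for x w
    by (rule dg_shift[OF sg_vs assms]) (use that in \<open>auto intro: jn_in\<close>)
  have z: "0 \<in> vs n" by (auto simp: vs_def)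
  show "dg (vs m) e (\<lambda>x. R (jn m x t w))" if w: "w \<in> vs n"
  proof -
    have "dg (vs m) e (\<lambda>x. R (jn m x 0 0 + jn m 0 t w))"
      by (rule dg_pull[OF _ _ sh[OF w]]) (auto simp: jn_in[OF z] jn_add)
    then show ?thesis unfolding jn_add add_0_left add_0_right .
  qed
  have "dg (vs n) e (\<lambda>w. R (jn m 0 0 w + jn m x t 0))"
    by (rule dg_pull[OF _ _ sh[OF z]]) (auto simp: jn_in jn_add)
  then show "dg (vs n) e (\<lambda>w. R (jn m x t w))" unfolding jn_add add_0_left add_0_right .
qed

text \<open>For a test phase \<open>R\<close> let \<open>f x\<close> be its average over
  \<open>w\<close> with selector 0, and \<open>g x\<close> its average against \<open>B\<close> with
  selector 1. The product \<open>f x * g x'\<close> is an average of correlations of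
  \<open>B\<close> with derivatives of \<open>R\<close>, which have one degree less, so it is at
  most \<open>\<epsilon>\<close>. Hence all values of \<open>f\<close> or all values of
  \<open>g\<close> are at most \<open>sqrt \<epsilon>\<close>; the half that is not small in this
  way is still bounded by \<open>c\<close>.\<close>

lemma gate_cb:
  assumes \<phi>: "corr_bound (vs m) (Suc e) \<phi> c" "phase \<phi>" and B: "corr_bound (vs n) e B \<epsilon>" "phase B"
  shows "corr_bound (vs (Suc (m + n))) (Suc e) (gate m \<phi> B) (c / 2 + sqrt \<epsilon> / 2)"
  unfolding corr_bound_def
proof (intro allI impI)
  fix R assume R: "phase R" "dg (vs (Suc (m + n))) (Suc e) R"
  define f where "f x = av (vs n) (\<lambda>w. R (jn m x 0 w))" for x
  define g where "g x = av (vs n) (\<lambda>w. B w * R (jn m x 1 w))" for x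
  note V = sg_vs[of m] and W = sg_vs[of n]
  have fW: "finite (vs n)" "vs n \<noteq> {}" using sgD[OF W] by auto
  have fV: "finite (vs m)" "vs m \<noteq> {}" using sgD[OF V] by auto
  have c2: "x + x = 0" for x :: "nat \<Rightarrow> bit" by (rule ext) simp
  have fg: "\<bar>f x * g x'\<bar> \<le> \<epsilon>" if x: "x \<in> vs m" "x' \<in> vs m" for x x'
  proof -
    have "f x * g x' = av (vs n) (\<lambda>w. R (jn m x 0 w) * g x')" by (simp add: f_def av_cmult_right)
    also have "\<dots> = av (vs n) (\<lambda>w. R (jn m x 0 w) * av (vs n) (\<lambda>u. B (w + u) * R (jn m x' 1 (w + u))))"
      unfolding g_def by (intro av_cong refl arg_cong2[where f = "(*)"] av_shift'[OF W, symmetric, where f = "\<lambda>w. B w * R (jn m x' 1 w)"])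
    also have "\<dots> = av (vs n) (\<lambda>w. av (vs n) (\<lambda>u. R (jn m x 0 w) * (B (w + u) * R (jn m x' 1 (w + u)))))"
      by (simp only: av_cmult)
    also have "\<dots> = av (vs n) (\<lambda>u. av (vs n) (\<lambda>w. R (jn m x 0 w) * (B (w + u) * R (jn m x' 1 (w + u)))))" by (rule av_swap)
    also have "\<dots> = av (vs n) (\<lambda>u. av (vs n) (\<lambda>w. B w * der (jn m (x + x') 1 u) R (jn m x' 1 w)))"
    proof (rule av_cong[OF refl])
      fix u assume u: "u \<in> vs n"
      have "av (vs n) (\<lambda>w. R (jn m x 0 w) * (B (w + u) * R (jn m x' 1 (w + u)))) =
         av (vs n) (\<lambda>w. R (jn m x 0 (w + u)) * (B ((w + u) + u) * R (jn m x' 1 ((w + u) + u))))"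
        by (rule av_shift[OF W u, symmetric])
      also have "\<dots> = av (vs n) (\<lambda>w. B w * der (jn m (x + x') 1 u) R (jn m x' 1 w))"
      proof (rule av_cong[OF refl])
        fix w
        have 1: "w + u + u = w" by (simp add: add.assoc c2)
        have "x' + (x + x') = x" by (rule ext) simp
        then have 2: "jn m x' 1 w + jn m (x + x') 1 u = jn m x 0 (w + u)" unfolding jn_add by simp
        show "R (jn m x 0 (w + u)) * (B ((w + u) + u) * R (jn m x' 1 ((w + u) + u))) = B w * der (jn m (x + x') 1 u) R (jn m x' 1 w)"
          unfolding 1 der_def 2 by (simp only: mult_ac)
      qed
      finally show "av (vs n) (\<lambda>w. R (jn m x 0 w) * (B (w + u) * R (jn m x' 1 (w + u)))) = av (vs n) (\<lambda>w. B w * der (jn m (x + x') 1 u) R (jn m x' 1 w))" .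
    qed
    also have "\<bar>\<dots>\<bar> \<le> av (vs n) (\<lambda>u. \<bar>av (vs n) (\<lambda>w. B w * der (jn m (x + x') 1 u) R (jn m x' 1 w))\<bar>)" by (rule av_abs)
    also have "\<dots> \<le> av (vs n) (\<lambda>u. \<epsilon>)"
    proof (rule av_mono)
      fix u assume u: "u \<in> vs n"
      have p: "phase (der (jn m (x + x') 1 u) R)" using R(1) by (rule phase_der)
      have "dg (vs (Suc (m + n))) e (der (jn m (x + x') 1 u) R)" using R(2) jn_in[OF u] unfolding dg.simps(2) by blast
      then have "dg (vs n) e (\<lambda>w. der (jn m (x + x') 1 u) R (jn m x' 1 w))" by (rule dg_jn(2)[OF p])
      moreover have "phase (\<lambda>w. der (jn m (x + x') 1 u) R (jn m x' 1 w))" using p by (simp add: phase_def)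
      ultimately show "\<bar>av (vs n) (\<lambda>w. B w * der (jn m (x + x') 1 u) R (jn m x' 1 w))\<bar> \<le> \<epsilon>" using B(1) unfolding corr_bound_def by blast
    qed
    also have "\<dots> = \<epsilon>" by (rule av_const[OF fW])
    finally show ?thesis .
  qed
  define a where "a = av (vs m) (\<lambda>x. \<phi> x * f x)"
  define b where "b = av (vs m) (\<lambda>x. \<phi> x * g x)"
  have tot: "av (vs (Suc (m + n))) (\<lambda>y. gate m \<phi> B y * R y) = (a + b) / 2"
  proof -
    have "av (vs m) (\<lambda>x. av (vs n) (\<lambda>w. gate m \<phi> B (jn m x 0 w) * R (jn m x 0 w))) = a"
      unfolding a_def f_def by (intro av_cong refl) (simp add: gate_jn av_cmult)
    moreover have "av (vs m) (\<lambda>x. av (vs n) (\<lambda>w. gate m \<phi> B (jn m x 1 w) * R (jn m x 1 w))) = b"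
      unfolding b_def g_def by (intro av_cong refl) (simp add: gate_jn av_cmult mult.assoc)
    ultimately show ?thesis unfolding av_jn by simp
  qed
  have small: "\<bar>av (vs m) (\<lambda>x. \<phi> x * F x)\<bar> \<le> s" if "\<And>x. x \<in> vs m \<Longrightarrow> \<bar>F x\<bar> \<le> s" for F s
  proof -
    have "\<bar>av (vs m) (\<lambda>x. \<phi> x * F x)\<bar> \<le> av (vs m) (\<lambda>x. \<bar>\<phi> x * F x\<bar>)" by (rule av_abs)
    also have "\<dots> \<le> av (vs m) (\<lambda>x. s)" using that \<phi>(2) by (intro av_mono) (simp add: abs_mult)
    finally show ?thesis using fV by (simp add: av_const)
  qed
  have avg: "\<bar>av (vs m) (\<lambda>x. \<phi> x * av (vs n) (\<lambda>w. H w * R (jn m x t w)))\<bar> \<le> c" if H: "phase H" for H t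
  proof -
    have "av (vs m) (\<lambda>x. \<phi> x * av (vs n) (\<lambda>w. H w * R (jn m x t w))) =
       av (vs n) (\<lambda>w. H w * av (vs m) (\<lambda>x. \<phi> x * R (jn m x t w)))"
      unfolding av_cmult[symmetric] by (subst av_swap) (intro av_cong refl, simp add: mult_ac)
    also have "\<bar>\<dots>\<bar> \<le> av (vs n) (\<lambda>w. \<bar>H w * av (vs m) (\<lambda>x. \<phi> x * R (jn m x t w))\<bar>)" by (rule av_abs)
    also have "\<dots> \<le> av (vs n) (\<lambda>w. c)"
    proof (rule av_mono)
      fix w assume w: "w \<in> vs n"
      have "dg (vs m) (Suc e) (\<lambda>x. R (jn m x t w))" by (rule dg_jn(1)[OF R w])
      moreover have "phase (\<lambda>x. R (jn m x t w))" using R(1) by (simp add: phase_def)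
      ultimately show "\<bar>H w * av (vs m) (\<lambda>x. \<phi> x * R (jn m x t w))\<bar> \<le> c" using \<phi>(1) H unfolding corr_bound_def by (simp add: abs_mult)
    qed
    finally show ?thesis using fW by (simp add: av_const)
  qed
  have a: "\<bar>a\<bar> \<le> c" using avg[of "\<lambda>_. 1" 0] by (simp add: a_def f_def phase_def)
  have b: "\<bar>b\<bar> \<le> c" using avg[OF B(2), of 1] by (simp add: b_def g_def)
  have e0: "0 \<le> \<epsilon>" by (rule cb_nonneg[OF W B(1)])
  have "\<bar>a\<bar> \<le> sqrt \<epsilon> \<or> \<bar>b\<bar> \<le> sqrt \<epsilon>"
  proof (cases "\<forall>x\<in>vs m. \<bar>f x\<bar> \<le> sqrt \<epsilon>")
    case True
    then show ?thesis using small[of f "sqrt \<epsilon>"] unfolding a_def by blast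
  next
    case False
    then obtain x where x: "x \<in> vs m" "sqrt \<epsilon> < \<bar>f x\<bar>" by auto
    have "\<bar>g y\<bar> \<le> sqrt \<epsilon>" if "y \<in> vs m" for y
    proof (rule ccontr)
      assume "\<not> \<bar>g y\<bar> \<le> sqrt \<epsilon>"
      then have "sqrt \<epsilon> * sqrt \<epsilon> < \<bar>f x\<bar> * \<bar>g y\<bar>" using x e0 by (intro mult_strict_mono') auto
      then show False using fg[OF x(1) that] e0 by (simp add: abs_mult)
    qed
    then show ?thesis using small[of g "sqrt \<epsilon>"] unfolding b_def by blast
  qed
  then show "\<bar>av (vs (Suc (m + n))) (\<lambda>y. gate m \<phi> B y * R y)\<bar> \<le> c / 2 + sqrt \<epsilon> / 2"
    unfolding tot using a b by auto
qed

text \<open>\<open>B\<close> is too complex to be determined by the relevant derivatives of the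
  \<open>\<psi> i\<close>, so there are \<open>w\<close>, \<open>w'\<close> with
  \<open>B w \<noteq> B w'\<close> at which these derivatives agree. Passing from \<open>w\<close>
  to \<open>w'\<close> then flips a fixed nonempty set of the \<open>\<psi> i\<close>, whatever the
  other coordinates are. At selector 0 this flip leaves the gate unchanged, so \<open>\<phi>\<close>
  depends on the \<open>\<psi> i\<close> only up to it, which saves one phase.\<close>

lemma gate_detby:
  assumes \<phi>: "phase \<phi>" and B: "phase B" "\<not> detby (vs n) e (k * 2 ^ Suc m) B"
    and det: "detby (vs (Suc (m + n))) (Suc e) k (gate m \<phi> B)"
  shows "1 \<le> k" "detby (vs m) (Suc e) (k - 1) \<phi>"
proof -
  let ?N = "Suc (m + n)"
  obtain \<psi> where \<psi>: "\<And>i. i < k \<Longrightarrow> phase (\<psi> i)" "\<And>i. i < k \<Longrightarrow> dg (vs ?N) (Suc e) (\<psi> i)"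
    "\<And>x y. x \<in> vs ?N \<Longrightarrow> y \<in> vs ?N \<Longrightarrow> (\<forall>i<k. \<psi> i x = \<psi> i y) \<Longrightarrow> gate m \<phi> B x = gate m \<phi> B y"
    using det unfolding detby_def by blast
  define A where "A = vs (Suc m)"
  have fA: "finite A" "card A = 2 ^ Suc m" using sgD(1)[OF sg_vs] card_vs unfolding A_def by auto
  have AN: "a \<in> vs ?N" if "a \<in> A" for a using that by (auto simp: A_def vs_def)
  \<comment> \<open>Derivatives along the directions that do not move \<open>w\<close>. There are
    2^\<open>Suc m\<close> such directions, which explains the number of phases in the hypothesis on
    \<open>B\<close>, and each derivative has degree at most \<open>e\<close>.\<close>
  define \<theta> where "\<theta> p w = der (snd p) (\<psi> (fst p)) (jn m 0 0 w)" for p :: "nat \<times> (nat \<Rightarrow> bit)" and w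
  have "\<exists>w w'. w \<in> vs n \<and> w' \<in> vs n \<and> (\<forall>p\<in>{..<k} \<times> A. \<theta> p w = \<theta> p w') \<and> B w \<noteq> B w'"
  proof (rule ccontr)
    assume no: "\<not> ?thesis"
    have "detby (vs n) e (card ({..<k} \<times> A)) B"
    proof (rule detby_set[of _ \<theta>])
      show "finite ({..<k} \<times> A)" using fA by simp
      fix p assume p: "p \<in> {..<k} \<times> A"
      have ph: "phase (der (snd p) (\<psi> (fst p)))" using p \<psi>(1) by (auto intro: phase_der)
      then show "phase (\<theta> p)" by (simp add: phase_def \<theta>_def)
      have "dg (vs ?N) e (der (snd p) (\<psi> (fst p)))" using p \<psi>(2) AN by auto
      then show "dg (vs n) e (\<theta> p)" unfolding \<theta>_def[abs_def] by (rule dg_jn(2)[OF ph])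
    qed (use no in blast)
    then show False using B(2) fA by simp
  qed
  then obtain w w' where w: "w \<in> vs n" "w' \<in> vs n" "\<And>p. p \<in> {..<k} \<times> A \<Longrightarrow> \<theta> p w = \<theta> p w'" "B w \<noteq> B w'" by blast
  have jnsplit: "jn m x t v = jn m 0 0 v + jn m x t 0" for x t v by (simp add: jn_add)
  have jA: "jn m x t 0 \<in> A" for x t by (auto simp: A_def jn_def vs_def)
  \<comment> \<open>Whether \<open>\<psi> i\<close> changes between \<open>w\<close> and
    \<open>w'\<close> does not depend on \<open>x\<close> and \<open>t\<close>.\<close>
  have same: "\<psi> i (jn m x t w) * \<psi> i (jn m 0 0 w) = \<psi> i (jn m x t w') * \<psi> i (jn m 0 0 w')" if "i < k" for i x t
    using w(3)[of "(i, jn m x t 0)"] that jA unfolding \<theta>_def der_def fst_conv snd_conv jnsplit[symmetric] by blast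
  have z: "0 \<in> vs m" by (auto simp: vs_def)
  have pm: "\<psi> i y = 1 \<or> \<psi> i y = -1" if "i < k" for i y using \<psi>(1)[OF that] by (simp add: phase_def)
  have "\<exists>j<k. \<psi> j (jn m 0 0 w) \<noteq> \<psi> j (jn m 0 0 w')"
  proof (rule ccontr)
    assume no: "\<not> ?thesis"
    have "\<psi> i (jn m 0 1 w) = \<psi> i (jn m 0 1 w')" if "i < k" for i
    proof -
      have "\<psi> i (jn m 0 0 w) = \<psi> i (jn m 0 0 w')" using no that by blast
      then show ?thesis using same[OF that, of 0 1] pm[OF that, of "jn m 0 0 w"] by auto
    qed
    then have "gate m \<phi> B (jn m 0 1 w) = gate m \<phi> B (jn m 0 1 w')" using w by (intro \<psi>(3) jn_in) auto
    then show False using w(4) \<phi> unfolding gate_jn[OF z] phase_def by (metis mult_cancel_left one_neq_zero zero_neq_neg_one)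
  qed
  then obtain j where j: "j < k" "\<psi> j (jn m 0 0 w) \<noteq> \<psi> j (jn m 0 0 w')" by blast
  then show "1 \<le> k" by simp
  define \<rho> where "\<rho> i x = \<psi> i (jn m x 0 w)" for i x
  \<comment> \<open>Invariants of the flip: a flipped phase is multiplied by the flipped phase
    \<open>\<rho> j\<close>, and \<open>\<rho> j\<close> itself is given up.\<close>
  define \<sigma> where "\<sigma> i = (if \<psi> i (jn m 0 0 w) = \<psi> i (jn m 0 0 w') then \<rho> i else (\<lambda>x. \<rho> i x * \<rho> j x))" for i
  have \<rho>: "phase (\<rho> i)" "dg (vs m) (Suc e) (\<rho> i)" if "i < k" for i
    using \<psi>(1)[OF that] dg_jn(1)[OF \<psi>(1,2)[OF that] w(1), of 0] unfolding \<rho>_def[abs_def] by (auto simp: phase_def)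
  have "detby (vs m) (Suc e) (card ({..<k} - {j})) \<phi>"
  proof (rule detby_set[of _ \<sigma>])
    fix i assume i: "i \<in> {..<k} - {j}"
    show "phase (\<sigma> i)" using i j \<rho>(1) by (auto simp: \<sigma>_def intro!: phase_mult)
    show "dg (vs m) (Suc e) (\<sigma> i)" using i j \<rho>(2) unfolding \<sigma>_def by (auto simp del: dg.simps intro!: dg_mult)
  next
    fix x y assume xy: "x \<in> vs m" "y \<in> vs m" and eq: "\<forall>i\<in>{..<k} - {j}. \<sigma> i x = \<sigma> i y"
    show "\<phi> x = \<phi> y"
    proof (cases "\<rho> j x = \<rho> j y")
      case True
      have "\<rho> i x = \<rho> i y" if i: "i < k" for i
      proof (cases "i = j")
        case False
        then have "\<sigma> i x = \<sigma> i y" using eq i by blast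
        moreover have "\<rho> j y \<noteq> 0" using pm[OF j(1)] unfolding \<rho>_def by (metis one_neq_zero zero_neq_neg_one)
        ultimately show ?thesis using True by (auto simp: \<sigma>_def split: if_splits)
      qed (use True in simp)
      then have "gate m \<phi> B (jn m x 0 w) = gate m \<phi> B (jn m y 0 w)" using w by (intro \<psi>(3) jn_in) (auto simp: \<rho>_def)
      then show ?thesis using xy by (simp add: gate_jn)
    next
      \<comment> \<open>Here \<open>x\<close> and \<open>y\<close> have opposite patterns on the
        flipped set. The flip is undone by replacing \<open>w\<close> with \<open>w'\<close> on the
        side of \<open>y\<close>.\<close>
      case False
      have "\<psi> i (jn m x 0 w) = \<psi> i (jn m y 0 w')" if i: "i < k" for i
      proof -
        note s = same[OF i, of y 0]
        show ?thesis
        proof (cases "\<psi> i (jn m 0 0 w) = \<psi> i (jn m 0 0 w')")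
          case True
          then have "i \<noteq> j" using j by blast
          then have "\<sigma> i x = \<sigma> i y" using eq i by blast
          then have "\<psi> i (jn m x 0 w) = \<psi> i (jn m y 0 w)" using True by (simp add: \<sigma>_def \<rho>_def)
          then show ?thesis using s True pm[OF i, of "jn m 0 0 w'"] by auto
        next
          case F: False
          have "\<psi> i (jn m x 0 w) = - \<psi> i (jn m y 0 w)"
          proof (cases "i = j")
            case True
            then show ?thesis using False pm[OF i, of "jn m x 0 w"] pm[OF i, of "jn m y 0 w"] by (auto simp: \<rho>_def)
          next
            case ij: False
            then have "\<sigma> i x = \<sigma> i y" using eq i by blast
            then have "\<rho> i x * \<rho> j x = \<rho> i y * \<rho> j y" using F by (simp add: \<sigma>_def)
            moreover have "\<rho> j x = - \<rho> j y" using False pm[OF j(1), of "jn m x 0 w"] pm[OF j(1), of "jn m y 0 w"] by (auto simp: \<rho>_def)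
            ultimately show ?thesis using pm[OF j(1), of "jn m y 0 w"] by (auto simp: \<rho>_def)
          qed
          moreover have "\<psi> i (jn m 0 0 w) = - \<psi> i (jn m 0 0 w')" using F pm[OF i, of "jn m 0 0 w"] pm[OF i, of "jn m 0 0 w'"] by auto
          ultimately show ?thesis using s pm[OF i, of "jn m 0 0 w'"] by auto
        qed
      qed
      then have "gate m \<phi> B (jn m x 0 w) = gate m \<phi> B (jn m y 0 w')" using w by (intro \<psi>(3) jn_in) auto
      then show ?thesis using xy by (simp add: gate_jn)
    qed
  qed simp
  then show "detby (vs m) (Suc e) (k - 1) \<phi>" using j by simp
qed

section \<open>Proof of the theorem\<close>

text \<open>Iterated gates starting from the constant 1. As \<open>B\<close> has nonnegative mean,
  each gate keeps at least half of the mean, while the correlation is halved up to an error made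
  small by the choice of \<open>B\<close>. So the correlation is hardly larger than the
  bias.\<close>

lemma tower:
  assumes good: "\<And>\<epsilon>. 0 < \<epsilon> \<Longrightarrow> \<exists>n B. phase B \<and> dg (vs n) (Suc e) B \<and> 0 \<le> av (vs n) B \<and> corr_bound (vs n) e B \<epsilon>"
    and \<epsilon>: "0 < \<epsilon>"
  shows "\<exists>m \<phi>. phase \<phi> \<and> dg (vs m) (Suc (Suc e)) \<phi> \<and> (1/2) ^ h \<le> av (vs m) \<phi> \<and> corr_bound (vs m) (Suc e) \<phi> ((1/2) ^ h + \<epsilon>)"
proof -
  obtain n B where B: "phase B" "dg (vs n) (Suc e) B" "0 \<le> av (vs n) B" "corr_bound (vs n) e B (\<epsilon>\<^sup>2)"
    using good[of "\<epsilon>\<^sup>2"] \<epsilon> by auto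
  have sq: "sqrt (\<epsilon>\<^sup>2) = \<epsilon>" using \<epsilon> by simp
  show ?thesis
  proof (induction h)
    case 0
    have "corr_bound (vs 0) (Suc e) (\<lambda>_. 1) ((1/2) ^ 0 + \<epsilon>)" unfolding corr_bound_def
    proof (intro allI impI)
      fix \<chi> :: "(nat \<Rightarrow> bit) \<Rightarrow> real" assume "phase \<chi>"
      then show "\<bar>av (vs 0) (\<lambda>x. 1 * \<chi> x)\<bar> \<le> (1/2) ^ 0 + \<epsilon>" using av_phase_le[OF sg_vs[of 0]] \<epsilon> by fastforce
    qed
    moreover have "dg (vs 0) (Suc (Suc e)) (\<lambda>_. 1 :: real)" by (rule dg_const[OF sg_vs])
    moreover have "(1/2) ^ 0 \<le> av (vs 0) (\<lambda>_. 1)" using sgD[OF sg_vs[of 0]] by (simp add: av_const)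
    moreover have "phase (\<lambda>_ :: nat \<Rightarrow> bit. 1)" by (simp add: phase_def)
    ultimately show ?case by blast
  next
    case (Suc h)
    then obtain m \<phi> where \<phi>: "phase \<phi>" "dg (vs m) (Suc (Suc e)) \<phi>" "(1/2) ^ h \<le> av (vs m) \<phi>"
      "corr_bound (vs m) (Suc e) \<phi> ((1/2) ^ h + \<epsilon>)" by blast
    have "(1/2) ^ Suc h = (1/2) ^ h * (1/2 :: real)" by simp
    moreover have "0 \<le> av (vs m) \<phi>" using \<phi>(3) zero_le_power[of "1/2 :: real" h] by linarith
    then have "(1/2) ^ h * (1/2) \<le> av (vs m) \<phi> * ((1 + av (vs n) B) / 2)" using \<phi>(3) B(3) by (intro mult_mono) auto
    ultimately have 1: "(1/2) ^ Suc h \<le> av (vs (Suc (m + n))) (gate m \<phi> B)" unfolding gate_av by simp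
    have "((1/2) ^ h + \<epsilon>) / 2 + sqrt (\<epsilon>\<^sup>2) / 2 = (1/2) ^ Suc h + \<epsilon>" unfolding sq by (simp add: field_simps)
    then have 2: "corr_bound (vs (Suc (m + n))) (Suc e) (gate m \<phi> B) ((1/2) ^ Suc h + \<epsilon>)"
      using gate_cb[OF \<phi>(4,1) B(4,1)] by simp
    show ?case using 1 2 gate_phase[OF \<phi>(1) B(1), of m] gate_dg[OF B(1) \<phi>(2) B(2)] by blast
  qed
qed

text \<open>Induction on the degree: a coordinate character is orthogonal to constants, and a high
  enough tower built from degree \<open>Suc e\<close> is nearly orthogonal to it in the next
  degree.\<close>

lemma good_exists: "0 < \<epsilon> \<Longrightarrow> \<exists>n B. phase B \<and> dg (vs n) (Suc e) B \<and> 0 \<le> av (vs n) B \<and> corr_bound (vs n) e B \<epsilon>"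
proof (induction e arbitrary: \<epsilon>)
  case 0
  define B where "B x = (if x 0 = 0 then 1 else -1 :: real)" for x :: "nat \<Rightarrow> bit"
  have ph: "phase B" by (auto simp: B_def phase_def)
  have dg: "dg (vs 1) (Suc 0) B" unfolding B_def[abs_def]
    by (rule dg_gate[OF sg_vs]) (auto simp: phase_def)
  define a where "a = chi {0}"
  have a: "a \<in> vs 1" by (auto simp: a_def chi_def vs_def)
  have z: "av (vs 1) (\<lambda>x. B x * \<chi> x) = 0" if "dg (vs 1) 0 \<chi>" for \<chi>
  proof -
    have "av (vs 1) (\<lambda>x. B x * \<chi> x) = av (vs 1) (\<lambda>x. B (x + a) * \<chi> (x + a))"
      by (rule av_shift[OF sg_vs a, symmetric])
    also have "\<dots> = av (vs 1) (\<lambda>x. (-1) * (B x * \<chi> x))"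
    proof (rule av_cong[OF refl])
      fix x assume x: "x \<in> vs 1"
      have "\<chi> (x + a) = \<chi> x" using that[unfolded dg.simps(1)] x sgD(4)[OF sg_vs x a] by blast
      moreover have "B (x + a) = - B x" by (cases "x 0") (auto simp: B_def a_def chi_def)
      ultimately show "B (x + a) * \<chi> (x + a) = (-1) * (B x * \<chi> x)" by simp
    qed
    also have "\<dots> = (-1) * av (vs 1) (\<lambda>x. B x * \<chi> x)" by (rule av_cmult)
    finally show ?thesis by simp
  qed
  have av0: "av (vs 1) B = 0" using z[OF dg_const[OF sg_vs], of 1] by simp
  have cbB: "corr_bound (vs 1) 0 B \<epsilon>" unfolding corr_bound_def
  proof (intro allI impI)
    fix \<chi> :: "(nat \<Rightarrow> bit) \<Rightarrow> real" assume "dg (vs 1) 0 \<chi>"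
    from z[OF this] show "\<bar>av (vs 1) (\<lambda>x. B x * \<chi> x)\<bar> \<le> \<epsilon>" using 0 by simp
  qed
  show ?case by (intro exI[of _ 1] exI[of _ B] conjI ph dg cbB) (simp only: av0 order_refl)
next
  case (Suc e)
  obtain h where h: "(1/2 :: real) ^ h < \<epsilon> / 2" using real_arch_pow_inv[of "\<epsilon> / 2" "1/2"] Suc.prems by auto
  obtain m \<phi> where \<phi>: "phase \<phi>" "dg (vs m) (Suc (Suc e)) \<phi>" "(1/2) ^ h \<le> av (vs m) \<phi>"
      "corr_bound (vs m) (Suc e) \<phi> ((1/2) ^ h + \<epsilon> / 2)" using tower[OF Suc.IH, of "\<epsilon> / 2" h] Suc.prems by auto
  have "corr_bound (vs m) (Suc e) \<phi> \<epsilon>" using \<phi>(4) h unfolding corr_bound_def by fastforce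
  moreover have "0 \<le> av (vs m) \<phi>" using \<phi>(3) by (rule order_trans[rotated]) simp
  ultimately show ?case using \<phi> by blast
qed

section \<open>The worst rank of a phase of given bias\<close>

definition hard :: "nat \<Rightarrow> real \<Rightarrow> nat \<Rightarrow> bool" where
  "hard e \<delta> j \<longleftrightarrow> (\<exists>m \<phi>. phase \<phi> \<and> dg (vs m) (Suc e) \<phi> \<and> \<delta> \<le> \<bar>av (vs m) \<phi>\<bar> \<and> \<not> detby (vs m) e j \<phi>)"

lemma hard_mono: "hard e \<delta> j \<Longrightarrow> \<delta>' \<le> \<delta> \<Longrightarrow> j' \<le> j \<Longrightarrow> hard e \<delta>' j'"
  unfolding hard_def using detby_mono[OF _ _ sg_vs] by (meson order_trans)

lemma hard_KL: assumes "KL_bound c" "1 \<le> e" "0 < \<delta>" "hard e \<delta> j" shows "j < c (Suc e) \<delta>"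
proof (rule ccontr)
  assume "\<not> j < c (Suc e) \<delta>"
  then show False using assms KL_detby detby_mono[OF _ _ sg_vs] unfolding hard_def by (meson not_less)
qed

lemma hard_Suc:
  assumes "1 \<le> e" "hard e \<delta> j"
  shows "hard e (\<delta> / 2) (Suc j)"
proof -
  obtain e' where e': "e = Suc e'" using assms(1) by (cases e) auto
  obtain m \<phi> where \<phi>: "phase \<phi>" "dg (vs m) (Suc e) \<phi>" "\<delta> \<le> \<bar>av (vs m) \<phi>\<bar>" "\<not> detby (vs m) e j \<phi>"
    using assms(2) unfolding hard_def by blast
  \<comment> \<open>The number of phases by which \<open>gate_detby\<close> requires
    \<open>B\<close> not to be determined; correlation 2^-\<open>K\<close> ensures this by
    \<open>corr_detby\<close>.\<close>
  define K where "K = Suc j * 2 ^ Suc m"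
  have "0 < K" by (simp add: K_def)
  then have K: "1 \<le> K" by simp
  obtain n B where B: "phase B" "dg (vs n) (Suc e') B" "0 \<le> av (vs n) B" "corr_bound (vs n) e' B ((1/2) ^ K)"
    using good_exists[of "(1/2) ^ K" e'] by auto
  have nB: "\<not> detby (vs n) e' K B"
  proof
    assume "detby (vs n) e' K B"
    then have "1 \<le> 2 ^ K * ((1/2 :: real) ^ K)\<^sup>2" by (rule corr_detby[OF sg_vs B(1,4)])
    also have "\<dots> = (1/2 :: real) ^ K" by (simp add: power2_eq_square power_one_over)
    also have "\<dots> \<le> (1/2) ^ 1" using K by (intro power_decreasing) auto
    finally show False by simp
  qed
  have "\<not> detby (vs (Suc (m + n))) e (Suc j) (gate m \<phi> B)"
    using gate_detby(2)[OF \<phi>(1) B(1) nB[unfolded K_def]] \<phi>(4) unfolding e' by auto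
  moreover have "dg (vs (Suc (m + n))) (Suc e) (gate m \<phi> B)"
    by (rule gate_dg[OF B(1) \<phi>(2)]) (use B(2) e' in simp)
  moreover have "\<delta> / 2 \<le> \<bar>av (vs (Suc (m + n))) (gate m \<phi> B)\<bar>"
  proof -
    have "\<bar>av (vs m) \<phi>\<bar> * 1 \<le> \<bar>av (vs m) \<phi>\<bar> * (1 + av (vs n) B)" using B(3) by (intro mult_left_mono) auto
    then show ?thesis using \<phi>(3) B(3) unfolding gate_av by (simp add: abs_mult)
  qed
  ultimately show ?thesis unfolding hard_def using gate_phase[OF \<phi>(1) B(1)] by blast
qed

lemma thr_Suc: "thr (Suc k) \<le> thr k / 2"
proof -
  have "thr (Suc k) = 2 powr (- (3 * real k / 2) - 1 - 3/2)" 
    unfolding thr_def by (rule arg_cong[where f = "\<lambda>z. 2 powr z"]) (simp add: field_simps)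
  also have "\<dots> \<le> 2 powr (- (3 * real k / 2) - 1 - 1)" by (intro powr_mono) auto
  also have "\<dots> = thr k / 2" unfolding thr_def by (subst powr_diff) simp
  finally show ?thesis .
qed

text \<open>A tower of height \<open>h\<close> has bias at least 2^-\<open>h\<close> and correlation
  at most 5/4 times that. The height is about 3 * k / 2, so that 2^-\<open>h\<close> is at least
  \<open>thr k\<close> while \<open>2 * h \<ge> 3 * k + 1\<close>; since 25/16 < 2,
  \<open>corr_detby\<close> forces a rank above \<open>3 * k\<close>.\<close>

lemma hard_tower:
  assumes "1 \<le> e"
  shows "hard e (thr k) (3 * k)"
proof -
  obtain e' where e': "e = Suc e'" using assms(1) by (cases e) auto
  define h where "h = (3 * k) div 2 + 1"
  have "0 < (1/2 :: real) ^ h / 4" by simp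
  then obtain m \<phi> where \<phi>: "phase \<phi>" "dg (vs m) (Suc (Suc e')) \<phi>" "(1/2) ^ h \<le> av (vs m) \<phi>"
      "corr_bound (vs m) (Suc e') \<phi> ((1/2) ^ h + (1/2) ^ h / 4)"
    using tower[where e = e' and h = h and \<epsilon> = "(1/2) ^ h / 4", OF good_exists] by blast
  have sq: "(u + u / 4)\<^sup>2 = u * u * (25 / 16)" for u :: real by (simp add: power2_eq_square field_simps)
  have "real (2 * h) \<le> real (3 * k + 2)" by (intro of_nat_mono) (simp add: h_def)
  then have "thr k \<le> (1/2) ^ h" unfolding thr_def half_powr by (intro powr_mono) auto
  then have 1: "thr k \<le> \<bar>av (vs m) \<phi>\<bar>" using \<phi>(3) by linarith
  have "\<not> detby (vs m) (Suc e') (3 * k) \<phi>"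
  proof
    assume "detby (vs m) (Suc e') (3 * k) \<phi>"
    then have "1 \<le> 2 ^ (3 * k) * ((1/2) ^ h + (1/2) ^ h / 4 :: real)\<^sup>2" by (rule corr_detby[OF sg_vs \<phi>(1,4)])
    also have "\<dots> = 2 ^ (3 * k) * ((1/2) ^ (2 * h)) * (25 / 16)"
      by (simp only: sq mult_2 power_add mult.assoc)
    also have "\<dots> \<le> 2 ^ (3 * k) * ((1/2) ^ (3 * k + 1)) * (25 / 16 :: real)"
      by (intro mult_right_mono mult_left_mono power_decreasing) (auto simp: h_def)
    also have "\<dots> = 25 / 32" by (simp add: power_one_over)
    finally show False by simp
  qed
  then show ?thesis using \<phi>(1,2) 1 unfolding hard_def e' by blast
qed

text \<open>\<open>c\<close> is an arbitrary bound and need not be monotone in the bias. The exact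
  worst case is, and it grows by at least one with each \<open>k\<close>; it serves as the minorant
  of the function given to psi.\<close>

definition worst_rank :: "nat \<Rightarrow> nat \<Rightarrow> nat" where "worst_rank e k = (LEAST N. \<not> hard e (thr k) N)"

lemma worst_rank:
  assumes KL: "KL_bound c" and e: "1 \<le> e"
  shows "\<not> hard e (thr k) (worst_rank e k)" "\<And>j. j < worst_rank e k \<Longrightarrow> hard e (thr k) j" "3 * k < worst_rank e k"
    "Suc (worst_rank e k) \<le> worst_rank e (Suc k)" "Suc (worst_rank e k) \<le> c (Suc e) (thr k / 2)"
proof -
  have ex: "\<exists>N. \<not> hard e (thr k) N" for k using hard_KL[OF KL e thr_pos] by blast
  have 1: "\<not> hard e (thr k) (worst_rank e k)" for k unfolding worst_rank_def by (rule LeastI_ex[OF ex])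
  have 2: "hard e (thr k) j" if "j < worst_rank e k" for j k using not_less_Least[OF that[unfolded worst_rank_def]] by blast
  have 3: "3 * k < worst_rank e k" for k using hard_tower[OF e, of k] 1[of k] hard_mono[of e "thr k" "3 * k" "thr k" "worst_rank e k"] by force
  have 4: "hard e (thr k / 2) (worst_rank e k)" for k
  proof -
    have "hard e (thr k) (worst_rank e k - 1)" using 3[of k] by (intro 2) simp
    then have "hard e (thr k / 2) (Suc (worst_rank e k - 1))" by (rule hard_Suc[OF e])
    then show ?thesis using 3[of k] by simp
  qed
  show "\<not> hard e (thr k) (worst_rank e k)" "3 * k < worst_rank e k" by (rule 1, rule 3)
  show "j < worst_rank e k \<Longrightarrow> hard e (thr k) j" for j by (rule 2)
  have "hard e (thr (Suc k)) (worst_rank e k)" by (rule hard_mono[OF 4 thr_Suc]) simp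
  then show "Suc (worst_rank e k) \<le> worst_rank e (Suc k)" using 1[of "Suc k"] hard_mono[of e "thr (Suc k)" "worst_rank e k" "thr (Suc k)" "worst_rank e (Suc k)"] by force
  show "Suc (worst_rank e k) \<le> c (Suc e) (thr k / 2)" using hard_KL[OF KL e _ 4] thr_pos[of k] by (simp add: Suc_le_eq)
qed

lemma wr_add: assumes "KL_bound c" "1 \<le> e" shows "worst_rank e k + j \<le> worst_rank e (k + j)"
proof (induction j)
  case (Suc j)
  then show ?case using worst_rank(4)[OF assms, of "k + j"] by simp
qed simp

lemma wr_mono: assumes "KL_bound c" "1 \<le> e" "k \<le> k'" shows "worst_rank e k \<le> worst_rank e k'"
  using wr_add[OF assms(1,2), of k "k' - k"] assms(3) by simp

section \<open>Removing one member of a biased product\<close>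

lemma fam_of_phases:
  assumes "\<forall>i<k. phase (\<psi> i)" "\<forall>i<k. dg V e (\<psi> i)" "1 \<le> e"
  defines "M \<equiv> (\<lambda>i::nat. (\<psi> i, e, 0 :: nat)) ` {..<k}"
  shows "wf_fam V M" "\<forall>p\<in>M. lev p = e" "card M \<le> k" "\<And>x y. \<forall>p\<in>M. ph p x = ph p y \<Longrightarrow> i < k \<Longrightarrow> \<psi> i x = \<psi> i y"
proof -
  show "card M \<le> k" unfolding M_def using card_image_le[of "{..<k}"] by fastforce
qed (use assms in \<open>auto simp: wf_fam_def\<close>)

lemma prod_cancel_det:
  assumes T: "finite T" "p0 \<in> T" and ph: "\<And>p. p \<in> T \<Longrightarrow> phase (ph p)"
    and eq: "(\<Prod>p\<in>T. ph p x) = (\<Prod>p\<in>T. ph p y)" "\<forall>p\<in>T - {p0}. ph p x = ph p y"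
  shows "ph p0 x = ph p0 y"
proof -
  let ?Q = "\<lambda>z. \<Prod>p\<in>T - {p0}. ph p z"
  have "?Q x = ?Q y" using eq(2) by (intro prod.cong) auto
  moreover have "phase ?Q" using ph by (intro phase_prod) auto
  then have "?Q y \<noteq> 0" unfolding phase_def by (metis one_neq_zero zero_neq_neg_one)
  ultimately show ?thesis using eq(1) T by (simp add: prod.remove)
qed

lemma top_elim:
  assumes KL: "KL_bound c" and e: "1 \<le> e"
    and F: "wf_fam (vs m) F" "\<forall>p\<in>F. lev p \<le> Suc e" and T: "T \<subseteq> F" "p0 \<in> T"
    and big: "thr (card F) \<le> \<bar>av (vs m) (\<lambda>x. \<Prod>p\<in>T. ph p x)\<bar>"
  shows "\<exists>M. wf_fam (vs m) M \<and> (\<forall>p\<in>M. lev p = e) \<and> card M \<le> worst_rank e (card F) \<and> refn (vs m) F (F - {p0} \<union> M)"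
proof -
  have fT: "finite T" using F T finite_subset by (auto simp: wf_fam_def)
  have T': "phase (ph p)" "dg (vs m) (Suc e) (ph p)" if "p \<in> T" for p
  proof -
    have p: "phase (ph p)" "dg (vs m) (lev p) (ph p)" "lev p \<le> Suc e" using that F T(1) unfolding wf_fam_def by blast+
    show "phase (ph p)" by (rule p(1))
    show "dg (vs m) (Suc e) (ph p)" by (rule dg_mono[OF sg_vs p(2,3)])
  qed
  have pp: "phase (\<lambda>x. \<Prod>p\<in>T. ph p x)" using T'(1) by (rule phase_prod)
  have pd: "dg (vs m) (Suc e) (\<lambda>x. \<Prod>p\<in>T. ph p x)" using T'(2) by (rule dg_prod[OF sg_vs])
  have "detby (vs m) e (worst_rank e (card F)) (\<lambda>x. \<Prod>p\<in>T. ph p x)"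
  proof (rule ccontr)
    assume "\<not> ?thesis"
    then have "hard e (thr (card F)) (worst_rank e (card F))" unfolding hard_def using pp pd big by (intro exI conjI)
    then show False using worst_rank(1)[OF KL e] by simp
  qed
  then obtain \<psi> where \<psi>: "\<And>i. i < worst_rank e (card F) \<Longrightarrow> phase (\<psi> i)" "\<And>i. i < worst_rank e (card F) \<Longrightarrow> dg (vs m) e (\<psi> i)"
    "\<And>x y. x \<in> vs m \<Longrightarrow> y \<in> vs m \<Longrightarrow> (\<forall>i<worst_rank e (card F). \<psi> i x = \<psi> i y) \<Longrightarrow> (\<Prod>p\<in>T. ph p x) = (\<Prod>p\<in>T. ph p y)"
    unfolding detby_def by blast
  have \<psi>': "\<forall>i<worst_rank e (card F). phase (\<psi> i)" "\<forall>i<worst_rank e (card F). dg (vs m) e (\<psi> i)" using \<psi>(1,2) by blast+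
  note M = fam_of_phases[where k = "worst_rank e (card F)" and \<psi> = \<psi> and V = "vs m" and e = e, OF \<psi>' e]
  let ?M = "(\<lambda>i. (\<psi> i, e, 0)) ` {..<worst_rank e (card F)}"
  have rf: "refn (vs m) F (F - {p0} \<union> ?M)" unfolding refn_def
  proof (intro ballI impI)
    fix x y p assume xy: "x \<in> vs m" "y \<in> vs m" and eq: "\<forall>p\<in>F - {p0} \<union> ?M. ph p x = ph p y" and p: "p \<in> F"
    have eM: "\<forall>p\<in>?M. ph p x = ph p y" and eT: "\<forall>p\<in>T - {p0}. ph p x = ph p y" using eq T(1) by blast+
    have pq: "(\<Prod>p\<in>T. ph p x) = (\<Prod>p\<in>T. ph p y)"
      by (rule \<psi>(3)[OF xy], intro allI impI) (rule M(4)[OF eM])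
    have "ph p0 x = ph p0 y" by (rule prod_cancel_det[OF fT T(2) _ pq eT]) (rule T'(1))
    then show "ph p x = ph p y" using eq p by blast
  qed
  show ?thesis by (intro exI[of _ ?M] conjI M(1-3) rf)
qed

text \<open>A phase of degree at most 1 is constant or changes sign everywhere under some shift; in
  the second case its mean is 0. So a biased product is constant and \<open>p0\<close> is determined
  by its other factors.\<close>

lemma linear_elim:
  assumes V: "elem2 V" and F: "wf_fam V F" and T: "T \<subseteq> F" "p0 \<in> T" "\<forall>p\<in>T. lev p \<le> 1"
    and big: "0 < \<bar>av V (\<lambda>x. \<Prod>p\<in>T. ph p x)\<bar>"
  shows "refn V F (F - {p0})"
proof -
  let ?\<phi> = "\<lambda>x. \<Prod>p\<in>T. ph p x"
  have fT: "finite T" using F T finite_subset by (auto simp: wf_fam_def)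
  have T': "phase (ph p)" "dg V 1 (ph p)" if "p \<in> T" for p
  proof -
    have p: "phase (ph p)" "dg V (lev p) (ph p)" "lev p \<le> 1" using that F T(1,3) unfolding wf_fam_def by blast+
    show "phase (ph p)" by (rule p(1))
    show "dg V 1 (ph p)" by (rule dg_mono[OF V p(2,3)])
  qed
  have ph: "phase ?\<phi>" using T'(1) by (rule phase_prod)
  have dg: "dg V 1 ?\<phi>" using T'(2) by (rule dg_prod[OF V])
  have const: "?\<phi> x = ?\<phi> y" if xy: "x \<in> V" "y \<in> V" for x y
  proof (rule ccontr)
    assume ne: "?\<phi> x \<noteq> ?\<phi> y"
    have h: "x + y \<in> V" by (rule sgD(4)[OF V xy])
    have d: "dg V 0 (der (x + y) ?\<phi>)" using dg h by (simp del: dg.simps(1))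
    have "x + (x + y) = y" by (rule sg_cancel(2)[OF V xy(1)])
    then have "der (x + y) ?\<phi> x = ?\<phi> y * ?\<phi> x" by (simp only: der_def)
    also have "\<dots> = -1" using ne ph unfolding phase_def by (metis mult.right_neutral mult_minus1 mult.commute)
    finally have m1: "der (x + y) ?\<phi> z = -1" if "z \<in> V" for z
      using d[unfolded dg.simps(1), rule_format, OF that xy(1)] by simp
    have "av V ?\<phi> = av V (\<lambda>z. ?\<phi> (z + (x + y)))" by (rule av_shift[OF V h, symmetric])
    also have "\<dots> = av V (\<lambda>z. (-1) * ?\<phi> z)"
    proof (rule av_cong[OF refl])
      fix z assume z: "z \<in> V"
      have "?\<phi> (z + (x + y)) * ?\<phi> z = -1" using m1[OF z] by (simp add: der_def)
      then show "?\<phi> (z + (x + y)) = (-1) * ?\<phi> z" using ph unfolding phase_def by (metis mult.right_neutral mult_minus1_right minus_minus)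
    qed
    also have "\<dots> = (-1) * av V ?\<phi>" by (rule av_cmult)
    finally show False using big by simp
  qed
  show ?thesis unfolding refn_def
  proof (intro ballI impI)
    fix x y p assume xy: "x \<in> V" "y \<in> V" and eq: "\<forall>p\<in>F - {p0}. ph p x = ph p y" and p: "p \<in> F"
    have eT: "\<forall>p\<in>T - {p0}. ph p x = ph p y" using eq T(1) by blast
    have "ph p0 x = ph p0 y" by (rule prod_cancel_det[OF fT T(2) _ const[OF xy] eT]) (rule T'(1))
    then show "ph p x = ph p y" using eq p by blast
  qed
qed

lemma psi_base: "psi f [x, 0] = x" "psi f [x] = x"
  by (subst psi.simps, auto simp: less_Suc_eq)+

lemma linear_case:
  assumes V: "elem2 V"
  shows "wf_fam V F \<Longrightarrow> \<forall>p\<in>F. lev p \<le> 1 \<Longrightarrow>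
     (\<And>x y. x \<in> V \<Longrightarrow> y \<in> V \<Longrightarrow> \<forall>p\<in>F. ph p x = ph p y \<Longrightarrow> P x = P y) \<Longrightarrow>
     card F \<le> r \<Longrightarrow> (1/2) ^ r / 12 \<le> \<bar>pr V P - 1 / 3\<bar>"
proof (induction "card F" arbitrary: F rule: less_induct)
  case less
  note P = less(4)
  have fin: "finite F" using less(2) by (simp add: wf_fam_def)
  show ?case
  proof (cases "unbiased V F (card F)")
    case True
    have "(1/2 :: real) ^ r \<le> (1/2) ^ card F" using less(5) by (intro power_decreasing) auto
    moreover have "(1/2) ^ card F / 12 \<le> \<bar>pr V P - 1 / 3\<bar>" by (rule final_estimate[OF V less(2) True]) (rule P)
    ultimately show ?thesis by linarith
  next
    case False
    then obtain T p0 where T: "T \<subseteq> F" "p0 \<in> T" "thr (card F) \<le> \<bar>av V (\<lambda>x. \<Prod>p\<in>T. ph p x)\<bar>"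
      unfolding unbiased_def by (meson not_le_imp_less all_not_in_conv)
    have ref: "refn V F (F - {p0})"
      by (rule linear_elim[OF V less(2) T(1,2)]) (use T less(3) thr_pos[of "card F"] in force)+
    have cl: "card (F - {p0}) < card F" using T fin by (intro psubset_card_mono) auto
    show ?thesis
    proof (rule less(1)[OF cl])
      show "wf_fam V (F - {p0})" using less(2) by (simp add: wf_fam_def)
      show "\<forall>p\<in>F - {p0}. lev p \<le> 1" using less(3) by blast
      show "card (F - {p0}) \<le> r" using cl less(5) by simp
      show "P x = P y" if xy: "x \<in> V" "y \<in> V" and eq: "\<forall>p\<in>F - {p0}. ph p x = ph p y" for x y
      proof (rule P[OF xy])
        show "\<forall>p\<in>F. ph p x = ph p y" using ref xy eq unfolding refn_def by blast
      qed
    qed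
  qed
qed

text \<open>A biased product of linear members removes one of them and adds nothing, so only
  eliminations at degree 2 consume a unit of psi; the size of \<open>F\<close> is the second
  component of the induction.\<close>

lemma quadratic_case:
  assumes KL: "KL_bound c" and f: "\<And>k. Suc (worst_rank 1 k) \<le> f k"
  shows "wf_fam (vs m) F \<Longrightarrow> \<forall>p\<in>F. lev p \<le> 2 \<Longrightarrow>
     (\<And>x y. x \<in> vs m \<Longrightarrow> y \<in> vs m \<Longrightarrow> \<forall>p\<in>F. ph p x = ph p y \<Longrightarrow> P x = P y) \<Longrightarrow>
     card {p\<in>F. lev p = 2} \<le> s \<Longrightarrow> card F \<le> x0 + s \<Longrightarrow> (1/2) ^ psi f [x0, s] / 12 \<le> \<bar>pr (vs m) P - 1 / 3\<bar>"
proof (induction "(s, card F)" arbitrary: s F x0 rule: wf_induct_rule[OF wf_lex_prod[OF wf_less_than wf_less_than]])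
  case (1 s F x0)
  note IH = 1(1) and F = 1(2,3) and P = 1(4) and s = 1(5) and cF = 1(6)
  have fin: "finite F" using F by (simp add: wf_fam_def)
  have f1: "1 \<le> f k" for k using f[of k] by simp
  have refP: "P x = P y" if "refn (vs m) F F'" "x \<in> vs m" "y \<in> vs m" "\<forall>p\<in>F'. ph p x = ph p y" for F' x y
  proof (rule P[OF that(2,3)])
    show "\<forall>p\<in>F. ph p x = ph p y" using that unfolding refn_def by blast
  qed
  show ?case
  proof (cases "unbiased (vs m) F (card F)")
    case True
    have "card F \<le> psi f [x0, s]" using psi_ge_sum[where f = f, OF f1, of "[x0, s]"] cF by simp
    then have "(1/2 :: real) ^ psi f [x0, s] \<le> (1/2) ^ card F" by (intro power_decreasing) auto
    moreover have "(1/2) ^ card F / 12 \<le> \<bar>pr (vs m) P - 1 / 3\<bar>" by (rule final_estimate[OF sg_vs F(1) True]) (rule P)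
    ultimately show ?thesis by linarith
  next
    case False
    then obtain T where T: "T \<subseteq> F" "T \<noteq> {}" "thr (card F) \<le> \<bar>av (vs m) (\<lambda>x. \<Prod>p\<in>T. ph p x)\<bar>"
      unfolding unbiased_def by (meson not_le_imp_less)
    show ?thesis
    proof (cases "\<exists>p0\<in>T. lev p0 = 2")
      case True
      then obtain p0 where p0: "p0 \<in> T" "lev p0 = 2" by blast
      obtain M where M: "wf_fam (vs m) M" "\<forall>p\<in>M. lev p = 1" "card M \<le> worst_rank 1 (card F)" "refn (vs m) F (F - {p0} \<union> M)"
        using top_elim[OF KL order_refl F(1) _ T(1) p0(1) T(3)] F(2) by (auto simp: numeral_2_eq_2)
      have fM: "finite M" using M(1) by (simp add: wf_fam_def)
      have top: "{p\<in>F - {p0} \<union> M. lev p = 2} = {p\<in>F. lev p = 2} - {p0}" using M(2) by auto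
      have "p0 \<in> {p\<in>F. lev p = 2}" using p0 T(1) by auto
      then have c2: "card ({p\<in>F. lev p = 2} - {p0}) < card {p\<in>F. lev p = 2}" using fin by (intro psubset_card_mono) auto
      obtain y where y: "s = Suc y" using s c2 by (cases s) auto
      have "card (F - {p0} \<union> M) \<le> card (F - {p0}) + card M" by (rule card_Un_le)
      also have "card (F - {p0}) = card F - 1" using p0 T(1) fin by (auto simp: card_Diff_singleton)
      also have "card M \<le> f (x0 + s) - 1" using M(3) wr_mono[OF KL order_refl cF] f[of "x0 + s"] by simp
      finally have cM: "card (F - {p0} \<union> M) \<le> x0 + f (x0 + Suc y) + y" using cF y by simp
      have "(1/2) ^ psi f [x0 + f (x0 + Suc y), y] / 12 \<le> \<bar>pr (vs m) P - 1 / 3\<bar>"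
      proof (rule IH)
        show "((y, card (F - {p0} \<union> M)), (s, card F)) \<in> less_than <*lex*> less_than" using y by simp
        show "wf_fam (vs m) (F - {p0} \<union> M)" using F(1) M(1) by (auto simp: wf_fam_def)
        show "\<forall>p\<in>F - {p0} \<union> M. lev p \<le> 2" using F(2) M(2) by auto
        show "card {p\<in>F - {p0} \<union> M. lev p = 2} \<le> y" unfolding top using c2 s y by simp
        show "P a = P b" if "a \<in> vs m" "b \<in> vs m" "\<forall>p\<in>F - {p0} \<union> M. ph p a = ph p b" for a b
          by (rule refP[OF M(4) that])
      qed (rule cM)
      moreover have "psi f [x0, s] = psi f [x0 + f (x0 + Suc y), y]" using psi_step_0[of f x0 y "[]"] unfolding y by simp
      ultimately show ?thesis by simp
    next
      case no: False
      obtain p0 where p0: "p0 \<in> T" using T(2) by blast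
      have "lev p \<le> 1" if "p \<in> T" for p
      proof -
        have "lev p \<le> 2" "lev p \<noteq> 2" using that T(1) F(2) no by blast+
        then show ?thesis by simp
      qed
      then have ref: "refn (vs m) F (F - {p0})"
        using T(3) thr_pos[of "card F"] by (intro linear_elim[OF sg_vs F(1) T(1) p0]) auto
      have cl: "card (F - {p0}) < card F" using T(1) p0 fin by (intro psubset_card_mono) auto
      show ?thesis
      proof (rule IH)
        show "((s, card (F - {p0})), (s, card F)) \<in> less_than <*lex*> less_than" using cl by simp
        show "wf_fam (vs m) (F - {p0})" using F(1) by (simp add: wf_fam_def)
        have "card {p\<in>F - {p0}. lev p = 2} \<le> card {p\<in>F. lev p = 2}" using fin by (intro card_mono) auto
        then show "card {p\<in>F - {p0}. lev p = 2} \<le> s" using s by simp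
        show "P a = P b" if "a \<in> vs m" "b \<in> vs m" "\<forall>p\<in>F - {p0}. ph p a = ph p b" for a b
          by (rule refP[OF ref that])
        show "\<forall>p\<in>F - {p0}. lev p \<le> 2" using F(2) by blast
        show "card (F - {p0}) \<le> x0 + s" using cl cF by simp
      qed
    qed
  qed
qed

text \<open>The first elimination is done by hand. At the start the list of psi has sum
  \<open>r\<close>, too small for the invariant of \<open>descent\<close>, which compares the sum
  with \<open>h (card F)\<close>. After one elimination and one further unit spent the sum is large
  enough, and no members below \<open>e\<close> exist yet.\<close>

lemma high_degree_case:
  assumes KL: "KL_bound c" and e: "2 \<le> e" and f: "\<And>k. Suc (worst_rank e k) \<le> f k"
    and F: "wf_fam (vs m) F" "\<forall>p\<in>F. lev p = Suc e" "card F \<le> r" and r: "1 \<le> r"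
    and P: "\<And>x y. x \<in> vs m \<Longrightarrow> y \<in> vs m \<Longrightarrow> \<forall>p\<in>F. ph p x = ph p y \<Longrightarrow> P x = P y"
  shows "(1/2) ^ psi f (replicate e 0 @ [r]) / 12 \<le> \<bar>pr (vs m) P - 1 / 3\<bar>"
proof -
  have e1: "1 \<le> e" using e by simp
  have fin: "finite F" using F by (simp add: wf_fam_def)
  define f0 where "f0 k = Suc (worst_rank e k)" for k
  have flf: "fl k \<le> f0 k" for k using worst_rank(3)[OF KL e1, of k] by (simp add: fl_def f0_def)
  have ff: "f0 k \<le> f k" for k using f by (simp add: f0_def)
  have f1: "1 \<le> f k" for k using f[of k] by simp
  have flff: "fl k \<le> f k" for k using flf ff order_trans by blast
  have rep: "replicate e 0 @ [r] = (0 # replicate (Suc (e - 2)) 0) @ (Suc (r - 1) # [])"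
  proof -
    have "e = Suc (Suc (e - 2))" using e by simp
    then have "replicate e (0::nat) = 0 # replicate (Suc (e - 2)) 0" by (metis replicate_Suc)
    then show ?thesis using r by simp
  qed
  show ?thesis
  proof (cases "unbiased (vs m) F (card F)")
    case True
    have "card F \<le> psi f (replicate e 0 @ [r])" using psi_ge_sum[where f = f, OF f1, of "replicate e 0 @ [r]"] F(3) by (simp add: sum_list_replicate)
    then have "(1/2 :: real) ^ psi f (replicate e 0 @ [r]) \<le> (1/2) ^ card F" by (intro power_decreasing) auto
    moreover have "(1/2) ^ card F / 12 \<le> \<bar>pr (vs m) P - 1 / 3\<bar>" by (rule final_estimate[OF sg_vs F(1) True]) (rule P)
    ultimately show ?thesis by linarith
  next
    case False
    then obtain T where T: "T \<subseteq> F" "T \<noteq> {}" "thr (card F) \<le> \<bar>av (vs m) (\<lambda>x. \<Prod>p\<in>T. ph p x)\<bar>"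
      unfolding unbiased_def by (meson not_le_imp_less)
    obtain p0 where p0: "p0 \<in> T" using T(2) by blast
    have te: "\<exists>M. wf_fam (vs m) M \<and> (\<forall>p\<in>M. lev p = e) \<and> Suc (card M) \<le> f0 (card F) \<and> refn (vs m) F (F - {p0} \<union> M)"
      if "wf_fam (vs m) F" "\<forall>p\<in>F. lev p \<le> Suc e" "T \<subseteq> F" "p0 \<in> T" "thr (card F) \<le> \<bar>av (vs m) (\<lambda>x. \<Prod>p\<in>T. ph p x)\<bar>" for F T p0
      using top_elim[OF KL e1 that] unfolding f0_def by simp
    obtain M where M: "wf_fam (vs m) M" "\<forall>p\<in>M. lev p = e" "Suc (card M) \<le> f0 (card F)" "refn (vs m) F (F - {p0} \<union> M)"
      using te[OF F(1) _ T(1) p0 T(3)] F(2) by auto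
    define F1 where "F1 = F - {p0} \<union> M"
    have fM: "finite M" using M(1) by (simp add: wf_fam_def)
    have cF: "card (F - {p0}) \<le> r - 1" "p0 \<in> F" using p0 T(1) fin F(3) by (auto simp: card_Diff_singleton)
    have cM: "Suc (card M) \<le> f r"
    proof -
      have "Suc (card M) \<le> f0 (card F)" by (rule M(3))
      also have "\<dots> \<le> f0 r" unfolding f0_def using wr_mono[OF KL e1 F(3)] by simp
      finally show ?thesis using ff[of r] by simp
    qed
    have "psi f (replicate e 0 @ [r]) = psi f ((0 # replicate (e - 2) 0) @ (f r # (r - 1) # []))"
      unfolding rep using psi_step_Suc[of f 0 "e - 2" "r - 1" "[]"] r by simp
    moreover obtain x where x: "psi f ((0 # replicate (e - 2) 0) @ (Suc (f r - 1) # [r - 1])) = psi f ((x # replicate (e - 2) 0) @ ((f r - 1) # [r - 1]))"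
      "al fl (e - 2) (0 + Suc (f r - 1) + sum_list [r - 1]) \<le> x + (f r - 1) + sum_list [r - 1]"
      using psi_run[OF fl(1,2) flff, of 0 "e - 2" "f r - 1" "[r - 1]"] by blast
    ultimately have psi: "psi f (replicate e 0 @ [r]) = psi f ((x # replicate (e - 2) 0) @ [f r - 1, r - 1])" using f1[of r] by simp
    \<comment> \<open>The sum of the list right after the first step; the unit spent next raises it
      to at least \<open>al fl (e - 2) Y\<close>, which exceeds \<open>h\<close> of any size below
      \<open>Y\<close>.\<close>
    define Y where "Y = f r + (r - 1)"
    have Y4: "4 \<le> Y"
    proof -
      have "4 \<le> fl r" using r by (simp add: fl_def)
      then show ?thesis using flff[of r] by (simp add: Y_def)
    qed
    have xY: "al fl (e - 2) Y \<le> x + (f r - 1) + (r - 1)" using x(2) f1[of r] by (simp add: Y_def)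
    have cF1: "card F1 \<le> Y - 1" unfolding F1_def Y_def using card_Un_le[of "F - {p0}" M] cF(1) cM by linarith
    define h where "h = (if e = 2 then (\<lambda>S. S + 4) else size_bound e)"
    have h: "mono h" "Suc S \<le> h S" "h (beta e S) \<le> al fl (e - 2) (h S)"
       "4 \<le> Y' \<Longrightarrow> h (Y' - 1) \<le> al fl (e - 2) Y'" "2 \<le> S \<Longrightarrow> 2 * S \<le> al fl (e - 2) S" for S Y'
    proof -
      have c: "(mono h \<and> Suc S \<le> h S \<and> h (beta e S) \<le> al fl (e - 2) (h S)) \<and>
       (4 \<le> Y' \<longrightarrow> h (Y' - 1) \<le> al fl (e - 2) Y') \<and> (2 \<le> S \<longrightarrow> 2 * S \<le> al fl (e - 2) S)"
      proof (cases "e = 2")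
        case True
        then have e2: "e - 2 = 0" "h = (\<lambda>S. S + 4)" by (auto simp: h_def)
        show ?thesis unfolding e2 using True growth_2[of S] growth_2(3)[of Y'] by (simp add: mono_def del: al.simps)
      next
        case False
        then have e3: "3 \<le> e" and size_bound: "h = size_bound e" using e by (auto simp: h_def)
        show ?thesis unfolding size_bound using growth_ge_3(1-3,5)[OF e3] growth_ge_3(4)[OF e3, of Y'] by (intro conjI impI)
      qed
      show "mono h" by (rule conjunct1[OF conjunct1[OF c]])
      show "Suc S \<le> h S" by (rule conjunct1[OF conjunct2[OF conjunct1[OF c]]])
      show "h (beta e S) \<le> al fl (e - 2) (h S)" by (rule conjunct2[OF conjunct2[OF conjunct1[OF c]]])
      show "4 \<le> Y' \<Longrightarrow> h (Y' - 1) \<le> al fl (e - 2) Y'" by (rule mp[OF conjunct1[OF conjunct2[OF c]]])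
      show "2 \<le> S \<Longrightarrow> 2 * S \<le> al fl (e - 2) S" by (rule mp[OF conjunct2[OF conjunct2[OF c]]])
    qed
    show ?thesis unfolding psi
    proof (rule descent[OF sg_vs e fl(1,2) flf ff _ _ h, where F = F1 and b = 0])
      show "f0 k + j \<le> f0 (k + j)" for k j using wr_add[OF KL e1, of k j] by (simp add: f0_def)
      show "4 \<le> f0 1" using flf[of 1] by (simp add: fl_def)
      show "wf_fam (vs m) F1" using F(1) M(1) by (auto simp: wf_fam_def F1_def)
      show "\<forall>p\<in>F1. lev p \<le> Suc e" using F(2) M(2) by (auto simp: F1_def)
      show "P a = P b" if "a \<in> vs m" "b \<in> vs m" "\<forall>p\<in>F1. ph p a = ph p b" for a b
      proof -
        have "\<forall>p\<in>F. ph p a = ph p b" using M(4) that unfolding refn_def F1_def by blast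
        then show ?thesis by (rule P[OF that(1,2)])
      qed
      have em: "{p\<in>F1. lev p < e} = {}" using F(2) M(2) by (auto simp: F1_def)
      show "unbiased (vs m) {p\<in>F1. lev p < e} (card F1)" unfolding em unbiased_def by blast
      have "{p\<in>F1. lev p = Suc e} \<subseteq> F - {p0}" using M(2) by (auto simp: F1_def)
      then show "card {p\<in>F1. lev p = Suc e} \<le> r - 1" using cF(1) card_mono[of "F - {p0}"] fin by (meson finite_Diff le_trans)
      have "{p\<in>F1. lev p = e} \<subseteq> M" using F(2) by (auto simp: F1_def)
      then have "card {p\<in>F1. lev p = e} \<le> card M" by (rule card_mono[OF fM])
      then show "card {p\<in>F1. lev p = e} + 0 \<le> f r - 1" using cM by linarith
      have "h (card F1) \<le> h (Y - 1)" using h(1) cF1 by (rule monoD)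
      also have "\<dots> \<le> al fl (e - 2) Y" by (rule h(4)[OF Y4])
      finally show "h (card F1) \<le> x + (f r - 1) + (r - 1)" using xY by simp
    qed (assumption, assumption, (rule te; assumption))
  qed
qed

theorem theorem6p4:
  fixes c :: "nat \<Rightarrow> real \<Rightarrow> nat"
    and d r m :: nat
    and P :: "nat set \<Rightarrow> bool"
  assumes KL: "KL_bound c"
    and d_pos: "d > 0" and r_pos: "r > 0"
    and nonzero: "\<exists>x \<in> points m. P x"
    and rank: "rank_deg m d P = r"
  shows "\<bar>prob_one m P - 1 / 3\<bar> \<ge>
           (1 / 2) ^ psi_star d (\<lambda>k. c d ((1 / 4) * 2 powr (- (3 * real k / 2)))) r / 12"
proof -
  define f where "f = (\<lambda>k. c d ((1 / 4) * 2 powr (- (3 * real k / 2))))"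
  obtain e where e: "d = Suc e" using d_pos by (cases d) auto
  \<comment> \<open>The bias in the theorem is half of \<open>thr k\<close>, which matches the bias
    lost by one gate.\<close>
  have fk: "f k = c (Suc e) (thr k / 2)" for k
    unfolding f_def e thr_def by (simp add: powr_diff)
  have "detby (vs m) d r (pz P)" by (rule rank_detby[OF rank rank_exists]) (use d_pos in simp)
  then obtain \<psi> where \<psi>: "\<And>i. i < r \<Longrightarrow> phase (\<psi> i)" "\<And>i. i < r \<Longrightarrow> dg (vs m) d (\<psi> i)"
    "\<And>x y. x \<in> vs m \<Longrightarrow> y \<in> vs m \<Longrightarrow> (\<forall>i<r. \<psi> i x = \<psi> i y) \<Longrightarrow> pz P x = pz P y"
    unfolding detby_def by blast
  have d1: "1 \<le> d" using d_pos by simp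
  \<comment> \<open>Stage 0 is admissible at every level; \<open>regularize\<close> assigns the
    stages anew.\<close>
  define F where "F = (\<lambda>i::nat. (\<psi> i, d, 0 :: nat)) ` {..<r}"
  have \<psi>': "\<forall>i<r. phase (\<psi> i)" "\<forall>i<r. dg (vs m) d (\<psi> i)" using \<psi>(1,2) by blast+
  note F = fam_of_phases[where k = r and \<psi> = \<psi> and V = "vs m" and e = d, OF \<psi>' d1, folded F_def]
  have P: "P (supp x) = P (supp y)" if "x \<in> vs m" "y \<in> vs m" "\<forall>p\<in>F. ph p x = ph p y" for x y
  proof -
    have "pz P x = pz P y" using F(4)[OF that(3)] by (intro \<psi>(3)[OF that(1,2)]) blast
    then show ?thesis by (auto simp: pz_def split: if_splits)
  qed
  have "(1 / 2) ^ psi f (replicate e 0 @ [r]) / 12 \<le> \<bar>pr (vs m) (\<lambda>x. P (supp x)) - 1 / 3\<bar>"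
  proof -
    consider "e = 0" | "e = 1" | "2 \<le> e" by linarith
    then show ?thesis
    proof cases
      case 1
      have "psi f (replicate e 0 @ [r]) = r" using 1 psi_base(2)[of f r] by simp
      moreover have "(1 / 2) ^ r / 12 \<le> \<bar>pr (vs m) (\<lambda>x. P (supp x)) - 1 / 3\<bar>"
      proof (rule linear_case[OF sg_vs F(1) _ _ F(3)])
        show "\<forall>p\<in>F. lev p \<le> 1" using F(2) e 1 by simp
      qed (rule P)
      ultimately show ?thesis by simp
    next
      case 2
      have fw: "Suc (worst_rank 1 k) \<le> f k" for k unfolding fk using worst_rank(5)[OF KL order_refl, of k] 2 by simp
      have "card {p\<in>F. lev p = 2} \<le> r" using F(3) card_mono[of F "{p\<in>F. lev p = 2}"] by (auto simp: F_def intro: order_trans)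
      then have "(1 / 2) ^ psi f [0, r] / 12 \<le> \<bar>pr (vs m) (\<lambda>x. P (supp x)) - 1 / 3\<bar>"
      proof (intro quadratic_case[OF KL fw F(1)])
        show "\<forall>p\<in>F. lev p \<le> 2" using F(2) e 2 by simp
        show "card F \<le> 0 + r" using F(3) by simp
      qed (rule P)
      then show ?thesis using 2 by simp
    next
      case 3
      have fw: "Suc (worst_rank e k) \<le> f k" for k unfolding fk using worst_rank(5)[OF KL, of e k] 3 by simp
      show ?thesis
      proof (rule high_degree_case[OF KL 3 fw F(1) _ F(3)])
        show "\<forall>p\<in>F. lev p = Suc e" using F(2) e by simp
        show "1 \<le> r" using r_pos by simp
      qed (rule P)
    qed
  qed
  moreover have "psi_star d f r = psi f (replicate e 0 @ [r])" by (simp add: psi_star_def e)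
  ultimately show ?thesis unfolding prob_pr f_def[symmetric] by simp
qed

end
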